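(* Let $K$ be a finite simplicial complex of dimension greater than $p$. If the boundary matrix $[\partial_{p+1}]$ of $K$ is totally unimodular, then the optimal homologous chain problem for $p$-chains of $K$ can be solved in polynomial time.
   Context: Each simplex of $K$ is given an arbitrary fixed orientation, and chains have $\mathbb{Z}$ coefficients. Let $m$ and $n$ be the numbers of $p$- and $(p+1)$-simplices of $K$. $[\partial_{p+1}]$ is the $m\times n$ matrix of the simplicial boundary operator $\partial_{p+1}\colon C_{p+1}(K)\to C_p(K)$ in the bases of oriented simplices. An integer matrix is totally unimodular if every square submatrix has determinant $0$, $1$ or $-1$. A $p$-chain is identified with its coefficient vector in $\mathbb{Z}^m$. Two $p$-chains $\mathbf{c},\mathbf{c}'$ are homologous if $\mathbf{c}=\mathbf{c}'+[\partial_{p+1}]\mathbf{y}$ for some $\mathbf{y}\in\mathbb{Z}^n$. Optimal homologous chain problem (OHCP) for $p$-chains: given a $p$-chain $\mathbf{c}\in\mathbb{Z}^m$ and a real $m\times m$ diagonal matrix $W$ with diagonal entries $w_i$ (the weights of the $p$-simplices; zero or negative weights are allowed), solve $$\min_{\mathbf{x},\mathbf{y}}\ \|W\mathbf{x}\|_1\quad\text{such that}\quad \mathbf{x}=\mathbf{c}+[\partial_{p+1}]\,\mathbf{y},\ \ \mathbf{x}\in\mathbb{Z}^m,\ \mathbf{y}\in\mathbb{Z}^n,$$ where $\|W\mathbf{x}\|_1=\sum_i|w_i||x_i|$. Polynomial time means a number of arithmetic operations polynomial in the number of simplices. *)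

theory Defs
  imports
    "HOL-Computational_Algebra.Polynomial"
    "HOL-Combinatorics.Permutations"
    "Jordan_Normal_Form.Determinant"
    "Jordan_Normal_Form.DL_Submatrix"
begin

section \<open>Simplicial complexes, oriented simplices and boundary matrices\<close>

text \<open>Abstract simplicial complexes, whose vertices are named by natural numbers so that a complex
  can be handed to a machine. The empty set is not a simplex.\<close>

definition simplicial_complex :: "nat set set \<Rightarrow> bool" where
  "simplicial_complex K \<longleftrightarrow>
     (\<forall>s\<in>K. finite s \<and> s \<noteq> {}) \<and> (\<forall>s\<in>K. \<forall>t. t \<subseteq> s \<and> t \<noteq> {} \<longrightarrow> t \<in> K)"

text \<open>The dimension of the empty complex is \<open>-1\<close>.\<close>

definition complex_dim :: "nat set set \<Rightarrow> int" where
  "complex_dim K = int (Max (insert 0 (card ` K))) - 1"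

text \<open>An oriented simplex \<open>[v\<^sub>0, \<dots>, v\<^sub>p]\<close> is given by a list of its vertices without repetition.
  A list \<open>L\<close> as below enumerates the \<open>p\<close>-simplices of \<open>K\<close> and fixes an orientation of each of them,
  that is, it is an ordered basis of the chain group.\<close>

definition oriented_basis :: "nat set set \<Rightarrow> nat \<Rightarrow> nat list list \<Rightarrow> bool" where
  "oriented_basis K p L \<longleftrightarrow>
     (\<forall>l\<in>set L. distinct l) \<and> distinct (map set L) \<and> set ` set L = {s\<in>K. card s = p + 1}"

text \<open>The coefficient of the basis element \<open>l'\<close> in the chain \<open>l\<close>: reordering the vertices
  of an oriented simplex multiplies it by the sign of the permutation.\<close>

definition orientation_sign :: "nat list \<Rightarrow> nat list \<Rightarrow> int" where
  "orientation_sign l l' =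
     (if set l = set l'
      then sign (THE \<pi>. \<pi> permutes {..<length l} \<and> permute_list \<pi> l = l') else 0)"

text \<open>The coefficient of \<open>\<sigma>\<close> in
  \<open>\<partial>[v\<^sub>0, \<dots>, v\<^sub>q] = (\<Sum>k\<le>q. (-1)^k [v\<^sub>0, \<dots>, v\<^sub>k\<^sub>-\<^sub>1, v\<^sub>k\<^sub>+\<^sub>1, \<dots>, v\<^sub>q])\<close>.\<close>

definition boundary_coeff :: "nat list \<Rightarrow> nat list \<Rightarrow> int" where
  "boundary_coeff \<sigma> \<tau> =
     (\<Sum>k<length \<tau>. (-1) ^ k * orientation_sign (take k \<tau> @ drop (Suc k) \<tau>) \<sigma>)"

definition boundary_matrix :: "nat list list \<Rightarrow> nat list list \<Rightarrow> int mat" where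
  "boundary_matrix Ps Qs =
     mat (length Ps) (length Qs) (\<lambda>(i, j). boundary_coeff (Ps ! i) (Qs ! j))"

definition totally_unimodular :: "int mat \<Rightarrow> bool" where
  "totally_unimodular A \<longleftrightarrow>
     (\<forall>I J. I \<subseteq> {..<dim_row A} \<and> J \<subseteq> {..<dim_col A} \<and> card I = card J
        \<longrightarrow> det (submatrix A I J) \<in> {0, 1, -1})"

section \<open>The optimal homologous chain problem\<close>

definition ohcp_feasible :: "int mat \<Rightarrow> int vec \<Rightarrow> int vec \<Rightarrow> int vec \<Rightarrow> bool" where
  "ohcp_feasible B c x y \<longleftrightarrow>
     x \<in> carrier_vec (dim_row B) \<and> y \<in> carrier_vec (dim_col B) \<and> x = c + B *\<^sub>v y"

definition l1_norm :: "real vec \<Rightarrow> real" where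
  "l1_norm v = (\<Sum>i<dim_vec v. \<bar>v $ i\<bar>)"

definition ohcp_objective :: "real mat \<Rightarrow> int vec \<Rightarrow> real" where
  "ohcp_objective W x = l1_norm (W *\<^sub>v map_vec real_of_int x)"

definition ohcp_optimal :: "int mat \<Rightarrow> int vec \<Rightarrow> real mat \<Rightarrow> int vec \<Rightarrow> int vec \<Rightarrow> bool" where
  "ohcp_optimal B c W x y \<longleftrightarrow>
     ohcp_feasible B c x y \<and>
     (\<forall>x' y'. ohcp_feasible B c x' y' \<longrightarrow> ohcp_objective W x \<le> ohcp_objective W x')"

section \<open>A real random access machine\<close>

text \<open>Programs work on arrays of natural numbers, which also serve for indirect addressing,
  and on arrays of real numbers; the arrays are numbered by constants in the program text.
  The only operations on reals are \<open>+\<close>, \<open>-\<close>, \<open>*\<close>, \<open>/\<close> and comparison: there is no rounding and no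
  conversion from reals to natural numbers. Constants are integers, so that a program
  is a finite object.\<close>

type_synonym store = "(nat \<Rightarrow> nat \<Rightarrow> nat) \<times> (nat \<Rightarrow> nat \<Rightarrow> real)"

datatype iexp =
    IConst nat
  | IGet nat iexp
  | IAdd iexp iexp
  | ISub iexp iexp
  | IMul iexp iexp

datatype rexp =
    RConst int
  | RGet nat iexp
  | RAdd rexp rexp
  | RSub rexp rexp
  | RMul rexp rexp
  | RDiv rexp rexp

datatype bexp =
    ILess iexp iexp
  | RLess rexp rexp
  | BNot bexp
  | BAnd bexp bexp

datatype com =
    Skip
  | IPut nat iexp iexp
  | RPut nat iexp rexp
  | Seq com com
  | Cond bexp com com
  | Loop bexp com

text \<open>Subtraction of natural numbers is truncated; division of reals by \<open>0\<close> yields \<open>0\<close>.\<close>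

primrec ival :: "iexp \<Rightarrow> store \<Rightarrow> nat" where
  "ival (IConst k) s = k"
| "ival (IGet a e) s = fst s a (ival e s)"
| "ival (IAdd e f) s = ival e s + ival f s"
| "ival (ISub e f) s = ival e s - ival f s"
| "ival (IMul e f) s = ival e s * ival f s"

primrec rval :: "rexp \<Rightarrow> store \<Rightarrow> real" where
  "rval (RConst k) s = real_of_int k"
| "rval (RGet a e) s = snd s a (ival e s)"
| "rval (RAdd e f) s = rval e s + rval f s"
| "rval (RSub e f) s = rval e s - rval f s"
| "rval (RMul e f) s = rval e s * rval f s"
| "rval (RDiv e f) s = rval e s / rval f s"

primrec bval :: "bexp \<Rightarrow> store \<Rightarrow> bool" where
  "bval (ILess e f) s \<longleftrightarrow> ival e s < ival f s"
| "bval (RLess e f) s \<longleftrightarrow> rval e s < rval f s"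
| "bval (BNot b) s \<longleftrightarrow> \<not> bval b s"
| "bval (BAnd b c) s \<longleftrightarrow> bval b s \<and> bval c s"

text \<open>Every operation, whether arithmetic, comparison, memory access or control, costs one unit.\<close>

primrec icost :: "iexp \<Rightarrow> nat" where
  "icost (IConst k) = 1"
| "icost (IGet a e) = 1 + icost e"
| "icost (IAdd e f) = 1 + icost e + icost f"
| "icost (ISub e f) = 1 + icost e + icost f"
| "icost (IMul e f) = 1 + icost e + icost f"

primrec rcost :: "rexp \<Rightarrow> nat" where
  "rcost (RConst k) = 1"
| "rcost (RGet a e) = 1 + icost e"
| "rcost (RAdd e f) = 1 + rcost e + rcost f"
| "rcost (RSub e f) = 1 + rcost e + rcost f"
| "rcost (RMul e f) = 1 + rcost e + rcost f"
| "rcost (RDiv e f) = 1 + rcost e + rcost f"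

primrec bcost :: "bexp \<Rightarrow> nat" where
  "bcost (ILess e f) = 1 + icost e + icost f"
| "bcost (RLess e f) = 1 + rcost e + rcost f"
| "bcost (BNot b) = 1 + bcost b"
| "bcost (BAnd b c) = 1 + bcost b + bcost c"

definition iput :: "nat \<Rightarrow> nat \<Rightarrow> nat \<Rightarrow> store \<Rightarrow> store" where
  "iput a k v s = ((fst s)(a := (fst s a)(k := v)), snd s)"

definition rput :: "nat \<Rightarrow> nat \<Rightarrow> real \<Rightarrow> store \<Rightarrow> store" where
  "rput a k v s = (fst s, (snd s)(a := (snd s a)(k := v)))"

text \<open>\<open>exec prog s N t\<close>: started in \<open>s\<close>, the program halts in \<open>t\<close> after operations of total
  cost \<open>N\<close>.\<close>

inductive exec :: "com \<Rightarrow> store \<Rightarrow> nat \<Rightarrow> store \<Rightarrow> bool" where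
  Skip: "exec Skip s 1 s"
| IPut: "exec (IPut a e f) s (1 + icost e + icost f) (iput a (ival e s) (ival f s) s)"
| RPut: "exec (RPut a e f) s (1 + icost e + rcost f) (rput a (ival e s) (rval f s) s)"
| Seq: "exec P s M t \<Longrightarrow> exec Q t N u \<Longrightarrow> exec (Seq P Q) s (M + N) u"
| CondTrue: "bval b s \<Longrightarrow> exec P s N t \<Longrightarrow> exec (Cond b P Q) s (1 + bcost b + N) t"
| CondFalse: "\<not> bval b s \<Longrightarrow> exec Q s N t \<Longrightarrow> exec (Cond b P Q) s (1 + bcost b + N) t"
| LoopFalse: "\<not> bval b s \<Longrightarrow> exec (Loop b P) s (1 + bcost b) s"
| LoopTrue: "bval b s \<Longrightarrow> exec P s M t \<Longrightarrow> exec (Loop b P) t N u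
    \<Longrightarrow> exec (Loop b P) s (1 + bcost b + M + N) u"

section \<open>Input and output of the problem on the machine\<close>

definition cells :: "'a::zero list \<Rightarrow> nat \<Rightarrow> 'a" where
  "cells xs k = (if k < length xs then xs ! k else 0)"

text \<open>The machine is given the oriented simplices themselves, as vertex lists written one after
  the other, and not the boundary matrix.\<close>

definition ohcp_input ::
  "nat \<Rightarrow> nat list list \<Rightarrow> nat list list \<Rightarrow> int vec \<Rightarrow> real mat \<Rightarrow> store" where
  "ohcp_input p Ps Qs c W =
    ((\<lambda>a. if a = 0 then cells [p, length Ps, length Qs]
          else if a = 1 then cells (concat Ps)
          else if a = 2 then cells (concat Qs)
          else cells []),
     (\<lambda>a. if a = 0 then cells (map real_of_int (list_of_vec c))
          else if a = 1 then cells (diag_mat W)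
          else cells []))"

definition ohcp_output :: "store \<Rightarrow> int vec \<Rightarrow> int vec \<Rightarrow> bool" where
  "ohcp_output t x y \<longleftrightarrow>
     (\<forall>i<dim_vec x. snd t 2 i = real_of_int (x $ i)) \<and>
     (\<forall>j<dim_vec y. snd t 3 j = real_of_int (y $ j))"

end

theory Submission
  imports Defs
begin

text \<open>With \<open>x = a - b\<close> and \<open>y = p - q\<close> the problem becomes the linear program of minimizing
  \<open>\<Sum>i. \<bar>w\<^sub>i\<bar> (a\<^sub>i + b\<^sub>i)\<close> over \<open>a, b, p, q \<ge> 0\<close> with \<open>a - b = c + B (p - q)\<close>. Its feasible vectors
  are a translate of a subspace \<open>L\<close>, which total unimodularity of \<open>B\<close> makes unimodular: vectors of \<open>L\<close> that are
  integral on a determining set of coordinates are integral. The operation count must not depend on the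
  sizes of \<open>c\<close> and of the weights, so a strongly polynomial algorithm in the manner of Tardos is needed.

  Keep a feasible integral \<open>x\<close> and reduced costs \<open>r\<close> (equal to the costs on \<open>L\<close>) that violate complementary
  slackness by at most \<open>\<epsilon>\<close>. In each round either some vector of \<open>L\<close> over \<open>{-1, 0, 1}\<close> moves only along
  coordinates of negative reduced cost upwards and of positive reduced cost downwards, and \<open>x\<close> moves
  along it until a coordinate with positive reduced cost becomes \<open>0\<close>; or a bounded vector orthogonal to \<open>L\<close>
  separates, and shifting \<open>r\<close> by it shrinks \<open>\<epsilon>\<close> by a constant factor. A perceptron decides which: it runs
  polynomially long because unimodularity bounds its data, and a real vector of \<open>L\<close> found by it is
  rounded to a \<open>{-1, 0, 1}\<close> vector along columns of echelon bases of \<open>L\<close>, whose entries are again \<open>0, \<plusminus>1\<close>.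

  An epoch starts by making \<open>r\<close> vanish on a basis; then some coordinate must have a reduced cost
  comparable to the initial \<open>\<epsilon>\<close>, so once \<open>\<epsilon>\<close> has decreased by a factor of order \<open>M\<^sup>2\<close>, there is a
  coordinate with \<open>r\<^sub>i > M \<epsilon>\<close>. It vanishes in some optimal solution and is fixed to \<open>0\<close> for good. Hence
  \<open>M + 1\<close> epochs suffice. The algorithm uses only loops whose bounds are computed beforehand from the input
  dimensions, so its running time is polynomial for syntactic reasons.\<close>

section \<open>A language of bounded loops\<close>

text \<open>Two facts make the fixing of a coordinate work. The first is proximity: unimodularity
  splits off, from the difference of a feasible \<open>y\<close> and the current \<open>x\<close>, a
  sign-compatible vector over -1, 0, 1. If it contains a coordinate with reduced cost above
  \<open>M * eps\<close>, each of the at most \<open>M - 1\<close> other coordinates gives back at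
  most \<open>eps\<close>, so removing the vector from \<open>y\<close> saves cost. The second is
  progress: after the change of basis the initial \<open>eps\<close> is the absolute pairing of
  \<open>r\<close> with one vector of \<open>L\<close> whose entries are at most 1 in absolute
  value. Later shifts are orthogonal to \<open>L\<close> and cannot change this pairing, whereas
  small reduced costs would bound it by \<open>M^2 * eps\<close>; this is the origin of
  \<open>M^2\<close>. The obstacle on the machine is that reals can be neither rounded nor turned
  into naturals. Integrality of \<open>x\<close> therefore comes only from adding an entry of
  \<open>x\<close> times a vector over -1, 0, 1, and such a vector has to be found by exact
  arithmetic, as the end of a walk on which coordinates hit -1, 0 or 1 one after another.\<close>

text \<open>Variables \<open>NV i\<close> are de Bruijn levels of the enclosing loops and sums. Loop bounds are given as indices
  into array 3 of natural numbers, which programs cannot write. Programs have access to the arrays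
  below 100 only: the compiled code keeps its loop counters and registers in the arrays 100 and 101.\<close>

datatype nat_term = NC nat | NV nat | NG nat nat_term | NAdd nat_term nat_term | NSub nat_term nat_term | NMul nat_term nat_term

datatype real_term =
    RC int | RG nat nat_term | Plus real_term real_term | Minus real_term real_term | Times real_term real_term | Div real_term real_term
  | IfR real_term real_term real_term real_term | IfN nat_term nat_term real_term real_term | SumTo nat real_term

datatype stmt =
    NSet nat nat_term nat_term | RSet nat nat_term real_term | Find nat nat real_term | Map2 nat nat nat real_term
  | Sq stmt stmt | If0 real_term stmt stmt | For nat stmt

primrec nval :: "nat_term \<Rightarrow> nat list \<Rightarrow> store \<Rightarrow> nat" where
  "nval (NC k) v s = k"
| "nval (NV i) v s = (if i < length v then v ! i else 0)"
| "nval (NG a e) v s = (if a < 100 then fst s a (nval e v s) else 0)"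
| "nval (NAdd e f) v s = nval e v s + nval f v s"
| "nval (NSub e f) v s = nval e v s - nval f v s"
| "nval (NMul e f) v s = nval e v s * nval f v s"

primrec xval :: "real_term \<Rightarrow> nat list \<Rightarrow> store \<Rightarrow> real" where
  "xval (RC k) v s = real_of_int k"
| "xval (RG a e) v s = (if a < 100 then snd s a (nval e v s) else 0)"
| "xval (Plus e f) v s = xval e v s + xval f v s"
| "xval (Minus e f) v s = xval e v s - xval f v s"
| "xval (Times e f) v s = xval e v s * xval f v s"
| "xval (Div e f) v s = xval e v s / xval f v s"
| "xval (IfR e f g h) v s = (if xval e v s < xval f v s then xval g v s else xval h v s)"
| "xval (IfN e f g h) v s = (if nval e v s < nval f v s then xval g v s else xval h v s)"
| "xval (SumTo b e) v s = (\<Sum>k<fst s 3 b. xval e (v @ [k]) s)"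

text \<open>The disjunct \<open>k = n\<close> guarantees that a least element exists, and the value
  \<open>n\<close> reports a failed search.\<close>

definition first_below :: "nat \<Rightarrow> (nat \<Rightarrow> bool) \<Rightarrow> nat" where
  "first_below n P = (LEAST k. k = n \<or> k < n \<and> P k)"

primrec run :: "stmt \<Rightarrow> nat list \<Rightarrow> store \<Rightarrow> store" where
  "run (NSet a e f) v s = (if a < 100 \<and> a \<noteq> 3 then iput a (nval e v s) (nval f v s) s else s)"
| "run (RSet a e x) v s = (if a < 100 then rput a (nval e v s) (xval x v s) s else s)"
| "run (Find a b x) v s =
     (if a < 100 \<and> a \<noteq> 3
      then iput a 0 (first_below (fst s 3 b) (\<lambda>k. 0 < xval x (v @ [k]) s)) s else s)"
| "run (Map2 a b c x) v s =
     (if a < 100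
      then (fst s, (snd s)(a := \<lambda>i. if i < fst s 3 b * fst s 3 c
              then xval x (v @ [i div fst s 3 c, i mod fst s 3 c]) s else snd s a i)) else s)"
| "run (Sq p q) v s = run q v (run p v s)"
| "run (If0 x p q) v s = (if 0 < xval x v s then run p v s else run q v s)"
| "run (For b p) v s = fold (\<lambda>k. run p (v @ [k])) [0..<fst s 3 b] s"

primrec ncode :: "nat_term \<Rightarrow> nat \<Rightarrow> iexp" where
  "ncode (NC k) l = IConst k"
| "ncode (NV i) l = (if i < l then IGet 100 (IConst i) else IConst 0)"
| "ncode (NG a e) l = (if a < 100 then IGet a (ncode e l) else IConst 0)"
| "ncode (NAdd e f) l = IAdd (ncode e l) (ncode f l)"
| "ncode (NSub e f) l = ISub (ncode e l) (ncode f l)"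
| "ncode (NMul e f) l = IMul (ncode e l) (ncode f l)"

definition loop_code :: "nat \<Rightarrow> nat \<Rightarrow> com \<Rightarrow> com" where
  "loop_code l b p =
     Seq (IPut 100 (IConst l) (IConst 0))
       (Loop (ILess (IGet 100 (IConst l)) (IGet 3 (IConst b)))
         (Seq p (IPut 100 (IConst l) (IAdd (IGet 100 (IConst l)) (IConst 1)))))"

abbreviation reg :: "nat \<Rightarrow> rexp" where "reg d \<equiv> RGet 100 (IConst d)"

text \<open>Register \<open>d\<close> receives the value, and the registers below \<open>d\<close>
  hold operands that are still needed, as on a stack. \<open>l\<close> counts the loop counters in
  scope, so it is also the cell of the next counter.\<close>

primrec xcode :: "real_term \<Rightarrow> nat \<Rightarrow> nat \<Rightarrow> com" where
  "xcode (RC k) l d = RPut 100 (IConst d) (RConst k)"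
| "xcode (RG a e) l d = RPut 100 (IConst d) (if a < 100 then RGet a (ncode e l) else RConst 0)"
| "xcode (Plus e f) l d = Seq (xcode e l d) (Seq (xcode f l (d + 1))
     (RPut 100 (IConst d) (RAdd (reg d) (reg (d + 1)))))"
| "xcode (Minus e f) l d = Seq (xcode e l d) (Seq (xcode f l (d + 1))
     (RPut 100 (IConst d) (RSub (reg d) (reg (d + 1)))))"
| "xcode (Times e f) l d = Seq (xcode e l d) (Seq (xcode f l (d + 1))
     (RPut 100 (IConst d) (RMul (reg d) (reg (d + 1)))))"
| "xcode (Div e f) l d = Seq (xcode e l d) (Seq (xcode f l (d + 1))
     (RPut 100 (IConst d) (RDiv (reg d) (reg (d + 1)))))"
| "xcode (IfR e f g h) l d = Seq (xcode e l d) (Seq (xcode f l (d + 1))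
     (Cond (RLess (reg d) (reg (d + 1))) (xcode g l d) (xcode h l d)))"
| "xcode (IfN e f g h) l d = Cond (ILess (ncode e l) (ncode f l)) (xcode g l d) (xcode h l d)"
| "xcode (SumTo b e) l d = Seq (RPut 100 (IConst d) (RConst 0))
     (loop_code l b (Seq (xcode e (l + 1) (d + 1)) (RPut 100 (IConst d) (RAdd (reg d) (reg (d + 1))))))"

definition cell2 :: "nat \<Rightarrow> nat \<Rightarrow> iexp" where
  "cell2 l c = IAdd (IMul (IGet 100 (IConst l)) (IGet 3 (IConst c))) (IGet 100 (IConst (l + 1)))"

text \<open>\<open>Map2\<close> first fills array 101 and then copies, because \<open>x\<close> may
  read the array that is being assigned and must see its old values. A loop cannot be left early, so
  \<open>Find\<close> keeps the bound in a scratch cell until the first hit and skips the test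
  afterwards.\<close>

primrec scode :: "stmt \<Rightarrow> nat \<Rightarrow> com" where
  "scode (NSet a e f) l = (if a < 100 \<and> a \<noteq> 3 then IPut a (ncode e l) (ncode f l) else Skip)"
| "scode (RSet a e x) l =
     (if a < 100 then Seq (xcode x l 0) (RPut a (ncode e l) (reg 0)) else Skip)"
| "scode (Find a b x) l =
     (if a < 100 \<and> a \<noteq> 3 then
        Seq (IPut 101 (IConst 0) (IGet 3 (IConst b)))
         (Seq (loop_code l b (Cond (ILess (IGet 101 (IConst 0)) (IGet 3 (IConst b))) Skip
             (Seq (xcode x (l + 1) 0)
               (Cond (RLess (RConst 0) (reg 0))
                 (IPut 101 (IConst 0) (IGet 100 (IConst l))) Skip))))
           (IPut a (IConst 0) (IGet 101 (IConst 0))))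
      else Skip)"
| "scode (Map2 a b c x) l =
     (if a < 100 then
        Seq (loop_code l b (loop_code (l + 1) c (Seq (xcode x (l + 2) 0) (RPut 101 (cell2 l c) (reg 0)))))
          (loop_code l b (loop_code (l + 1) c (RPut a (cell2 l c) (RGet 101 (cell2 l c)))))
      else Skip)"
| "scode (Sq p q) l = Seq (scode p l) (scode q l)"
| "scode (If0 x p q) l = Seq (xcode x l 0) (Cond (RLess (RConst 0) (reg 0)) (scode p l) (scode q l))"
| "scode (For b p) l = loop_code l b (scode p (l + 1))"

text \<open>Upper bounds for the cost of compiled code, given the table \<open>n\<close> of loop bounds.\<close>

primrec ncost :: "nat_term \<Rightarrow> nat" where
  "ncost (NC k) = 1"
| "ncost (NV i) = 2"
| "ncost (NG a e) = 1 + ncost e"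
| "ncost (NAdd e f) = 1 + ncost e + ncost f"
| "ncost (NSub e f) = 1 + ncost e + ncost f"
| "ncost (NMul e f) = 1 + ncost e + ncost f"

primrec xcost :: "real_term \<Rightarrow> (nat \<Rightarrow> nat) \<Rightarrow> nat" where
  "xcost (RC k) n = 3"
| "xcost (RG a e) n = 3 + ncost e"
| "xcost (Plus e f) n = xcost e n + xcost f n + 7"
| "xcost (Minus e f) n = xcost e n + xcost f n + 7"
| "xcost (Times e f) n = xcost e n + xcost f n + 7"
| "xcost (Div e f) n = xcost e n + xcost f n + 7"
| "xcost (IfR e f g h) n = xcost e n + xcost f n + xcost g n + xcost h n + 6"
| "xcost (IfN e f g h) n = ncost e + ncost f + xcost g n + xcost h n + 2"
| "xcost (SumTo b e) n = 12 + n b * (xcost e n + 19)"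

primrec scost :: "stmt \<Rightarrow> (nat \<Rightarrow> nat) \<Rightarrow> nat" where
  "scost (NSet a e f) n = 1 + ncost e + ncost f"
| "scost (RSet a e x) n = 3 + ncost e + xcost x n"
| "scost (Find a b x) n = 20 + n b * (xcost x n + 27)"
| "scost (Map2 a b c x) n = 18 + n b * (30 + n c * (xcost x n + 60) + 20)"
| "scost (Sq p q) n = scost p n + scost q n"
| "scost (If0 x p q) n = 5 + xcost x n + scost p n + scost q n"
| "scost (For b p) n = 9 + n b * (scost p n + 12)"

section \<open>Correctness and cost of the compiled code\<close>

definition sim :: "store \<Rightarrow> store \<Rightarrow> bool" where
  "sim s t \<longleftrightarrow> (\<forall>a<100. fst s a = fst t a \<and> snd s a = snd t a)"

definition counters :: "store \<Rightarrow> nat list \<Rightarrow> bool" where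
  "counters s v \<longleftrightarrow> (\<forall>i<length v. fst s 100 i = v ! i)"

lemma store_simps [simp]:
  "fst (iput a k x s) = (fst s)(a := (fst s a)(k := x))" "snd (iput a k x s) = snd s"
  "fst (rput a k y s) = fst s" "snd (rput a k y s) = (snd s)(a := (snd s a)(k := y))"
  by (simp_all add: iput_def rput_def)

lemma nval_cong: "sim s t \<Longrightarrow> nval e v s = nval e v t"
  by (induction e) (auto simp: sim_def)

lemma xval_cong: "sim s t \<Longrightarrow> xval e v s = xval e v t"
proof (induction e arbitrary: v)
  case (SumTo b e)
  then have "fst s 3 = fst t 3" by (auto simp: sim_def)
  with SumTo show ?case by simp
qed (auto simp: nval_cong, auto simp: sim_def)

lemma ncode_ival: "counters s v \<Longrightarrow> ival (ncode e (length v)) s = nval e v s"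
  by (induction e) (auto simp: counters_def)

lemma ncode_icost: "icost (ncode e l) \<le> ncost e"
  by (induction e) auto

lemma run_consts [simp]: "fst (run p v s) 3 = fst s 3"
proof (induction p arbitrary: v s)
  case (For b p)
  have "fst (fold (\<lambda>k. run p (v @ [k])) ks s) 3 = fst s 3" for ks s
    by (induction ks arbitrary: s) (auto simp: For)
  then show ?case by simp
qed auto

lemma exec_RPut': "n = 1 + icost e + rcost f \<Longrightarrow> t = rput a (ival e s) (rval f s) s \<Longrightarrow> exec (RPut a e f) s n t"
  using exec.RPut by simp

lemma exec_IPut': "n = 1 + icost e + icost f \<Longrightarrow> t = iput a (ival e s) (ival f s) s \<Longrightarrow> exec (IPut a e f) s n t"
  using exec.IPut by simp

lemma exec_Cond': "n = 1 + bcost b + N \<Longrightarrow> exec (if bval b s then P else Q) s N t \<Longrightarrow> exec (Cond b P Q) s n t"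
  using exec.CondTrue[of b s P N t Q] exec.CondFalse[of b s Q N t P] by (cases "bval b s") simp_all

text \<open>The constants are machine costs: 6 for each test of the guard and 6 for each increment,
  hence 12 per round and a final 6; \<open>exec_loop\<close> adds 3 for the initialization. The
  invariant is claimed after the increment because the counter is itself a cell of the
  store.\<close>

lemma exec_loop_aux:
  assumes step: "\<And>k s. \<lbrakk>k < n; I k s; fst s 100 l = k\<rbrakk> \<Longrightarrow> \<exists>N s'. exec p s N s' \<and> N \<le> C
      \<and> fst s' 100 l = k \<and> I (Suc k) (iput 100 l (Suc k) s')"
    and bound: "\<And>k s. I k s \<Longrightarrow> fst s 3 b = n"
    and I: "I k s" "fst s 100 l = k" and kn: "k \<le> n"
  shows "\<exists>N s'. exec (Loop (ILess (IGet 100 (IConst l)) (IGet 3 (IConst b)))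
           (Seq p (IPut 100 (IConst l) (IAdd (IGet 100 (IConst l)) (IConst 1))))) s N s'
          \<and> N \<le> 6 + (n - k) * (C + 12) \<and> I n s' \<and> fst s' 100 l = n"
  using kn I
proof (induction "n - k" arbitrary: k s)
  case 0
  then have "k = n" by simp
  with 0 bound[of k s] show ?case
    by (intro exI[of _ "1 + bcost (ILess (IGet 100 (IConst l)) (IGet 3 (IConst b)))"] exI[of _ s] conjI exec.LoopFalse)
      auto
next
  case (Suc j)
  then have kn: "k < n" by simp
  from step[OF kn Suc.prems(2,3)] obtain N s' where 1: "exec p s N s'" "N \<le> C" "fst s' 100 l = k"
    "I (Suc k) (iput 100 l (Suc k) s')" by blast
  have j: "j = n - Suc k" using Suc.hyps(2) by simp
  have "Suc k \<le> n" "fst (iput 100 l (Suc k) s') 100 l = Suc k" using kn by simp_all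
  from Suc.hyps(1)[OF j this(1) 1(4) this(2)] obtain N' u where
    2: "exec (Loop (ILess (IGet 100 (IConst l)) (IGet 3 (IConst b)))
           (Seq p (IPut 100 (IConst l) (IAdd (IGet 100 (IConst l)) (IConst 1))))) (iput 100 l (Suc k) s') N' u"
       "N' \<le> 6 + (n - Suc k) * (C + 12)" "I n u" "fst u 100 l = n" by blast
  have "exec (IPut 100 (IConst l) (IAdd (IGet 100 (IConst l)) (IConst 1))) s' 6 (iput 100 l (Suc k) s')"
    by (rule exec_IPut') (simp_all add: 1(3))
  from exec.Seq[OF 1(1) this]
  have 3: "exec (Seq p (IPut 100 (IConst l) (IAdd (IGet 100 (IConst l)) (IConst 1)))) s (N + 6) (iput 100 l (Suc k) s')" .
  have "bval (ILess (IGet 100 (IConst l)) (IGet 3 (IConst b))) s"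
    using Suc.prems bound[OF Suc.prems(2)] kn by simp
  from exec.LoopTrue[OF this 3 2(1)]
  have "exec (Loop (ILess (IGet 100 (IConst l)) (IGet 3 (IConst b)))
           (Seq p (IPut 100 (IConst l) (IAdd (IGet 100 (IConst l)) (IConst 1))))) s (6 + (N + 6) + N') u"
    by simp
  moreover have "6 + (N + 6) + N' \<le> 6 + (n - k) * (C + 12)"
  proof -
    have "n - k = Suc (n - Suc k)" using kn by simp
    then have "(n - k) * (C + 12) = (C + 12) + (n - Suc k) * (C + 12)" by simp
    with 1(2) 2(2) show ?thesis by linarith
  qed
  ultimately show ?case using 2 by blast
qed

lemma exec_loop:
  assumes step: "\<And>k s. \<lbrakk>k < n; I k s; fst s 100 l = k\<rbrakk> \<Longrightarrow> \<exists>N s'. exec p s N s' \<and> N \<le> C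
      \<and> fst s' 100 l = k \<and> I (Suc k) (iput 100 l (Suc k) s')"
    and bound: "\<And>k s. I k s \<Longrightarrow> fst s 3 b = n"
    and I: "I 0 (iput 100 l 0 s)"
  shows "\<exists>N s'. exec (loop_code l b p) s N s' \<and> N \<le> 9 + n * (C + 12) \<and> I n s' \<and> fst s' 100 l = n"
proof -
  have "\<exists>N s'. exec (Loop (ILess (IGet 100 (IConst l)) (IGet 3 (IConst b)))
           (Seq p (IPut 100 (IConst l) (IAdd (IGet 100 (IConst l)) (IConst 1))))) (iput 100 l 0 s) N s'
          \<and> N \<le> 6 + (n - 0) * (C + 12) \<and> I n s' \<and> fst s' 100 l = n"
    by (rule exec_loop_aux[where I=I and k=0]) (fact step, fact bound, fact I, simp_all)
  then obtain N s' where 1: "exec (Loop (ILess (IGet 100 (IConst l)) (IGet 3 (IConst b)))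
           (Seq p (IPut 100 (IConst l) (IAdd (IGet 100 (IConst l)) (IConst 1))))) (iput 100 l 0 s) N s'"
    "N \<le> 6 + n * (C + 12)" "I n s'" "fst s' 100 l = n" by auto
  have "exec (IPut 100 (IConst l) (IConst 0)) s 3 (iput 100 l 0 s)"
    by (rule exec_IPut') simp_all
  from exec.Seq[OF this 1(1)] 1 show ?thesis
    unfolding loop_code_def by (intro exI[of _ "3 + N"] exI[of _ s']) auto
qed

text \<open>What the evaluation of a term at depth \<open>l\<close> with register \<open>d\<close>
  must leave alone. Array 101 is included because \<open>Find\<close> and \<open>Map2\<close> hold
  partial results there between evaluations.\<close>

definition keeps :: "nat \<Rightarrow> nat \<Rightarrow> store \<Rightarrow> store \<Rightarrow> bool" where
  "keeps l d s t \<longleftrightarrow> sim t s \<and> (\<forall>i<l. fst t 100 i = fst s 100 i) \<and>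
     (\<forall>i<d. snd t 100 i = snd s 100 i) \<and> snd t 101 = snd s 101 \<and> fst t 101 = fst s 101"

lemma keeps_trans: "keeps l d s t \<Longrightarrow> keeps l d t u \<Longrightarrow> keeps l d s u"
  by (auto simp: keeps_def sim_def)

lemma keeps_mono: "keeps l d s t \<Longrightarrow> l' \<le> l \<Longrightarrow> d' \<le> d \<Longrightarrow> keeps l' d' s t"
  by (auto simp: keeps_def)

lemma keeps_counters: "keeps l d s t \<Longrightarrow> counters s v \<Longrightarrow> length v \<le> l \<Longrightarrow> counters t v"
  by (auto simp: keeps_def counters_def)

lemma keeps_rput [simp]: "keeps l d s (rput 100 d x t) \<longleftrightarrow> keeps l d s t"
  by (auto simp: keeps_def sim_def)

definition xcode_ok :: "real_term \<Rightarrow> bool" where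
  "xcode_ok e \<longleftrightarrow> (\<forall>v d s. counters s v \<longrightarrow> (\<exists>N t. exec (xcode e (length v) d) s N t \<and>
      N \<le> xcost e (fst s 3) \<and> snd t 100 d = xval e v s \<and> keeps (length v) d s t))"

lemma xcode_okD: "xcode_ok e \<Longrightarrow> counters s v \<Longrightarrow> \<exists>N t. exec (xcode e (length v) d) s N t \<and>
      N \<le> xcost e (fst s 3) \<and> snd t 100 d = xval e v s \<and> keeps (length v) d s t"
  unfolding xcode_ok_def by blast

lemma xcode_two:
  assumes "xcode_ok e" "xcode_ok f" and s: "counters s v"
  obtains N t N' u where "exec (xcode e (length v) d) s N t" "exec (xcode f (length v) (d + 1)) t N' u"
    "N \<le> xcost e (fst s 3)" "N' \<le> xcost f (fst s 3)" "snd u 100 d = xval e v s"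
    "snd u 100 (d + 1) = xval f v s" "keeps (length v) d s u"
proof -
  from xcode_okD[OF assms(1) s, of d] obtain N t where 1: "exec (xcode e (length v) d) s N t"
    "N \<le> xcost e (fst s 3)" "snd t 100 d = xval e v s" "keeps (length v) d s t" by blast
  have "counters t v" using keeps_counters[OF 1(4) s] by simp
  from xcode_okD[OF assms(2) this, of "d + 1"] obtain N' u where
    2: "exec (xcode f (length v) (d + 1)) t N' u" "N' \<le> xcost f (fst t 3)"
      "snd u 100 (d + 1) = xval f v t" "keeps (length v) (d + 1) t u" by blast
  have "sim t s" using 1(4) by (simp add: keeps_def)
  then have eq: "fst t 3 = fst s 3" "xval f v t = xval f v s" by (auto simp: xval_cong) (auto simp: sim_def)
  have "snd u 100 d = snd t 100 d" using 2(4) by (simp add: keeps_def)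
  moreover have "keeps (length v) d s u" using keeps_trans[OF 1(4) keeps_mono[OF 2(4)]] by simp
  ultimately show ?thesis using that[OF 1(1) 2(1)] 1 2 eq by simp
qed

lemma xcode_binop:
  assumes "xcode_ok e" "xcode_ok f" and s: "counters s v"
    and "\<And>u. rval r u = g (snd u 100 d) (snd u 100 (d + 1))" and "rcost r = 5"
  shows "\<exists>N t. exec (Seq (xcode e (length v) d) (Seq (xcode f (length v) (d + 1)) (RPut 100 (IConst d) r))) s N t \<and>
      N \<le> xcost e (fst s 3) + xcost f (fst s 3) + 7 \<and> snd t 100 d = g (xval e v s) (xval f v s) \<and> keeps (length v) d s t"
proof -
  obtain N t N' u where 1: "exec (xcode e (length v) d) s N t" "exec (xcode f (length v) (d + 1)) t N' u"
    "N \<le> xcost e (fst s 3)" "N' \<le> xcost f (fst s 3)" "snd u 100 d = xval e v s"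
    "snd u 100 (d + 1) = xval f v s" "keeps (length v) d s u"
    by (rule xcode_two[OF assms(1-3)])
  have "exec (RPut 100 (IConst d) r) u 7 (rput 100 d (rval r u) u)"
    by (rule exec_RPut') (simp_all add: assms)
  from exec.Seq[OF 1(1) exec.Seq[OF 1(2) this]] show ?thesis
    using 1 by (intro exI[of _ "N + (N' + 7)"] exI[of _ "rput 100 d (rval r u) u"]) (auto simp: assms(4))
qed

lemma xcode_ok: "xcode_ok e"
proof (induction e)
  case (RC k)
  show ?case unfolding xcode_ok_def
  proof (intro allI impI)
    fix v d s
    show "\<exists>N t. exec (xcode (RC k) (length v) d) s N t \<and>
      N \<le> xcost (RC k) (fst s 3) \<and> snd t 100 d = xval (RC k) v s \<and> keeps (length v) d s t"
      by (rule exI[of _ 3], rule exI[of _ "rput 100 d (real_of_int k) s"])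
        (auto intro!: exec_RPut' simp: keeps_def sim_def)
  qed
next
  case (RG a e)
  show ?case unfolding xcode_ok_def
  proof (intro allI impI)
    fix v d s assume s: "counters s v"
    show "\<exists>N t. exec (xcode (RG a e) (length v) d) s N t \<and>
      N \<le> xcost (RG a e) (fst s 3) \<and> snd t 100 d = xval (RG a e) v s \<and> keeps (length v) d s t"
      apply (rule exI, rule exI, rule conjI, simp only: xcode.simps, rule exec_RPut'[OF refl refl])
      using ncode_icost[of e "length v"] by (auto simp: ncode_ival[OF s]) (simp_all add: keeps_def sim_def)
  qed
next
  case (Plus e f)
  show ?case unfolding xcode_ok_def
    using xcode_binop[OF Plus, where g="(+)"] by simp
next
  case (Minus e f)
  show ?case unfolding xcode_ok_def
    using xcode_binop[OF Minus, where g="(-)"] by simp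
next
  case (Times e f)
  show ?case unfolding xcode_ok_def
    using xcode_binop[OF Times, where g="(*)"] by simp
next
  case (Div e f)
  show ?case unfolding xcode_ok_def
    using xcode_binop[OF Div, where g="(/)"] by simp
next
  case (IfR e f g h)
  show ?case unfolding xcode_ok_def
  proof (intro allI impI)
    fix v d s assume s: "counters s v"
    obtain N t N' u where 1: "exec (xcode e (length v) d) s N t" "exec (xcode f (length v) (d + 1)) t N' u"
      "N \<le> xcost e (fst s 3)" "N' \<le> xcost f (fst s 3)" "snd u 100 d = xval e v s"
      "snd u 100 (d + 1) = xval f v s" "keeps (length v) d s u"
      by (rule xcode_two[OF IfR(1,2) s])
    have u: "counters u v" "sim u s" using keeps_counters[OF 1(7) s] 1(7) by (simp_all add: keeps_def)
    then have 3: "fst u 3 = fst s 3" by (simp add: sim_def)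
    let ?b = "RLess (reg d) (reg (d + 1))"
    let ?k = "if bval ?b u then g else h"
    have "xcode_ok ?k" using IfR by simp
    from xcode_okD[OF this u(1), of d] obtain N'' w where 2: "exec (xcode ?k (length v) d) u N'' w"
      "N'' \<le> xcost ?k (fst u 3)" "snd w 100 d = xval ?k v u" "keeps (length v) d u w" by blast
    have "exec (Cond ?b (xcode g (length v) d) (xcode h (length v) d)) u (6 + N'') w"
      by (rule exec_Cond'[where N=N'']) (use 2(1) in \<open>simp_all split: if_splits\<close>)
    from exec.Seq[OF 1(1) exec.Seq[OF 1(2) this]] show "\<exists>N t. exec (xcode (IfR e f g h) (length v) d) s N t \<and>
      N \<le> xcost (IfR e f g h) (fst s 3) \<and> snd t 100 d = xval (IfR e f g h) v s \<and> keeps (length v) d s t"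
      using 1 2 3 keeps_trans[OF 1(7) 2(4)] xval_cong[OF u(2)]
      by (intro exI[of _ "N + (N' + (6 + N''))"] exI[of _ w]) (auto split: if_splits)
  qed
next
  case (IfN e f g h)
  show ?case unfolding xcode_ok_def
  proof (intro allI impI)
    fix v d s assume s: "counters s v"
    let ?b = "ILess (ncode e (length v)) (ncode f (length v))"
    let ?k = "if bval ?b s then g else h"
    have "xcode_ok ?k" using IfN by simp
    from xcode_okD[OF this s, of d] obtain N w where 2: "exec (xcode ?k (length v) d) s N w"
      "N \<le> xcost ?k (fst s 3)" "snd w 100 d = xval ?k v s" "keeps (length v) d s w" by blast
    have "exec (Cond ?b (xcode g (length v) d) (xcode h (length v) d)) s (1 + bcost ?b + N) w"
      by (rule exec_Cond'[where N=N]) (use 2(1) in \<open>simp_all split: if_splits\<close>)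
    then show "\<exists>N t. exec (xcode (IfN e f g h) (length v) d) s N t \<and>
      N \<le> xcost (IfN e f g h) (fst s 3) \<and> snd t 100 d = xval (IfN e f g h) v s \<and> keeps (length v) d s t"
      using 2 ncode_icost[of e "length v"] ncode_icost[of f "length v"]
      by (intro exI[of _ "1 + bcost ?b + N"] exI[of _ w]) (auto simp: ncode_ival[OF s] split: if_splits)
  qed
next
  case (SumTo b e)
  show ?case unfolding xcode_ok_def
  proof (intro allI impI)
    fix v d s assume s: "counters s v"
    let ?l = "length v"
    let ?I = "\<lambda>k u. keeps ?l d s u \<and> snd u 100 d = (\<Sum>j<k. xval e (v @ [j]) s)"
    let ?p = "Seq (xcode e (?l + 1) (d + 1)) (RPut 100 (IConst d) (RAdd (reg d) (reg (d + 1))))"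
    have "\<exists>N t. exec (loop_code ?l b ?p) (rput 100 d 0 s) N t \<and> N \<le> 9 + fst s 3 b * ((xcost e (fst s 3) + 7) + 12)
        \<and> ?I (fst s 3 b) t \<and> fst t 100 ?l = fst s 3 b"
    proof (rule exec_loop[where I="?I"])
      fix k u assume k: "k < fst s 3 b" and u: "?I k u" "fst u 100 ?l = k"
      have vk: "counters u (v @ [k])"
        using keeps_counters[of ?l d s u, OF _ s] u by (auto simp: counters_def nth_append less_Suc_eq)
      have len: "length (v @ [k]) = ?l + 1" by simp
      have us: "sim u s" using u by (simp add: keeps_def)
      then have 3: "fst u 3 = fst s 3" by (simp add: sim_def)
      from xcode_okD[OF SumTo vk, of "d + 1"] obtain N t where 1: "exec (xcode e (?l + 1) (d + 1)) u N t"
        "N \<le> xcost e (fst u 3)" "snd t 100 (d + 1) = xval e (v @ [k]) u" "keeps (?l + 1) (d + 1) u t"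
        by auto
      let ?t = "rput 100 d (snd t 100 d + snd t 100 (d + 1)) t"
      have "exec (RPut 100 (IConst d) (RAdd (reg d) (reg (d + 1)))) t 7 ?t" by (rule exec_RPut') simp_all
      from exec.Seq[OF 1(1) this] have ex: "exec ?p u (N + 7) ?t" .
      have td: "snd t 100 d = snd u 100 d" using 1(4) by (simp add: keeps_def)
      have k2: "keeps ?l d s t" using keeps_trans[OF conjunct1[OF u(1)] keeps_mono[OF 1(4)]] by simp
      then have "keeps ?l d s (iput 100 ?l (Suc k) ?t)"
        by (auto simp: keeps_def sim_def)
      moreover have "snd (iput 100 ?l (Suc k) ?t) 100 d = (\<Sum>j<Suc k. xval e (v @ [j]) s)"
        using 1(3) td u(1) xval_cong[OF us] by simp
      moreover have "fst ?t 100 ?l = k" using 1(4) u(2) by (simp add: keeps_def)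
      ultimately show "\<exists>N t. exec ?p u N t \<and> N \<le> xcost e (fst s 3) + 7 \<and> fst t 100 ?l = k \<and> ?I (Suc k) (iput 100 ?l (Suc k) t)"
        using ex 1(2) 3 by (intro exI[of _ "N + 7"] exI[of _ ?t]) auto
    next
      fix k u assume "?I k u" then show "fst u 3 b = fst s 3 b" by (auto simp: keeps_def sim_def)
    next
      show "?I 0 (iput 100 ?l 0 (rput 100 d 0 s))" by (auto simp: keeps_def sim_def)
    qed
    then obtain N t where 1: "exec (loop_code ?l b ?p) (rput 100 d 0 s) N t"
      "N \<le> 9 + fst s 3 b * ((xcost e (fst s 3) + 7) + 12)" "?I (fst s 3 b) t" by blast
    have "exec (RPut 100 (IConst d) (RConst 0)) s 3 (rput 100 d 0 s)" by (rule exec_RPut') simp_all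
    from exec.Seq[OF this 1(1)] show "\<exists>N t. exec (xcode (SumTo b e) (length v) d) s N t \<and>
      N \<le> xcost (SumTo b e) (fst s 3) \<and> snd t 100 d = xval (SumTo b e) v s \<and> keeps (length v) d s t"
      using 1 by (intro exI[of _ "3 + N"] exI[of _ t]) (auto simp: algebra_simps)
  qed
qed

lemmas xcode_exec = xcode_okD[OF xcode_ok]

lemma keeps_sim: "keeps l d s t \<Longrightarrow> sim s u \<Longrightarrow> sim t u"
  by (auto simp: keeps_def sim_def)

lemma counters_snoc: "counters s (v @ [k]) \<longleftrightarrow> counters s v \<and> fst s 100 (length v) = k"
  by (auto simp: counters_def nth_append less_Suc_eq)

lemma counters_iput: "length v \<le> l \<Longrightarrow> counters (iput 100 l k s) v \<longleftrightarrow> counters s v"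
  by (auto simp: counters_def)

lemma sim_temp [simp]:
  "sim (iput 100 k x s) t \<longleftrightarrow> sim s t" "sim (iput 101 k x s) t \<longleftrightarrow> sim s t"
  "sim (rput 100 k y s) t \<longleftrightarrow> sim s t" "sim (rput 101 k y s) t \<longleftrightarrow> sim s t"
  by (auto simp: sim_def)

lemma sim_consts: "sim s t \<Longrightarrow> fst s 3 = fst t 3"
  by (simp add: sim_def)

lemma cell2_ival: "counters s (v @ [i, j]) \<Longrightarrow> ival (cell2 (length v) c) s = i * fst s 3 c + j"
  by (simp add: cell2_def counters_def nth_append)

lemma cell2_icost: "icost (cell2 l c) = 8"
  by (simp add: cell2_def)

definition scode_ok :: "stmt \<Rightarrow> bool" where
  "scode_ok p \<longleftrightarrow> (\<forall>v s t. counters s v \<and> sim s t \<longrightarrow> (\<exists>N u. exec (scode p (length v)) s N u \<and>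
      N \<le> scost p (fst t 3) \<and> sim u (run p v t) \<and> counters u v))"

lemma scode_okI:
  assumes "\<And>v s t. counters s v \<Longrightarrow> sim s t \<Longrightarrow> \<exists>N u. exec (scode p (length v)) s N u \<and>
      N \<le> scost p (fst t 3) \<and> sim u (run p v t) \<and> counters u v"
  shows "scode_ok p"
  using assms unfolding scode_ok_def by blast

lemma scode_okD: "scode_ok p \<Longrightarrow> counters s v \<Longrightarrow> sim s t \<Longrightarrow> \<exists>N u. exec (scode p (length v)) s N u \<and>
      N \<le> scost p (fst t 3) \<and> sim u (run p v t) \<and> counters u v"
  unfolding scode_ok_def by blast

lemma scode_NSet: "scode_ok (NSet a e f)"
proof (rule scode_okI)
  fix v s t assume s: "counters s v" and st: "sim s t"
  show "\<exists>N u. exec (scode (NSet a e f) (length v)) s N u \<and>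
      N \<le> scost (NSet a e f) (fst t 3) \<and> sim u (run (NSet a e f) v t) \<and> counters u v"
  proof (cases "a < 100 \<and> a \<noteq> 3")
    case True
    let ?u = "iput a (nval e v s) (nval f v s) s"
    have "exec (scode (NSet a e f) (length v)) s (1 + icost (ncode e (length v)) + icost (ncode f (length v))) ?u"
      using True by simp (rule exec_IPut', simp_all add: ncode_ival[OF s])
    moreover have "sim ?u (run (NSet a e f) v t)" using True st by (auto simp: sim_def nval_cong[OF st])
    moreover have "counters ?u v" using s True by (simp add: counters_def)
    ultimately show ?thesis using ncode_icost[of e "length v"] ncode_icost[of f "length v"]
      by (intro exI conjI) (assumption, auto)
  next
    case False
    then have "exec (scode (NSet a e f) (length v)) s 1 s" using exec.Skip by auto
    with False s st show ?thesis by (intro exI[of _ 1] exI[of _ s]) auto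
  qed
qed

lemma scode_RSet: "scode_ok (RSet a e x)"
proof (rule scode_okI)
  fix v s t assume s: "counters s v" and st: "sim s t"
  show "\<exists>N u. exec (scode (RSet a e x) (length v)) s N u \<and>
      N \<le> scost (RSet a e x) (fst t 3) \<and> sim u (run (RSet a e x) v t) \<and> counters u v"
  proof (cases "a < 100")
    case True
    from xcode_exec[OF s, of x 0] obtain N w where 1: "exec (xcode x (length v) 0) s N w"
      "N \<le> xcost x (fst s 3)" "snd w 100 0 = xval x v s" "keeps (length v) 0 s w" by blast
    have w: "counters w v" "sim w t" using keeps_counters[OF 1(4) s] keeps_sim[OF 1(4) st] by simp_all
    let ?u = "rput a (nval e v w) (xval x v s) w"
    have "exec (RPut a (ncode e (length v)) (reg 0)) w (3 + icost (ncode e (length v))) ?u"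
      by (rule exec_RPut') (simp_all add: ncode_ival[OF w(1)] 1)
    from exec.Seq[OF 1(1) this] have "exec (scode (RSet a e x) (length v)) s (N + (3 + icost (ncode e (length v)))) ?u"
      using True by simp
    moreover have "sim ?u (run (RSet a e x) v t)"
      using True w(2) by (auto simp: sim_def nval_cong[OF w(2)] xval_cong[OF st])
    moreover have "counters ?u v" using w(1) by (simp add: counters_def)
    ultimately show ?thesis using ncode_icost[of e "length v"] 1(2) sim_consts[OF st]
      by (intro exI conjI) (assumption, auto)
  next
    case False
    then have "exec (scode (RSet a e x) (length v)) s 1 s" using exec.Skip by auto
    with False s st show ?thesis by (intro exI[of _ 1] exI[of _ s]) auto
  qed
qed

lemma first_below_eqI:
  assumes "k \<le> n" "\<And>j. j < k \<Longrightarrow> \<not> P j" "k < n \<Longrightarrow> P k"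
  shows "first_below n P = k"
  unfolding first_below_def using assms by (intro Least_equality) (auto simp: not_less[symmetric])

lemma scode_Find: "scode_ok (Find a b x)"
proof (rule scode_okI)
  fix v s t assume s: "counters s v" and st: "sim s t"
  show "\<exists>N u. exec (scode (Find a b x) (length v)) s N u \<and>
      N \<le> scost (Find a b x) (fst t 3) \<and> sim u (run (Find a b x) v t) \<and> counters u v"
  proof (cases "a < 100 \<and> a \<noteq> 3")
    case True
    let ?l = "length v" let ?n = "fst t 3 b"
    let ?P = "\<lambda>k. 0 < xval x (v @ [k]) t"
    let ?p = "Cond (ILess (IGet 101 (IConst 0)) (IGet 3 (IConst b))) Skip
             (Seq (xcode x (?l + 1) 0) (Cond (RLess (RConst 0) (reg 0))
                 (IPut 101 (IConst 0) (IGet 100 (IConst ?l))) Skip))"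
    let ?I = "\<lambda>k u. sim u t \<and> counters u v \<and>
       (let j = fst u 101 0 in (j = ?n \<and> (\<forall>i<k. \<not> ?P i)) \<or> (j < k \<and> j < ?n \<and> ?P j \<and> (\<forall>i<j. \<not> ?P i)))"
    let ?s0 = "iput 101 0 ?n s"
    have "\<exists>N u. exec (loop_code ?l b ?p) ?s0 N u \<and> N \<le> 9 + ?n * ((xcost x (fst t 3) + 15) + 12) \<and> ?I ?n u \<and> fst u 100 ?l = ?n"
    proof (rule exec_loop[where I = ?I])
      fix k u assume k: "k < ?n" and I: "?I k u" and ul: "fst u 100 ?l = k"
      have ut: "sim u t" and uc: "counters u v" and u3: "fst u 3 = fst t 3" using I by (auto simp: sim_consts)
      have vk: "counters u (v @ [k])" using uc ul by (simp add: counters_snoc)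
      let ?j = "fst u 101 0"
      show "\<exists>N u'. exec ?p u N u' \<and> N \<le> xcost x (fst t 3) + 15 \<and> fst u' 100 ?l = k \<and> ?I (Suc k) (iput 100 ?l (Suc k) u')"
      proof (cases "?j < ?n")
        case True
        have "exec ?p u 7 u" by (rule exec_Cond'[where N=1]) (use True u3 exec.Skip in auto)
        moreover have "?I (Suc k) (iput 100 ?l (Suc k) u)"
          using I True by (auto simp: Let_def counters_iput)
        ultimately show ?thesis using ul by (intro exI[of _ 7] exI[of _ u]) auto
      next
        case False
        have no: "\<forall>i<k. \<not> ?P i" "?j = ?n" using I False by (auto simp: Let_def)
        from xcode_exec[OF vk, of x 0] obtain N w where 1: "exec (xcode x (?l + 1) 0) u N w"
          "N \<le> xcost x (fst u 3)" "snd w 100 0 = xval x (v @ [k]) u" "keeps (?l + 1) 0 u w" by auto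
        have w: "sim w t" "counters w (v @ [k])" using keeps_sim[OF 1(4) ut] keeps_counters[OF 1(4) vk] by simp_all
        have wl: "fst w 100 ?l = k" and w1: "fst w 101 = fst u 101" using w(2) 1(4) by (auto simp: counters_snoc keeps_def)
        let ?w = "if ?P k then iput 101 0 k w else w"
        let ?c = "if ?P k then 4 else 1 :: nat"
        have bv: "bval (RLess (RConst 0) (reg 0)) w \<longleftrightarrow> ?P k" using 1(3) xval_cong[OF ut] by simp
        have "exec (if ?P k then IPut 101 (IConst 0) (IGet 100 (IConst ?l)) else Skip) w ?c ?w"
          using wl by (auto intro!: exec_IPut' exec.Skip[unfolded One_nat_def])
        then have "exec (Cond (RLess (RConst 0) (reg 0)) (IPut 101 (IConst 0) (IGet 100 (IConst ?l))) Skip) w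
            (5 + ?c) ?w"
          by (intro exec_Cond'[where N = ?c]) (simp, simp only: bv)
        from exec.Seq[OF 1(1) this]
        have "exec ?p u (N + (11 + ?c)) ?w"
          by (intro exec_Cond'[where N="N + (5 + ?c)"]) (use False u3 in auto)
        moreover have "?I (Suc k) (iput 100 ?l (Suc k) ?w)"
          using w no k w1 by (auto simp: Let_def counters_iput counters_snoc less_Suc_eq counters_def nth_append)
        ultimately show ?thesis using 1(2) u3 wl
          by (intro exI[of _ "N + (11 + ?c)"] exI[of _ ?w]) auto
      qed
    next
      fix k u assume "?I k u" then show "fst u 3 b = ?n" by (auto simp: sim_consts)
    next
      show "?I 0 (iput 100 ?l 0 ?s0)"
        using st s by (auto simp: counters_def)
    qed
    then obtain N u where 1: "exec (loop_code ?l b ?p) ?s0 N u" "N \<le> 9 + ?n * ((xcost x (fst t 3) + 15) + 12)"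
      "?I ?n u" by blast
    have f: "first_below ?n ?P = fst u 101 0"
      by (rule first_below_eqI) (use 1(3) in \<open>auto simp: Let_def\<close>)
    let ?u = "iput a 0 (fst u 101 0) u"
    have 0: "exec (IPut 101 (IConst 0) (IGet 3 (IConst b))) s 4 ?s0"
      by (rule exec_IPut') (simp_all add: sim_consts[OF st])
    have 2: "exec (IPut a (IConst 0) (IGet 101 (IConst 0))) u 4 ?u"
      by (rule exec_IPut') simp_all
    have "exec (scode (Find a b x) ?l) s (4 + (N + 4)) ?u"
      using exec.Seq[OF 0 exec.Seq[OF 1(1) 2]] True by simp
    moreover have "sim ?u (run (Find a b x) v t)" using True f 1(3) by (auto simp: sim_def)
    moreover have "counters ?u v" using 1(3) True by (simp add: counters_def)
    moreover have "4 + (N + 4) \<le> scost (Find a b x) (fst t 3)"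
      using 1(2) by (simp add: algebra_simps)
    ultimately show ?thesis by blast
  next
    case False
    then have "exec (scode (Find a b x) (length v)) s 1 s" using exec.Skip by auto
    with False s st show ?thesis by (intro exI[of _ 1] exI[of _ s]) auto
  qed
qed

lemma scode_Sq: "scode_ok p \<Longrightarrow> scode_ok q \<Longrightarrow> scode_ok (Sq p q)"
proof (rule scode_okI)
  fix v s t assume p: "scode_ok p" and q: "scode_ok q" and s: "counters s v" and st: "sim s t"
  from scode_okD[OF p s st] obtain N u where 1: "exec (scode p (length v)) s N u"
    "N \<le> scost p (fst t 3)" "sim u (run p v t)" "counters u v" by blast
  from scode_okD[OF q 1(4,3)] obtain N' w where 2: "exec (scode q (length v)) u N' w"
    "N' \<le> scost q (fst t 3)" "sim w (run q v (run p v t))" "counters w v" by auto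
  from exec.Seq[OF 1(1) 2(1)] show "\<exists>N u. exec (scode (Sq p q) (length v)) s N u \<and>
      N \<le> scost (Sq p q) (fst t 3) \<and> sim u (run (Sq p q) v t) \<and> counters u v"
    using 1 2 by (intro exI[of _ "N + N'"] exI[of _ w]) auto
qed

lemma scode_If0: "scode_ok p \<Longrightarrow> scode_ok q \<Longrightarrow> scode_ok (If0 x p q)"
proof (rule scode_okI)
  fix v s t assume p: "scode_ok p" and q: "scode_ok q" and s: "counters s v" and st: "sim s t"
  from xcode_exec[OF s, of x 0] obtain N w where 1: "exec (xcode x (length v) 0) s N w"
    "N \<le> xcost x (fst s 3)" "snd w 100 0 = xval x v s" "keeps (length v) 0 s w" by blast
  have w: "counters w v" "sim w t" using keeps_counters[OF 1(4) s] keeps_sim[OF 1(4) st] by simp_all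
  let ?q = "if 0 < xval x v t then p else q"
  have "scode_ok ?q" using p q by simp
  from scode_okD[OF this w] obtain N' u where 2: "exec (scode ?q (length v)) w N' u"
    "N' \<le> scost ?q (fst t 3)" "sim u (run ?q v t)" "counters u v" by blast
  have "exec (Cond (RLess (RConst 0) (reg 0)) (scode p (length v)) (scode q (length v))) w (5 + N') u"
    by (rule exec_Cond'[where N=N']) (use 2(1) 1(3) xval_cong[OF st] in \<open>simp_all split: if_splits\<close>)
  from exec.Seq[OF 1(1) this] show "\<exists>N u. exec (scode (If0 x p q) (length v)) s N u \<and>
      N \<le> scost (If0 x p q) (fst t 3) \<and> sim u (run (If0 x p q) v t) \<and> counters u v"
    using 1 2 sim_consts[OF st] by (intro exI[of _ "N + (5 + N')"] exI[of _ u]) (auto split: if_splits)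
qed

lemma fold_run_consts [simp]: "fst (fold (\<lambda>k. run p (v @ [k])) ks t) 3 = fst t 3"
  by (induction ks arbitrary: t) auto

lemma scode_For: "scode_ok p \<Longrightarrow> scode_ok (For b p)"
proof (rule scode_okI)
  fix v s t assume p: "scode_ok p" and s: "counters s v" and st: "sim s t"
  let ?l = "length v" let ?n = "fst t 3 b"
  let ?t = "\<lambda>k. fold (\<lambda>k. run p (v @ [k])) [0..<k] t"
  let ?I = "\<lambda>k u. sim u (?t k) \<and> counters u v"
  have "\<exists>N u. exec (loop_code ?l b (scode p (?l + 1))) s N u \<and> N \<le> 9 + ?n * (scost p (fst t 3) + 12) \<and> ?I ?n u \<and> fst u 100 ?l = ?n"
  proof (rule exec_loop[where I = ?I])
    fix k u assume k: "k < ?n" and I: "?I k u" and ul: "fst u 100 ?l = k"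
    have c: "counters u (v @ [k])" using I ul by (simp add: counters_snoc)
    from scode_okD[OF p c conjunct1[OF I]] obtain N w where 1: "exec (scode p (length (v @ [k]))) u N w"
      "N \<le> scost p (fst (?t k) 3)" "sim w (run p (v @ [k]) (?t k))" "counters w (v @ [k])" by blast
    have "?I (Suc k) (iput 100 ?l (Suc k) w)" "fst w 100 ?l = k"
      using 1(3,4) by (simp_all add: counters_snoc counters_iput)
    with 1 show "\<exists>N w. exec (scode p (?l + 1)) u N w \<and> N \<le> scost p (fst t 3) \<and> fst w 100 ?l = k \<and> ?I (Suc k) (iput 100 ?l (Suc k) w)"
      by (intro exI[of _ N] exI[of _ w]) auto
  next
    fix k u assume "?I k u" then show "fst u 3 b = ?n" using sim_consts[of u "?t k"] by simp
  next
    show "?I 0 (iput 100 ?l 0 s)" using st s by (simp add: counters_iput)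
  qed
  then show "\<exists>N u. exec (scode (For b p) (length v)) s N u \<and>
      N \<le> scost (For b p) (fst t 3) \<and> sim u (run (For b p) v t) \<and> counters u v" by auto
qed

text \<open>The invariant speaks of the single row-major index, so two nested loops are treated as
  one pass over the cells. It has to be insensitive to array 100 of naturals, where both counters
  change.\<close>

lemma exec_loop2:
  fixes t :: store
  assumes step: "\<And>i j s. \<lbrakk>i < fst t 3 b; j < fst t 3 c; I (i * fst t 3 c + j) s; counters s (v @ [i, j])\<rbrakk>
      \<Longrightarrow> \<exists>N s'. exec p s N s' \<and> N \<le> C \<and> I (Suc (i * fst t 3 c + j)) s' \<and> counters s' (v @ [i, j])"
    and I3: "\<And>k s. I k s \<Longrightarrow> fst s 3 = fst t 3"
    and Icnt: "\<And>k s l x. I k s \<Longrightarrow> I k (iput 100 l x s)"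
    and I: "I 0 s" and s: "counters s v"
  shows "\<exists>N s'. exec (loop_code (length v) b (loop_code (length v + 1) c p)) s N s' \<and>
     N \<le> 9 + fst t 3 b * ((9 + fst t 3 c * (C + 12)) + 12) \<and> I (fst t 3 b * fst t 3 c) s' \<and> counters s' v"
proof -
  let ?l = "length v" let ?m = "fst t 3 b" let ?n = "fst t 3 c"
  let ?I = "\<lambda>i s. I (i * ?n) s \<and> counters s v"
  have "\<exists>N s'. exec (loop_code ?l b (loop_code (?l + 1) c p)) s N s' \<and>
     N \<le> 9 + ?m * ((9 + ?n * (C + 12)) + 12) \<and> ?I ?m s' \<and> fst s' 100 ?l = ?m"
  proof (rule exec_loop[where I = ?I])
    fix i u assume i: "i < ?m" and Ii: "?I i u" and ul: "fst u 100 ?l = i"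
    let ?J = "\<lambda>j s. I (i * ?n + j) s \<and> counters s (v @ [i])"
    have "\<exists>N s'. exec (loop_code (?l + 1) c p) u N s' \<and>
       N \<le> 9 + ?n * (C + 12) \<and> ?J ?n s' \<and> fst s' 100 (?l + 1) = ?n"
    proof (rule exec_loop[where I = ?J])
      fix j w assume j: "j < ?n" and J: "?J j w" and wl: "fst w 100 (?l + 1) = j"
      have c: "counters w (v @ [i, j])" using J wl counters_snoc[of w "v @ [i]" j] by simp
      from step[OF i j conjunct1[OF J] c] obtain N w' where 1: "exec p w N w'" "N \<le> C"
        "I (Suc (i * ?n + j)) w'" "counters w' (v @ [i, j])" by blast
      have "counters w' (v @ [i])" "fst w' 100 (?l + 1) = j"
        using 1(4) counters_snoc[of w' "v @ [i]" j] by simp_all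
      with 1 Icnt[OF 1(3)] show "\<exists>N w'. exec p w N w' \<and> N \<le> C \<and> fst w' 100 (?l + 1) = j \<and>
          ?J (Suc j) (iput 100 (?l + 1) (Suc j) w')"
        by (intro exI[of _ N] exI[of _ w']) (simp add: counters_iput)
    next
      fix j w assume "?J j w" then show "fst w 3 c = ?n" using I3[of "i * ?n + j" w] by simp
    next
      show "?J 0 (iput 100 (?l + 1) 0 u)"
        using Ii ul Icnt by (simp add: counters_iput counters_snoc)
    qed
    then obtain N w where 1: "exec (loop_code (?l + 1) c p) u N w" "N \<le> 9 + ?n * (C + 12)" "?J ?n w" by blast
    have "I (Suc i * ?n) w" using 1(3) by (simp add: add.commute)
    with 1 Icnt show "\<exists>N w. exec (loop_code (?l + 1) c p) u N w \<and> N \<le> 9 + ?n * (C + 12) \<and>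
        fst w 100 ?l = i \<and> ?I (Suc i) (iput 100 ?l (Suc i) w)"
      by (intro exI[of _ N] exI[of _ w]) (simp add: counters_snoc counters_iput)
  next
    fix i u assume "?I i u" then show "fst u 3 b = ?m" using I3[of "i * ?n" u] by simp
  next
    show "?I 0 (iput 100 ?l 0 s)" using I s Icnt by (simp add: counters_iput)
  qed
  then show ?thesis by blast
qed

lemma cell_less: "i < m \<Longrightarrow> j < n \<Longrightarrow> i * n + j < m * (n::nat)"
proof -
  assume "i < m" "j < n"
  then have "i * n + j < Suc i * n" "Suc i * n \<le> m * n" by (simp, intro mult_le_mono1) simp
  then show ?thesis by linarith
qed

lemma scode_Map2: "scode_ok (Map2 a b c x)"
proof (rule scode_okI)
  fix v s t assume s: "counters s v" and st: "sim s t"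
  show "\<exists>N u. exec (scode (Map2 a b c x) (length v)) s N u \<and>
      N \<le> scost (Map2 a b c x) (fst t 3) \<and> sim u (run (Map2 a b c x) v t) \<and> counters u v"
  proof (cases "a < 100")
    case True
    let ?l = "length v" let ?m = "fst t 3 b" let ?n = "fst t 3 c"
    let ?f = "\<lambda>i. xval x (v @ [i div ?n, i mod ?n]) t"
    let ?p1 = "Seq (xcode x (?l + 2) 0) (RPut 101 (cell2 ?l c) (reg 0))"
    let ?p2 = "RPut a (cell2 ?l c) (RGet 101 (cell2 ?l c))"
    let ?I = "\<lambda>k u. sim u t \<and> (\<forall>i<k. snd u 101 i = ?f i)"
    have "\<exists>N u. exec (loop_code ?l b (loop_code (?l + 1) c ?p1)) s N u \<and>
       N \<le> 9 + ?m * ((9 + ?n * ((xcost x (fst t 3) + 11) + 12)) + 12) \<and> ?I (?m * ?n) u \<and> counters u v"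
    proof (rule exec_loop2[where I = ?I and t = t and v = v])
      fix i j u assume ij: "i < ?m" "j < ?n" and I: "?I (i * ?n + j) u" and cu: "counters u (v @ [i, j])"
      have ut: "sim u t" using I by simp
      from xcode_exec[OF cu, of x 0] obtain N w where 1: "exec (xcode x (?l + 2) 0) u N w"
        "N \<le> xcost x (fst u 3)" "snd w 100 0 = xval x (v @ [i, j]) u" "keeps (?l + 2) 0 u w" by auto
      have w: "sim w t" "counters w (v @ [i, j])"
        using keeps_sim[OF 1(4) ut] keeps_counters[OF 1(4) cu] by simp_all
      let ?w = "rput 101 (i * ?n + j) (?f (i * ?n + j)) w"
      have "exec (RPut 101 (cell2 ?l c) (reg 0)) w 11 ?w"
        by (rule exec_RPut')
          (use ij in \<open>simp_all add: cell2_icost cell2_ival[OF w(2)] sim_consts[OF w(1)] 1(3) xval_cong[OF ut]\<close>)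
      from exec.Seq[OF 1(1) this] have "exec ?p1 u (N + 11) ?w" .
      moreover have "?I (Suc (i * ?n + j)) ?w"
        using I w(1) 1(4) by (auto simp: keeps_def less_Suc_eq)
      moreover have "counters ?w (v @ [i, j])" using w(2) by (simp add: counters_def)
      ultimately show "\<exists>N w. exec ?p1 u N w \<and> N \<le> xcost x (fst t 3) + 11 \<and> ?I (Suc (i * ?n + j)) w \<and> counters w (v @ [i, j])"
        using 1(2) sim_consts[OF ut] by (intro exI[of _ "N + 11"] exI[of _ ?w]) simp
    qed (use st s in \<open>auto simp: sim_consts\<close>)
    then obtain N u where 1: "exec (loop_code ?l b (loop_code (?l + 1) c ?p1)) s N u"
       "N \<le> 9 + ?m * ((9 + ?n * ((xcost x (fst t 3) + 11) + 12)) + 12)" "?I (?m * ?n) u" "counters u v" by blast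
    let ?J = "\<lambda>k w. (\<forall>a'<100. fst w a' = fst t a' \<and> (a' \<noteq> a \<longrightarrow> snd w a' = snd t a')) \<and>
        snd w a = (\<lambda>i. if i < k then ?f i else snd t a i) \<and> (\<forall>i<?m * ?n. snd w 101 i = ?f i)"
    have "\<exists>N w. exec (loop_code ?l b (loop_code (?l + 1) c ?p2)) u N w \<and>
       N \<le> 9 + ?m * ((9 + ?n * (18 + 12)) + 12) \<and> ?J (?m * ?n) w \<and> counters w v"
    proof (rule exec_loop2[where I = ?J and t = t and v = v])
      fix i j w assume ij: "i < ?m" "j < ?n" and J: "?J (i * ?n + j) w" and cw: "counters w (v @ [i, j])"
      let ?k = "i * ?n + j"
      let ?w = "rput a ?k (?f ?k) w"
      have k: "?k < ?m * ?n" using ij by (rule cell_less)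
      have w3: "fst w 3 = fst t 3" using J by simp
      have "exec ?p2 w 18 ?w"
        by (rule exec_RPut') (use ij J k in \<open>simp_all add: cell2_icost cell2_ival[OF cw] w3\<close>)
      moreover have "?J (Suc ?k) ?w" using J True by (auto simp: less_Suc_eq fun_eq_iff)
      moreover have "counters ?w (v @ [i, j])" using cw by (simp add: counters_def)
      ultimately show "\<exists>N s'. exec ?p2 w N s' \<and> N \<le> 18 \<and> ?J (Suc ?k) s' \<and> counters s' (v @ [i, j])"
        by (intro exI[of _ 18] exI[of _ ?w] conjI) (assumption | rule order_refl | blast)+
    next
      show "?J 0 u" using 1(3) by (auto simp: sim_def True)
    qed (use 1 in auto)
    then obtain N' w where 2: "exec (loop_code ?l b (loop_code (?l + 1) c ?p2)) u N' w"
      "N' \<le> 9 + ?m * ((9 + ?n * (18 + 12)) + 12)" "?J (?m * ?n) w" "counters w v" by blast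
    have "exec (scode (Map2 a b c x) ?l) s (N + N') w" using exec.Seq[OF 1(1) 2(1)] True by simp
    moreover have "N + N' \<le> scost (Map2 a b c x) (fst t 3)"
      using 1(2) 2(2) by (simp add: algebra_simps)
    moreover have "sim w (run (Map2 a b c x) v t)" using 2(3) True by (simp add: sim_def)
    ultimately show ?thesis using 2(4) by blast
  next
    case False
    then have "exec (scode (Map2 a b c x) (length v)) s 1 s" using exec.Skip by auto
    with False s st show ?thesis by (intro exI[of _ 1] exI[of _ s]) auto
  qed
qed

lemma scode_ok: "scode_ok p"
  by (induction p) (simp_all add: scode_NSet scode_RSet scode_Find scode_Map2 scode_Sq scode_If0 scode_For)

theorem run_exec:
  "\<exists>N u. exec (scode p 0) s N u \<and> N \<le> scost p (fst s 3) \<and> (\<forall>a<100. fst u a = fst (run p [] s) a \<and> snd u a = snd (run p [] s) a)"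
  using scode_okD[OF scode_ok, of s "[]" s p] by (auto simp: counters_def sim_def)

section \<open>Polynomial bounds on the cost\<close>

lemma xcost_poly: "\<exists>T :: nat poly. \<forall>D n. (\<forall>b. n b \<le> poly R D) \<longrightarrow> xcost e n \<le> poly T D"
proof (induction e)
  case (RC k)
  show ?case by (rule exI[of _ "[:3:]"]) simp
next
  case (RG a e)
  show ?case by (rule exI[of _ "[:3 + ncost e:]"]) simp
next
  case (Plus e f)
  then obtain S T where "\<forall>D n. (\<forall>b. n b \<le> poly R D) \<longrightarrow> xcost e n \<le> poly S D"
    "\<forall>D n. (\<forall>b. n b \<le> poly R D) \<longrightarrow> xcost f n \<le> poly T D" by blast
  then show ?case by (intro exI[of _ "S + T + [:7:]"]) (auto intro: add_mono)
next
  case (Minus e f)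
  then obtain S T where "\<forall>D n. (\<forall>b. n b \<le> poly R D) \<longrightarrow> xcost e n \<le> poly S D"
    "\<forall>D n. (\<forall>b. n b \<le> poly R D) \<longrightarrow> xcost f n \<le> poly T D" by blast
  then show ?case by (intro exI[of _ "S + T + [:7:]"]) (auto intro: add_mono)
next
  case (Times e f)
  then obtain S T where "\<forall>D n. (\<forall>b. n b \<le> poly R D) \<longrightarrow> xcost e n \<le> poly S D"
    "\<forall>D n. (\<forall>b. n b \<le> poly R D) \<longrightarrow> xcost f n \<le> poly T D" by blast
  then show ?case by (intro exI[of _ "S + T + [:7:]"]) (auto intro: add_mono)
next
  case (Div e f)
  then obtain S T where "\<forall>D n. (\<forall>b. n b \<le> poly R D) \<longrightarrow> xcost e n \<le> poly S D"
    "\<forall>D n. (\<forall>b. n b \<le> poly R D) \<longrightarrow> xcost f n \<le> poly T D" by blast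
  then show ?case by (intro exI[of _ "S + T + [:7:]"]) (auto intro: add_mono)
next
  case (IfR e f g h)
  then obtain S T U V where "\<forall>D n. (\<forall>b. n b \<le> poly R D) \<longrightarrow> xcost e n \<le> poly S D"
    "\<forall>D n. (\<forall>b. n b \<le> poly R D) \<longrightarrow> xcost f n \<le> poly T D"
    "\<forall>D n. (\<forall>b. n b \<le> poly R D) \<longrightarrow> xcost g n \<le> poly U D"
    "\<forall>D n. (\<forall>b. n b \<le> poly R D) \<longrightarrow> xcost h n \<le> poly V D" by blast
  then show ?case by (intro exI[of _ "S + T + U + V + [:6:]"]) (auto intro!: add_mono)
next
  case (IfN e f g h)
  then obtain U V where
    "\<forall>D n. (\<forall>b. n b \<le> poly R D) \<longrightarrow> xcost g n \<le> poly U D"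
    "\<forall>D n. (\<forall>b. n b \<le> poly R D) \<longrightarrow> xcost h n \<le> poly V D" by blast
  then show ?case by (intro exI[of _ "U + V + [:ncost e + ncost f + 2:]"]) (auto intro: add_mono)
next
  case (SumTo b e)
  then obtain S where "\<forall>D n. (\<forall>b. n b \<le> poly R D) \<longrightarrow> xcost e n \<le> poly S D" by blast
  then show ?case by (intro exI[of _ "[:12:] + R * (S + [:19:])"]) (auto intro!: add_mono mult_mono)
qed

text \<open>All loop bounds are read from array 3, which no program writes, so one polynomial
  \<open>R\<close> bounds them throughout a run. The nesting depth is that of the program text;
  substituting \<open>R\<close> at every loop gives a polynomial that depends on the text and on
  \<open>R\<close> alone.\<close>

lemma scost_poly: "\<exists>T :: nat poly. \<forall>D n. (\<forall>b. n b \<le> poly R D) \<longrightarrow> scost p n \<le> poly T D"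
proof (induction p)
  case (NSet a e f)
  show ?case by (rule exI[of _ "[:1 + ncost e + ncost f:]"]) simp
next
  case (RSet a e x)
  obtain S where "\<forall>D n. (\<forall>b. n b \<le> poly R D) \<longrightarrow> xcost x n \<le> poly S D" using xcost_poly by blast
  then show ?case by (intro exI[of _ "[:3 + ncost e:] + S"]) auto
next
  case (Find a b x)
  obtain S where "\<forall>D n. (\<forall>b. n b \<le> poly R D) \<longrightarrow> xcost x n \<le> poly S D" using xcost_poly by blast
  then show ?case by (intro exI[of _ "[:20:] + R * (S + [:27:])"]) (auto intro!: add_mono mult_mono)
next
  case (Map2 a b c x)
  obtain S where "\<forall>D n. (\<forall>b. n b \<le> poly R D) \<longrightarrow> xcost x n \<le> poly S D" using xcost_poly by blast
  then show ?case
    by (intro exI[of _ "[:18:] + R * ([:30:] + R * (S + [:60:]) + [:20:])"]) (auto intro!: add_mono mult_mono)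
next
  case (Sq p q)
  then obtain S T where "\<forall>D n. (\<forall>b. n b \<le> poly R D) \<longrightarrow> scost p n \<le> poly S D"
    "\<forall>D n. (\<forall>b. n b \<le> poly R D) \<longrightarrow> scost q n \<le> poly T D" by blast
  then show ?case by (intro exI[of _ "S + T"]) (auto intro: add_mono)
next
  case (If0 x p q)
  obtain U where "\<forall>D n. (\<forall>b. n b \<le> poly R D) \<longrightarrow> xcost x n \<le> poly U D" using xcost_poly by blast
  moreover obtain S T where "\<forall>D n. (\<forall>b. n b \<le> poly R D) \<longrightarrow> scost p n \<le> poly S D"
    "\<forall>D n. (\<forall>b. n b \<le> poly R D) \<longrightarrow> scost q n \<le> poly T D" using If0 by blast
  ultimately show ?case by (intro exI[of _ "[:5:] + U + S + T"]) (auto intro!: add_mono)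
next
  case (For b p)
  then obtain S where "\<forall>D n. (\<forall>b. n b \<le> poly R D) \<longrightarrow> scost p n \<le> poly S D" by blast
  then show ?case by (intro exI[of _ "[:9:] + R * (S + [:12:])"]) (auto intro!: add_mono mult_mono)
qed

section \<open>Frame properties and loop invariants of programs\<close>

primrec nwrites :: "stmt \<Rightarrow> nat set" where
  "nwrites (NSet a e f) = {a}"
| "nwrites (RSet a e x) = {}"
| "nwrites (Find a b x) = {a}"
| "nwrites (Map2 a b c x) = {}"
| "nwrites (Sq p q) = nwrites p \<union> nwrites q"
| "nwrites (If0 x p q) = nwrites p \<union> nwrites q"
| "nwrites (For b p) = nwrites p"

primrec rwrites :: "stmt \<Rightarrow> nat set" where
  "rwrites (NSet a e f) = {}"
| "rwrites (RSet a e x) = {a}"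
| "rwrites (Find a b x) = {}"
| "rwrites (Map2 a b c x) = {a}"
| "rwrites (Sq p q) = rwrites p \<union> rwrites q"
| "rwrites (If0 x p q) = rwrites p \<union> rwrites q"
| "rwrites (For b p) = rwrites p"

lemma nframe: "a \<notin> nwrites p \<Longrightarrow> fst (run p v s) a = fst s a"
proof (induction p arbitrary: v s)
  case (For b p)
  have "fst (fold (\<lambda>k. run p (v @ [k])) ks s) a = fst s a" for ks s
    using For by (induction ks arbitrary: s) auto
  then show ?case by simp
qed auto

lemma rframe: "a \<notin> rwrites p \<Longrightarrow> snd (run p v s) a = snd s a"
proof (induction p arbitrary: v s)
  case (For b p)
  have "snd (fold (\<lambda>k. run p (v @ [k])) ks s) a = snd s a" for ks s
    using For by (induction ks arbitrary: s) auto
  then show ?case by simp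
qed auto

lemma run_For_inv:
  assumes "I 0 s" and "\<And>k s. k < fst s 3 b \<Longrightarrow> fst s 3 = c \<Longrightarrow> I k s \<Longrightarrow> I (Suc k) (run p (v @ [k]) s)" and "fst s 3 = c"
  shows "I (c b) (run (For b p) v s)"
proof -
  have "I k (fold (\<lambda>k. run p (v @ [k])) [0..<k] s)" if "k \<le> c b" for k
    using that
  proof (induction k)
    case 0 show ?case using assms(1) by simp
  next
    case (Suc k)
    have "I (Suc k) (run p (v @ [k]) (fold (\<lambda>k. run p (v @ [k])) [0..<k] s))"
      using Suc assms(3) by (intro assms(2)) auto
    then show ?case by simp
  qed
  then show ?thesis using assms(3) by simp
qed

lemma run_For_const:
  assumes "I 0 s" and "\<And>k s. k < n \<Longrightarrow> fst s 3 = c \<Longrightarrow> I k s \<Longrightarrow> I (Suc k) (run p (v @ [k]) s)" and "fst s 3 = c" "c b = n"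
  shows "I n (run (For b p) v s)"
  using run_For_inv[of I s b c p v] assms by simp

section \<open>Integrality from total unimodularity\<close>

lemma bij_betw_pick:
  assumes "finite J"
  shows "bij_betw (pick J) {..<card J} J"
proof -
  have sub: "J \<subseteq> pick J ` {..<card J}"
  proof
    fix i assume i: "i \<in> J"
    have "{a \<in> J. a < i} \<subset> J" using i by auto
    then have "card {a \<in> J. a < i} < card J" using assms by (simp add: psubset_card_mono)
    moreover have "i = pick J (card {a \<in> J. a < i})" using pick_card_in_set[OF i] by simp
    ultimately show "i \<in> pick J ` {..<card J}" by blast
  qed
  have le: "card (pick J ` {..<card J}) \<le> card J" using card_image_le[of "{..<card J}" "pick J"] by simp
  have eq: "J = pick J ` {..<card J}" using card_seteq[OF _ sub le] by simp
  then have "card (pick J ` {..<card J}) = card {..<card J}" by simp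
  then have "inj_on (pick J) {..<card J}" by (simp add: eq_card_imp_inj_on)
  with eq show ?thesis by (simp add: bij_betw_def)
qed

text \<open>\<open>submatrix\<close> renumbers the chosen rows and columns from 0. Through
  \<open>pick\<close> the adjugate identities are restated for functions on the original index sets,
  the form of Cramer's rule used below.\<close>

locale square_sub =
  fixes B :: "int mat" and I J :: "nat set"
  assumes I: "I \<subseteq> {..<dim_row B}" and J: "J \<subseteq> {..<dim_col B}" and card: "card I = card J"
begin

abbreviation "S \<equiv> submatrix B I J"

lemma fin: "finite I" "finite J"
  using I J finite_subset by blast+

lemma card_sets: "card {i. i < dim_row B \<and> i \<in> I} = card J" "card {j. j < dim_col B \<and> j \<in> J} = card J"
proof -
  have "{i. i < dim_row B \<and> i \<in> I} = I" "{j. j < dim_col B \<and> j \<in> J} = J" using I J by auto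
  then show "card {i. i < dim_row B \<and> i \<in> I} = card J" "card {j. j < dim_col B \<and> j \<in> J} = card J"
    using card by simp_all
qed

lemma S_carrier: "S \<in> carrier_mat (card J) (card J)"
  by (rule carrier_matI) (simp_all add: dim_submatrix card_sets)

lemma S_index: "a < card J \<Longrightarrow> b < card J \<Longrightarrow> S $$ (a, b) = B $$ (pick I a, pick J b)"
  by (rule submatrix_index) (simp_all add: card_sets)

lemma S_sum:
  fixes u :: "nat \<Rightarrow> 'b :: comm_ring_1"
  assumes "a < card J"
  shows "(\<Sum>b<card J. of_int (S $$ (a, b)) * u (pick J b)) = (\<Sum>j\<in>J. of_int (B $$ (pick I a, j)) * u j)"
proof -
  have "(\<Sum>b<card J. of_int (S $$ (a, b)) * u (pick J b)) =
      (\<Sum>b<card J. of_int (B $$ (pick I a, pick J b)) * u (pick J b))"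
    using assms by (intro sum.cong) (simp_all add: S_index)
  also have "\<dots> = (\<Sum>j\<in>J. of_int (B $$ (pick I a, j)) * u j)"
    by (rule sum.reindex_bij_betw[OF bij_betw_pick[OF fin(2)]])
  finally show ?thesis .
qed

lemma adj_left: "a < card J \<Longrightarrow> c < card J \<Longrightarrow>
    (\<Sum>b<card J. adj_mat S $$ (a, b) * S $$ (b, c)) = (if a = c then det S else 0)"
  using arg_cong[OF adj_mat(3)[OF S_carrier], of "\<lambda>A. A $$ (a, c)"] adj_mat(1)[OF S_carrier] S_carrier
  by (simp add: scalar_prod_def lessThan_atLeast0)

lemma adj_right: "a < card J \<Longrightarrow> c < card J \<Longrightarrow>
    (\<Sum>b<card J. S $$ (a, b) * adj_mat S $$ (b, c)) = (if a = c then det S else 0)"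
  using arg_cong[OF adj_mat(2)[OF S_carrier], of "\<lambda>A. A $$ (a, c)"] adj_mat(1)[OF S_carrier] S_carrier
  by (simp add: scalar_prod_def lessThan_atLeast0)

lemma inj:
  fixes u :: "nat \<Rightarrow> real"
  assumes det: "det S \<noteq> 0" and u: "\<And>i. i \<in> I \<Longrightarrow> (\<Sum>j\<in>J. of_int (B $$ (i, j)) * u j) = 0" and j: "j \<in> J"
  shows "u j = 0"
proof -
  let ?k = "card J"
  obtain c where c: "c < ?k" "j = pick J c"
    using bij_betw_pick[OF fin(2)] j by (auto simp: bij_betw_def)
  have row: "(\<Sum>b<?k. of_int (S $$ (a, b)) * u (pick J b)) = 0" if "a < ?k" for a
  proof -
    have "pick I a \<in> I" using that card bij_betw_pick[OF fin(1)] by (auto simp: bij_betw_def)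
    then show ?thesis using S_sum[OF that, of u] u by simp
  qed
  have "0 = (\<Sum>a<?k. of_int (adj_mat S $$ (c, a)) * (\<Sum>b<?k. of_int (S $$ (a, b)) * u (pick J b)))"
    by (simp add: row)
  also have "\<dots> = (\<Sum>b<?k. (\<Sum>a<?k. of_int (adj_mat S $$ (c, a) * S $$ (a, b))) * u (pick J b))"
    by (simp add: sum_distrib_left sum_distrib_right mult.assoc) (rule sum.swap)
  also have "\<dots> = (\<Sum>b<?k. of_int (if c = b then det S else 0) * u (pick J b))"
    by (intro sum.cong refl) (simp add: adj_left[OF c(1)] del: of_int_mult flip: of_int_sum)
  also have "\<dots> = of_int (det S) * u j"
    using c by (simp add: if_distrib[of of_int] if_distrib[of "\<lambda>x. x * _"] sum.delta cong: if_cong)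
  finally show ?thesis using det by simp
qed

lemma solve:
  fixes r :: "nat \<Rightarrow> real"
  assumes det: "det S \<noteq> 0"
  obtains u :: "nat \<Rightarrow> real" where "\<And>i. i \<in> I \<Longrightarrow> (\<Sum>j\<in>J. of_int (B $$ (i, j)) * u j) = r i"
    "\<And>j. \<lbrakk>\<forall>i\<in>I. r i \<in> \<int>; det S \<in> {0, 1, -1}; j \<in> J\<rbrakk> \<Longrightarrow> u j \<in> \<int>"
proof -
  let ?k = "card J"
  define w where "w b = (\<Sum>c<?k. of_int (adj_mat S $$ (b, c)) * r (pick I c)) / of_int (det S)" for b
  define u where "u j = w (the_inv_into {..<?k} (pick J) j)" for j
  have bij: "bij_betw (pick J) {..<?k} J" "bij_betw (pick I) {..<?k} I"
    using bij_betw_pick[OF fin(2)] bij_betw_pick[OF fin(1)] card by simp_all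
  have uw: "u (pick J b) = w b" if "b < ?k" for b
    using bij(1) that by (simp add: u_def bij_betw_def the_inv_into_f_f)
  show ?thesis
  proof (rule that[of u])
    fix i assume "i \<in> I"
    then obtain a where a: "a < ?k" "i = pick I a" using bij(2) by (auto simp: bij_betw_def)
    have "(\<Sum>j\<in>J. of_int (B $$ (i, j)) * u j) = (\<Sum>b<?k. of_int (S $$ (a, b)) * w b)"
      using S_sum[OF a(1), of u] a(2) by (simp add: uw)
    also have "\<dots> = (\<Sum>c<?k. (\<Sum>b<?k. of_int (S $$ (a, b) * adj_mat S $$ (b, c))) * r (pick I c)) / of_int (det S)"
      by (simp add: w_def sum_distrib_left sum_distrib_right mult.assoc sum_divide_distrib) (rule sum.swap)
    also have "\<dots> = (\<Sum>c<?k. of_int (if a = c then det S else 0) * r (pick I c)) / of_int (det S)"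
      by (intro arg_cong2[where f="(/)"] sum.cong refl) (simp add: adj_right[OF a(1)] del: of_int_mult flip: of_int_sum)
    also have "\<dots> = r i"
      using a det by (simp add: if_distrib[of of_int] if_distrib[of "\<lambda>x. x * _"] sum.delta cong: if_cong)
    finally show "(\<Sum>j\<in>J. of_int (B $$ (i, j)) * u j) = r i" .
  next
    fix j assume r: "\<forall>i\<in>I. r i \<in> \<int>" and d: "det S \<in> {0, 1, -1}" and "j \<in> J"
    then obtain b where b: "b < ?k" "j = pick J b" using bij(1) by (auto simp: bij_betw_def)
    have "(\<Sum>c<?k. of_int (adj_mat S $$ (b, c)) * r (pick I c)) \<in> \<int>"
      using r bij(2) by (intro Ints_sum Ints_mult) (auto simp: bij_betw_def)
    moreover have "real_of_int (det S) = 1 \<or> real_of_int (det S) = -1" using d det by auto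
    ultimately have "w b \<in> \<int>" unfolding w_def by (auto simp: Ints_minus)
    with b uw show "u j \<in> \<int>" by simp
  qed
qed

lemma singular:
  assumes "det S = 0"
  obtains u :: "nat \<Rightarrow> real" where "\<And>i. i \<in> I \<Longrightarrow> (\<Sum>j\<in>J. of_int (B $$ (i, j)) * u j) = 0" "\<exists>j\<in>J. u j \<noteq> 0"
proof -
  let ?k = "card J"
  from assms obtain v where v: "v \<in> carrier_vec ?k" "v \<noteq> 0\<^sub>v ?k" "S *\<^sub>v v = 0\<^sub>v ?k"
    using det_0_iff_vec_prod_zero[OF S_carrier] by auto
  define u :: "nat \<Rightarrow> real" where "u j = of_int (v $ the_inv_into {..<?k} (pick J) j)" for j
  have bij: "bij_betw (pick J) {..<?k} J" "bij_betw (pick I) {..<?k} I"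
    using bij_betw_pick[OF fin(2)] bij_betw_pick[OF fin(1)] card by simp_all
  have uv: "u (pick J b) = of_int (v $ b)" if "b < ?k" for b
    using bij(1) that by (simp add: u_def bij_betw_def the_inv_into_f_f)
  show ?thesis
  proof (rule that[of u])
    fix i assume "i \<in> I"
    then obtain a where a: "a < ?k" "i = pick I a" using bij(2) by (auto simp: bij_betw_def)
    have "(\<Sum>j\<in>J. of_int (B $$ (i, j)) * u j) = (\<Sum>b<?k. of_int (S $$ (a, b) * v $ b))"
      using S_sum[OF a(1), of u] a(2) by (simp add: uv)
    also have "\<dots> = of_int ((S *\<^sub>v v) $ a)"
      using a v(1) S_carrier by (simp add: scalar_prod_def lessThan_atLeast0)
    finally show "(\<Sum>j\<in>J. of_int (B $$ (i, j)) * u j) = 0" using v(3) a(1) by simp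
  next
    obtain b where "b < ?k" "v $ b \<noteq> 0" using v(1,2) by (metis carrier_vecD eq_vecI index_zero_vec)
    then show "\<exists>j\<in>J. u j \<noteq> 0" using uv bij(1) by (intro bexI[of _ "pick J b"]) (auto simp: bij_betw_def)
  qed
qed

end

text \<open>A nonsingular minor with the most columns uses all of \<open>J\<close>: a further column
  could be cancelled by the columns of the minor in every row of \<open>I\<close>, against
  injectivity. On this minor, of determinant 1 or -1, Cramer's rule expresses \<open>y\<close>
  through integers.\<close>

lemma totally_unimodular_integral:
  fixes y :: "nat \<Rightarrow> real"
  assumes tu: "totally_unimodular B" and I: "I \<subseteq> {..<dim_row B}" and J: "J \<subseteq> {..<dim_col B}"
    and inj: "\<And>u :: nat \<Rightarrow> real. (\<And>i. i \<in> I \<Longrightarrow> (\<Sum>j\<in>J. of_int (B $$ (i, j)) * u j) = 0) \<Longrightarrow> \<forall>j\<in>J. u j = 0"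
    and y: "\<And>i. i \<in> I \<Longrightarrow> (\<Sum>j\<in>J. of_int (B $$ (i, j)) * y j) \<in> \<int>" and j: "j \<in> J"
  shows "y j \<in> \<int>"
proof -
  have fin: "finite I" "finite J" using I J finite_subset by blast+
  define good where "good = {(I', J'). I' \<subseteq> I \<and> J' \<subseteq> J \<and> card I' = card J' \<and> det (submatrix B I' J') \<noteq> 0}"
  have ne: "({}, {}) \<in> good"
  proof -
    have "submatrix B {} {} \<in> carrier_mat 0 0" by (rule carrier_matI) (simp_all add: dim_submatrix)
    then show ?thesis by (simp add: good_def det_dim_zero)
  qed
  have fg: "finite good"
    by (rule finite_subset[of _ "Pow I \<times> Pow J"]) (auto simp: good_def fin)
  obtain I' J' where "(I', J') \<in> good" and mx: "\<And>I2 J2. (I2, J2) \<in> good \<Longrightarrow> card J2 \<le> card J'"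
  proof -
    let ?M = "(card \<circ> snd) ` good"
    have "Max ?M \<in> ?M" using fg ne by (intro Max_in) auto
    then obtain z where z: "z \<in> good" "card (snd z) = Max ?M" by auto
    have "card J2 \<le> card (snd z)" if "(I2, J2) \<in> good" for I2 J2
      unfolding z(2) using fg that by (intro Max_ge) (auto intro!: image_eqI[of _ _ "(I2, J2)"])
    with z(1) show ?thesis using that[of "fst z" "snd z"] by simp
  qed
  then have IJ: "I' \<subseteq> I" "J' \<subseteq> J" "card I' = card J'" "det (submatrix B I' J') \<noteq> 0" by (auto simp: good_def)
  interpret sq: square_sub B I' J' using IJ I J by unfold_locales auto
  have "J' = J"
  proof (rule ccontr)
    assume "J' \<noteq> J"
    then obtain k where k: "k \<in> J" "k \<notin> J'" using IJ by auto
    obtain h where h: "\<And>i. i \<in> I' \<Longrightarrow> (\<Sum>j\<in>J'. of_int (B $$ (i, j)) * h j) = - real_of_int (B $$ (i, k))"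
      by (rule sq.solve[OF IJ(4), of "\<lambda>i. - real_of_int (B $$ (i, k))"]) blast
    \<comment> \<open>Column \<open>k\<close> plus the combination of the columns in
      \<open>J'\<close> that cancels it in the rows \<open>I'\<close>; the remaining rows of
      \<open>I\<close> are to be shown to vanish as well.\<close>
    define u where "u j = (if j \<in> J' then h j else if j = k then 1 else 0)" for j
    have usum: "(\<Sum>j\<in>J. of_int (B $$ (i, j)) * u j) = (\<Sum>j\<in>J'. of_int (B $$ (i, j)) * h j) + of_int (B $$ (i, k))" for i
    proof -
      have "(\<Sum>j\<in>J. of_int (B $$ (i, j)) * u j) = (\<Sum>j\<in>insert k J'. of_int (B $$ (i, j)) * u j)"
        using IJ(2) k by (intro sum.mono_neutral_right fin) (auto simp: u_def)
      also have "\<dots> = (\<Sum>j\<in>J'. of_int (B $$ (i, j)) * u j) + of_int (B $$ (i, k))"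
        using k sq.fin by (simp add: u_def)
      also have "(\<Sum>j\<in>J'. of_int (B $$ (i, j)) * u j) = (\<Sum>j\<in>J'. of_int (B $$ (i, j)) * h j)"
        by (intro sum.cong) (simp_all add: u_def)
      finally show ?thesis .
    qed
    have "(\<Sum>j\<in>J. of_int (B $$ (i, j)) * u j) = 0" if i: "i \<in> I" for i
    proof (cases "i \<in> I'")
      case True
      then show ?thesis using usum h by simp
    next
      case False
      interpret sq2: square_sub B "insert i I'" "insert k J'"
        using IJ I J i k False sq.fin by unfold_locales auto
      \<comment> \<open>By maximality the bordered minor is singular. Its kernel vector
        \<open>g\<close> is a multiple of \<open>u\<close>, because the inner minor is injective,
        and so \<open>u\<close> vanishes in row \<open>i\<close> too.\<close>
      have "det (submatrix B (insert i I') (insert k J')) = 0"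
      proof (rule ccontr)
        assume "det (submatrix B (insert i I') (insert k J')) \<noteq> 0"
        then have "(insert i I', insert k J') \<in> good" using i k IJ sq2.card by (auto simp: good_def)
        from mx[OF this] k sq.fin show False by simp
      qed
      then obtain g where
        g: "\<And>i'. i' \<in> insert i I' \<Longrightarrow> (\<Sum>j\<in>insert k J'. of_int (B $$ (i', j)) * g j) = (0::real)"
        and g0: "\<exists>j\<in>insert k J'. g j \<noteq> 0"
        by (rule sq2.singular) blast
      have g': "(\<Sum>j\<in>J'. of_int (B $$ (i', j)) * g j) = - of_int (B $$ (i', k)) * g k" if "i' \<in> insert i I'" for i'
        using g[OF that] k sq.fin by simp
      have gk: "g k \<noteq> 0"
      proof
        assume "g k = 0"
        then have "g j = 0" if "j \<in> J'" for j
          using sq.inj[OF IJ(4) _ that, of g] g' by simp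
        with \<open>g k = 0\<close> g0 show False by auto
      qed
      have "g j - g k * h j = 0" if "j \<in> J'" for j
        by (rule sq.inj[OF IJ(4) _ that])
          (use g' h in \<open>simp add: right_diff_distrib sum_subtractf mult.left_commute[of _ "g k"] flip: sum_distrib_left\<close>)
      then have "(\<Sum>j\<in>J'. of_int (B $$ (i, j)) * g j) = (\<Sum>j\<in>J'. g k * (of_int (B $$ (i, j)) * h j))"
        by (intro sum.cong) simp_all
      then have "g k * (\<Sum>j\<in>J'. of_int (B $$ (i, j)) * h j) = - of_int (B $$ (i, k)) * g k"
        using g'[of i] by (simp add: sum_distrib_left)
      then have "(\<Sum>j\<in>J'. of_int (B $$ (i, j)) * h j) = - of_int (B $$ (i, k))"
        using gk mult_left_cancel[OF gk, of "\<Sum>j\<in>J'. of_int (B $$ (i, j)) * h j" "- of_int (B $$ (i, k))"] by simp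
      then show ?thesis using usum by simp
    qed
    from inj[OF this] k show False by (auto simp: u_def)
  qed
  obtain u where u: "\<And>i. i \<in> I' \<Longrightarrow> (\<Sum>j\<in>J'. of_int (B $$ (i, j)) * u j) = (\<Sum>j\<in>J'. of_int (B $$ (i, j)) * y j)"
    "\<And>j. \<lbrakk>\<forall>i\<in>I'. (\<Sum>j\<in>J'. of_int (B $$ (i, j)) * y j) \<in> \<int>; det (submatrix B I' J') \<in> {0, 1, -1}; j \<in> J'\<rbrakk> \<Longrightarrow> u j \<in> \<int>"
    by (rule sq.solve[OF IJ(4), of "\<lambda>i. \<Sum>j\<in>J'. of_int (B $$ (i, j)) * y j"]) blast
  have "y j - u j = 0"
    by (rule sq.inj[OF IJ(4)]) (use u(1) j \<open>J' = J\<close> in \<open>simp_all add: right_diff_distrib sum_subtractf\<close>)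
  moreover have "det (submatrix B I' J') \<in> {0, 1, -1}"
    using tu sq.I sq.J sq.card unfolding totally_unimodular_def by blast
  then have "u j \<in> \<int>" using u(2) y IJ(1) j \<open>J' = J\<close> by blast
  ultimately show ?thesis by simp
qed

section \<open>Approximately optimal solutions of unimodular programs\<close>

text \<open>The program lives on the nonnegative part of \<open>x0 + L\<close>, where
  \<open>L\<close> is the column space of \<open>A\<close>; the leading identity block makes the
  first \<open>N\<close> coordinates free parameters. \<open>integral\<close> is unimodularity
  stated for the subspace instead of for minors, which makes it independent of the chosen basis of
  \<open>L\<close>.\<close>

locale unimodular_lp =
  fixes M N :: nat and A :: "nat \<Rightarrow> nat \<Rightarrow> real" and L :: "(nat \<Rightarrow> real) \<Rightarrow> bool"
    and x0 g :: "nat \<Rightarrow> real"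
  defines "L h \<equiv> \<exists>z. \<forall>i<M. h i = (\<Sum>j<N. A i j * z j)"
  assumes NM: "N \<le> M"
    and A_id: "\<And>i j. i < N \<Longrightarrow> j < N \<Longrightarrow> A i j = (if i = j then 1 else 0)"
    and A_bound: "\<And>i j. i < M \<Longrightarrow> j < N \<Longrightarrow> \<bar>A i j\<bar> \<le> 1"
    and integral: "\<And>F h i. \<lbrakk>F \<subseteq> {..<M}; L h; \<forall>i\<in>F. h i \<in> \<int>;
        \<And>h'. L h' \<Longrightarrow> \<forall>i\<in>F. h' i = 0 \<Longrightarrow> \<forall>i<M. h' i = 0; i < M\<rbrakk> \<Longrightarrow> h i \<in> \<int>"
    and g: "\<And>i. i < M \<Longrightarrow> 0 \<le> g i"
begin

lemma L_cong: "(\<And>i. i < M \<Longrightarrow> h i = h' i) \<Longrightarrow> L h \<Longrightarrow> L h'"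
  unfolding L_def by auto

lemma L_add: "L h \<Longrightarrow> L h' \<Longrightarrow> L (\<lambda>i. h i + h' i)"
proof -
  assume "L h" "L h'"
  then obtain z z' where "\<forall>i<M. h i = (\<Sum>j<N. A i j * z j)" "\<forall>i<M. h' i = (\<Sum>j<N. A i j * z' j)"
    unfolding L_def by auto
  then show ?thesis unfolding L_def
    by (intro exI[of _ "\<lambda>j. z j + z' j"]) (simp add: distrib_left sum.distrib)
qed

lemma L_scale: "L h \<Longrightarrow> L (\<lambda>i. c * h i)"
proof -
  assume "L h"
  then obtain z where "\<forall>i<M. h i = (\<Sum>j<N. A i j * z j)" unfolding L_def by auto
  then show ?thesis unfolding L_def
    by (intro exI[of _ "\<lambda>j. c * z j"]) (simp add: sum_distrib_left mult.left_commute)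
qed

lemma L_diff: "L h \<Longrightarrow> L h' \<Longrightarrow> L (\<lambda>i. h i - h' i)"
  using L_add[OF _ L_scale[of h' "-1"]] by simp

lemma L_column: "j < N \<Longrightarrow> L (\<lambda>i. A i j)"
  unfolding L_def by (intro exI[of _ "\<lambda>k. if k = j then 1 else 0"])
    (simp add: if_distrib[of "\<lambda>x. _ * x"] cong: if_cong)

section \<open>Elementary vectors of a unimodular subspace\<close>

definition "determined F \<longleftrightarrow> (\<forall>h. L h \<longrightarrow> (\<forall>i\<in>F. h i = 0) \<longrightarrow> (\<forall>i<M. h i = 0))"

lemma determined_integral:
  "\<lbrakk>determined F; F \<subseteq> {..<M}; L h; \<forall>i\<in>F. h i \<in> \<int>; i < M\<rbrakk> \<Longrightarrow> h i \<in> \<int>"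
  by (rule integral[of F]) (auto simp: determined_def)

lemma Ints_inverse_abs:
  fixes a :: real
  assumes "a \<in> \<int>" "1 / a \<in> \<int>" "a \<noteq> 0"
  shows "a = 1 \<or> a = -1"
proof -
  obtain k l where kl: "a = of_int k" "1 / a = of_int l" using assms by (auto elim!: Ints_cases)
  then have "of_int (k * l) = (1::real)" using assms(3) by (metis nonzero_eq_divide_eq mult.commute of_int_mult)
  then have "k * l = 1" using of_int_eq_1_iff by blast
  then have "k = 1 \<or> k = -1" using zmult_eq_1_iff by blast
  with kl show ?thesis by auto
qed

text \<open>The vectors of \<open>L\<close> that vanish on \<open>F\<close> are the multiples of
  \<open>h\<close>. Hence any coordinate \<open>k\<close> with \<open>h k \<noteq> 0\<close> may
  replace \<open>i0\<close>: normalized at \<open>i0\<close> the vector shows that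
  \<open>h k\<close> is integral, and normalized at \<open>k\<close> that \<open>1 / h k\<close>
  is.\<close>

lemma unit_entries:
  assumes h: "L h" and i0: "i0 < M" "h i0 = 1" and F: "F \<subseteq> {..<M}" "\<forall>i\<in>F. h i = 0"
    and det: "determined (insert i0 F)" and k: "k < M"
  shows "h k \<in> {-1, 0, 1}"
proof (cases "h k = 0")
  case False
  have "h k \<in> \<int>" by (rule determined_integral[OF det _ h]) (use i0 F k in auto)
  moreover have "1 / h k \<in> \<int>"
  proof -
    have det2: "determined (insert k F)" unfolding determined_def
    proof (intro allI impI)
      fix u i assume u: "L u" "\<forall>i\<in>insert k F. u i = 0" and i: "i < M"
      let ?w = "\<lambda>i. u i - u i0 * h i"
      have "L ?w" "\<forall>i\<in>insert i0 F. ?w i = 0"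
        using L_diff[OF u(1) L_scale[OF h]] u(2) F(2) i0 by simp_all
      then have w: "\<forall>i<M. ?w i = 0" using det unfolding determined_def by blast
      then have "u k = u i0 * h k" using k by simp
      then have "u i0 = 0" using u(2) False by simp
      then show "u i = 0" using w i by simp
    qed
    have "1 / h k * h i0 \<in> \<int>"
      by (rule determined_integral[OF det2 _ L_scale[OF h, of "1 / h k"]]) (use F k i0 False in auto)
    then show ?thesis using i0 by simp
  qed
  ultimately show ?thesis using Ints_inverse_abs False by blast
qed simp

text \<open>Take a vector of least support among those of \<open>L\<close> that agree in sign with
  \<open>v\<close> on their support and do not vanish at \<open>i0\<close>. It is elementary, since
  otherwise adding a multiple of another vector supported in it, zero at \<open>i0\<close>, would
  shrink the support. Then \<open>unit_entries\<close> applies.\<close>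

lemma conformal:
  assumes v: "L v" and i0: "i0 < M" "v i0 > 0"
  obtains d where "L d" "d i0 = 1" "\<And>k. k < M \<Longrightarrow> d k \<in> {-1, 0, 1}"
    "\<And>k. k < M \<Longrightarrow> d k \<noteq> 0 \<Longrightarrow> d k * v k > 0"
proof -
  define S where "S u = {k. k < M \<and> u k \<noteq> (0::real)}" for u
  define good where "good u \<longleftrightarrow> L u \<and> u i0 \<noteq> 0 \<and> (\<forall>k<M. u k \<noteq> 0 \<longrightarrow> u k * v k > 0)" for u
  have "good v" using v i0 by (auto simp: good_def mult_pos_neg not_less zero_less_mult_iff)
  then obtain u where u: "good u" and mn: "\<And>u'. good u' \<Longrightarrow> card (S u) \<le> card (S u')"
    using exists_least_iff[of "\<lambda>n. \<exists>u. good u \<and> card (S u) = n"] by (metis not_le)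
  let ?F = "{k. k < M \<and> u k = 0}"
  have det: "determined (insert i0 ?F)" unfolding determined_def
  proof (intro allI impI, rule ccontr)
    fix h i assume h: "L h" "\<forall>i\<in>insert i0 ?F. h i = 0" and i: "i < M" "h i \<noteq> 0"
    let ?H = "{k. k < M \<and> h k \<noteq> 0}"
    have "finite ?H" "?H \<noteq> {}" using i by auto
    \<comment> \<open>The least ratio belongs to the coordinate that reaches 0 first, before any
      other can change its sign.\<close>
    then obtain k where k: "k \<in> ?H" and kmin: "\<And>j. j \<in> ?H \<Longrightarrow> \<bar>u k\<bar> / \<bar>h k\<bar> \<le> \<bar>u j\<bar> / \<bar>h j\<bar>"
      using arg_min_if_finite[of ?H "\<lambda>k. \<bar>u k\<bar> / \<bar>h k\<bar>"] by (metis (no_types, lifting) not_le)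
    define t where "t = - (u k / h k)"
    let ?u = "\<lambda>i. u i + t * h i"
    have uk: "?u k = 0" using k by (simp add: t_def)
    have le: "\<bar>t * h j\<bar> \<le> \<bar>u j\<bar>" if "j < M" for j
    proof (cases "h j = 0")
      case False
      then have "\<bar>u k\<bar> / \<bar>h k\<bar> \<le> \<bar>u j\<bar> / \<bar>h j\<bar>" using kmin that by simp
      then show ?thesis using False by (simp add: t_def abs_mult field_simps abs_divide)
    qed simp
    have sg: "?u j * v j > 0" if "j < M" "?u j \<noteq> 0" for j
    proof -
      have "u j \<noteq> 0" using h(2) that by auto
      then have "u j * v j > 0" using u that by (simp add: good_def)
      then show ?thesis using le[OF that(1)] that(2) by (auto simp: zero_less_mult_iff)
    qed
    have "good ?u" unfolding good_def
      using L_add[OF _ L_scale[OF h(1)]] u h(2) sg by (auto simp: good_def)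
    moreover have "S ?u \<subset> S u"
    proof
      show "S ?u \<subseteq> S u" using h(2) by (auto simp: S_def)
      show "S ?u \<noteq> S u" using uk k h(2) by (auto simp: S_def)
    qed
    then have "card (S ?u) < card (S u)" by (intro psubset_card_mono) (auto simp: S_def)
    ultimately show False using mn[of ?u] by simp
  qed
  have Lu: "L u" and u0: "u i0 \<noteq> 0" and ucon: "\<And>k. k < M \<Longrightarrow> u k \<noteq> 0 \<Longrightarrow> u k * v k > 0"
    using u by (auto simp: good_def)
  have pos: "u i0 > 0" using ucon[OF i0(1) u0] i0(2) by (simp add: zero_less_mult_iff)
  let ?d = "\<lambda>k. 1 / u i0 * u k"
  have Ld: "L ?d" by (rule L_scale[OF Lu])
  show ?thesis
  proof (rule that[OF Ld])
    show "?d i0 = 1" using u0 by simp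
    show "?d k \<in> {-1, 0, 1}" if "k < M" for k
      by (rule unit_entries[OF Ld i0(1) _ _ _ det that]) (use u0 in auto)
    show "?d k * v k > 0" if "k < M" "?d k \<noteq> 0" for k
      using ucon[OF that(1)] that(2) pos by (simp add: field_simps)
  qed
qed

section \<open>Reduced costs, fixed coordinates and the two kinds of steps\<close>

definition "feas x \<longleftrightarrow> (\<forall>i<M. 0 \<le> x i \<and> x i \<in> \<int>) \<and> L (\<lambda>i. x i - x0 i)"

definition "cost x = (\<Sum>i<M. g i * x i)"

text \<open>\<open>Z\<close> marks the coordinates fixed to \<open>0\<close>, and \<open>r\<close> may replace the costs \<open>g\<close> along the remaining
  directions. The last conjunct says that fixing \<open>Z\<close> does not lose the optimum.\<close>

definition "invar Z x r \<longleftrightarrow> feas x \<and> (\<forall>i<M. Z i \<longrightarrow> x i = 0) \<and>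
   (\<forall>h. L h \<longrightarrow> (\<forall>i<M. Z i \<longrightarrow> h i = 0) \<longrightarrow> (\<Sum>i<M. r i * h i) = (\<Sum>i<M. g i * h i)) \<and>
   (\<forall>x'. feas x' \<longrightarrow> (\<exists>x''. feas x'' \<and> (\<forall>i<M. Z i \<longrightarrow> x'' i = 0) \<and> cost x'' \<le> cost x'))"

definition "eps_opt Z x r e \<longleftrightarrow> (\<forall>i<M. \<not> Z i \<longrightarrow> - e \<le> r i \<and> (0 < x i \<longrightarrow> r i \<le> e))"

lemma feas_diff: "feas x \<Longrightarrow> feas x' \<Longrightarrow> L (\<lambda>i. x i - x' i)"
  unfolding feas_def using L_diff[of "\<lambda>i. x i - x0 i" "\<lambda>i. x' i - x0 i"] by simp

lemma invar_cong:
  assumes "invar Z x r" "\<And>i. i < M \<Longrightarrow> Z' i = Z i" "\<And>i. i < M \<Longrightarrow> x' i = x i" "\<And>i. i < M \<Longrightarrow> r' i = r i"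
  shows "invar Z' x' r'"
proof -
  have "feas x'" using assms(1) L_cong[of "\<lambda>i. x i - x0 i" "\<lambda>i. x' i - x0 i"] assms(3)
    by (simp add: invar_def feas_def)
  moreover have "(\<Sum>i<M. r' i * h i) = (\<Sum>i<M. r i * h i)" for h
    by (intro sum.cong) (simp_all add: assms(4))
  ultimately show ?thesis using assms by (simp add: invar_def)
qed

text \<open>With \<open>r\<close> zero off \<open>Z\<close>, all feasible points that vanish on
  \<open>Z\<close> have the same cost, and one of them is as cheap as any given competitor.\<close>

lemma invar_optimal:
  assumes invar: "invar Z x r" and r: "\<And>i. i < M \<Longrightarrow> \<not> Z i \<Longrightarrow> r i = 0" and x': "feas x'"
  shows "cost x \<le> cost x'"
proof -
  obtain y where y: "feas y" "\<forall>i<M. Z i \<longrightarrow> y i = 0" "cost y \<le> cost x'"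
    using invar x' by (auto simp: invar_def)
  have "L (\<lambda>i. y i - x i)" using y invar by (intro feas_diff) (auto simp: invar_def)
  moreover have "\<forall>i<M. Z i \<longrightarrow> y i - x i = 0" using y invar by (auto simp: invar_def)
  ultimately have "(\<Sum>i<M. g i * (y i - x i)) = (\<Sum>i<M. r i * (y i - x i))" using invar by (auto simp: invar_def)
  also have "\<dots> = 0" using r \<open>\<forall>i<M. Z i \<longrightarrow> y i - x i = 0\<close> by (intro sum.neutral) auto
  finally have "cost y = cost x" by (simp add: cost_def right_diff_distrib sum_subtractf)
  with y show ?thesis by simp
qed

text \<open>\<open>x\<close> itself vanishes where \<open>r\<close> exceeds \<open>M * e\<close>, as
  positive entries of \<open>x\<close> have \<open>r \<le> e\<close>. A feasible \<open>y\<close>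
  that is positive there is moved towards \<open>x\<close> by a conformal \<open>d\<close> with
  \<open>d i = 1\<close>. Every other term of the pairing of \<open>r\<close> with \<open>d\<close>
  is at least \<open>- e\<close>: a rising entry has \<open>r \<ge> - e\<close>, and where
  \<open>d k = -1\<close> one has \<open>0 \<le> y k < x k\<close>, so \<open>r k \<le> e\<close>.
  Removing \<open>d\<close> therefore does not raise the cost, and it lowers the integral sum of the
  entries to be fixed by at least 1, which ends the descent.\<close>

lemma invar_fix:
  assumes invar: "invar Z x r" and eo: "eps_opt Z x r e" and e: "0 \<le> e"
    and Z': "\<And>i. i < M \<Longrightarrow> Z' i \<longleftrightarrow> Z i \<or> r i > real M * e"
  shows "invar Z' x r"
proof -
  have fx: "feas x" using invar by (simp add: invar_def)
  have big: "e < r i" if "i < M" "r i > real M * e" for i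
  proof -
    have "1 * e \<le> real M * e" using that(1) e by (intro mult_right_mono) auto
    with that(2) show ?thesis by simp
  qed
  have xZ': "x i = 0" if "i < M" "Z' i" for i
  proof (cases "Z i")
    case False
    then have "\<not> 0 < x i" using eo big[of i] that Z' by (fastforce simp: eps_opt_def)
    then show ?thesis using fx that by (auto simp: feas_def)
  qed (use invar that in \<open>auto simp: invar_def\<close>)
  have descend: "\<exists>x''. feas x'' \<and> (\<forall>i<M. Z' i \<longrightarrow> x'' i = 0) \<and> cost x'' \<le> cost y"
    if "feas y" "\<forall>i<M. Z i \<longrightarrow> y i = 0" "(\<Sum>i\<in>{i. i < M \<and> Z' i}. y i) \<le> real n" for y n
    using that
  proof (induction n arbitrary: y rule: less_induct)
    case (less n y)
    show ?case
    proof (cases "\<forall>i<M. Z' i \<longrightarrow> y i = 0")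
      case True
      with less.prems show ?thesis by blast
    next
      case False
      then obtain i where i: "i < M" "Z' i" "y i \<noteq> 0" by auto
      then have yi: "y i > 0" using less.prems(1) by (fastforce simp: feas_def)
      have nZ: "\<not> Z i" using i less.prems(2) by auto
      then have ri: "r i > real M * e" using Z' i by auto
      let ?v = "\<lambda>k. y k - x k"
      have "?v i > 0" using yi xZ' i by simp
      from conformal[OF feas_diff[OF less.prems(1) fx] i(1) this]
      obtain d where d: "L d" "d i = 1" "\<And>k. k < M \<Longrightarrow> d k \<in> {-1, 0, 1}"
        "\<And>k. k < M \<Longrightarrow> d k \<noteq> 0 \<Longrightarrow> d k * ?v k > 0" by blast
      have dpos: "x k < y k" if "k < M" "d k = 1" for k using d(4)[OF that(1)] that by simp
      have dneg: "y k < x k" if "k < M" "d k = -1" for k using d(4)[OF that(1)] that by simp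
      have dZ: "d k = 0" if "k < M" "Z k" for k
        using d(4)[OF that(1)] less.prems(2) invar that by (auto simp: invar_def)
      have dZ': "0 \<le> d k" if "k < M" "Z' k" for k
        using d(3)[OF that(1)] dneg[OF that(1)] xZ'[OF that] less.prems(1) that by (auto simp: feas_def not_le)
      let ?y = "\<lambda>k. y k - d k"
      have fy: "feas ?y" unfolding feas_def
      proof (intro conjI allI impI)
        fix k assume k: "k < M"
        have int: "y k \<in> \<int>" "0 \<le> y k" "0 \<le> x k" using less.prems(1) fx k by (auto simp: feas_def)
        show "0 \<le> ?y k"
        proof (cases "d k = 1")
          case True
          then have "0 < y k" using dpos[OF k] int by simp
          then have "1 \<le> y k" using int(1) by (auto elim!: Ints_cases)
          with True show ?thesis by simp
        qed (use d(3)[OF k] int in auto)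
        show "?y k \<in> \<int>" using int d(3)[OF k] by (intro Ints_diff) auto
      next
        show "L (\<lambda>k. ?y k - x0 k)"
          using L_diff[of "\<lambda>k. y k - x0 k" d] less.prems(1) d(1) by (simp add: feas_def algebra_simps)
      qed
      have lower: "- e \<le> r k * d k" if "k < M" for k
        using d(3)[OF that] eo dZ[OF that] dneg[OF that] e that less.prems(1)
        by (fastforce simp: eps_opt_def feas_def)
      have "(\<Sum>k<M. r k * d k) = r i + (\<Sum>k\<in>{..<M} - {i}. r k * d k)"
        using i d(2) by (simp add: sum.remove[of _ i])
      moreover have "(\<Sum>k\<in>{..<M} - {i}. - e) \<le> (\<Sum>k\<in>{..<M} - {i}. r k * d k)"
        by (intro sum_mono) (use lower in auto)
      moreover have "(\<Sum>k\<in>{..<M} - {i}. - e) \<ge> - (real M * e)"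
        using e i by (simp add: card_Diff_singleton mult_right_mono)
      ultimately have "(\<Sum>k<M. r k * d k) > 0" using ri by linarith
      moreover have "(\<Sum>k<M. r k * d k) = (\<Sum>k<M. g k * d k)" using invar d(1) dZ by (auto simp: invar_def)
      ultimately have cost: "cost ?y \<le> cost y" by (simp add: cost_def right_diff_distrib sum_subtractf)
      have "1 \<le> (\<Sum>k\<in>{k. k < M \<and> Z' k}. d k)"
        using member_le_sum[of i "{k. k < M \<and> Z' k}" d] i d(2) dZ' by auto
      then have s: "(\<Sum>k\<in>{k. k < M \<and> Z' k}. ?y k) \<le> real n - 1" using less.prems(3) by (simp add: sum_subtractf)
      have "0 \<le> (\<Sum>k\<in>{k. k < M \<and> Z' k}. ?y k)" using fy by (intro sum_nonneg) (auto simp: feas_def)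
      then have "n \<ge> 1" using s by linarith
      then have "(\<Sum>k\<in>{k. k < M \<and> Z' k}. ?y k) \<le> real (n - 1)" "n - 1 < n" using s by (simp_all add: of_nat_diff)
      with less.IH[of "n - 1" ?y] fy less.prems(2) dZ obtain w where
        "feas w" "\<forall>i<M. Z' i \<longrightarrow> w i = 0" "cost w \<le> cost ?y" by auto
      with cost show ?thesis by (meson order_trans)
    qed
  qed
  show ?thesis unfolding invar_def
  proof (intro conjI allI impI)
    show "feas x" by fact
    show "\<And>i. i < M \<Longrightarrow> Z' i \<Longrightarrow> x i = 0" by (rule xZ')
    show "(\<Sum>i<M. r i * h i) = (\<Sum>i<M. g i * h i)" if "L h" "\<forall>i<M. Z' i \<longrightarrow> h i = 0" for h
      using invar that Z' by (auto simp: invar_def)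
    fix x' assume "feas x'"
    then obtain y where y: "feas y" "\<forall>i<M. Z i \<longrightarrow> y i = 0" "cost y \<le> cost x'" using invar by (auto simp: invar_def)
    obtain n where "(\<Sum>i\<in>{i. i < M \<and> Z' i}. y i) \<le> real n" using real_arch_simple by blast
    from descend[OF y(1,2) this] y(3) show "\<exists>x''. feas x'' \<and> (\<forall>i<M. Z' i \<longrightarrow> x'' i = 0) \<and> cost x'' \<le> cost x'"
      by (meson order_trans)
  qed
qed

text \<open>Every nonzero entry of \<open>d\<close> makes the reduced cost along \<open>d\<close>
  smaller, so the cost along \<open>d\<close> is negative. A direction without negative entries has
  nonnegative cost because \<open>g\<close> is nonnegative. Thus some coordinate always stops the
  move.\<close>

lemma L_cost_pos:
  assumes invar: "invar Z x r" and d: "L d" "\<And>k. k < M \<Longrightarrow> d k \<in> {-1, 0, 1}" and k1: "k1 < M" "d k1 \<noteq> 0"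
    and pos: "\<And>k. k < M \<Longrightarrow> d k = 1 \<Longrightarrow> \<not> Z k \<and> r k < 0"
    and neg: "\<And>k. k < M \<Longrightarrow> d k = -1 \<Longrightarrow> \<not> Z k \<and> 0 < r k \<and> 0 < x k"
  shows "\<exists>k<M. d k = -1"
proof (rule ccontr)
  assume no: "\<not> ?thesis"
  have dZ: "\<forall>k<M. Z k \<longrightarrow> d k = 0" using d(2) pos neg by blast
  have "(\<Sum>k<M. r k * d k) \<le> r k1 * d k1 + (\<Sum>k\<in>{..<M} - {k1}. 0)"
    unfolding sum.remove[of "{..<M}" k1, OF finite_lessThan, simplified, OF k1(1)]
    by (intro add_left_mono sum_mono) (use d(2) pos neg in \<open>force simp: mult_le_0_iff\<close>)
  moreover have "r k1 * d k1 < 0" using d(2)[OF k1(1)] k1 pos[OF k1(1)] neg[OF k1(1)] by auto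
  ultimately have "(\<Sum>k<M. r k * d k) < 0" by simp
  moreover have "(\<Sum>k<M. r k * d k) = (\<Sum>k<M. g k * d k)" using invar d(1) dZ by (auto simp: invar_def)
  moreover have "0 \<le> (\<Sum>k<M. g k * d k)"
    using no d(2) g by (intro sum_nonneg mult_nonneg_nonneg) (auto, force)
  ultimately show False by simp
qed

text \<open>The length \<open>x k0\<close>, the least among the falling coordinates, preserves
  nonnegativity and integrality and brings \<open>k0\<close> to 0. Rising coordinates have negative
  reduced cost, so they never enter the counted set of positive entries with positive reduced cost,
  while \<open>k0\<close> leaves it.\<close>

lemma cancel_step:
  assumes invar: "invar Z x r" and eo: "eps_opt Z x r e"
    and d: "L d" "\<And>k. k < M \<Longrightarrow> d k \<in> {-1, 0, 1}"
    and pos: "\<And>k. k < M \<Longrightarrow> d k = 1 \<Longrightarrow> \<not> Z k \<and> r k < 0"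
    and neg: "\<And>k. k < M \<Longrightarrow> d k = -1 \<Longrightarrow> \<not> Z k \<and> 0 < r k \<and> 0 < x k"
    and k0: "k0 < M" "d k0 = -1" "\<And>k. k < M \<Longrightarrow> d k = -1 \<Longrightarrow> x k0 \<le> x k"
    and x': "\<And>k. k < M \<Longrightarrow> x' k = x k + x k0 * d k" and e: "0 \<le> e"
  shows "invar Z x' r" "eps_opt Z x' r e"
    "card {k. k < M \<and> \<not> Z k \<and> 0 < r k \<and> 0 < x' k} < card {k. k < M \<and> \<not> Z k \<and> 0 < r k \<and> 0 < x k}"
proof -
  have fx: "feas x" using invar by (simp add: invar_def)
  have x0: "0 \<le> x k" "x k \<in> \<int>" if "k < M" for k using fx that by (auto simp: feas_def)
  have dZ: "d k = 0" if "k < M" "Z k" for k using d(2) pos neg that by blast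
  have fx': "feas x'" unfolding feas_def
  proof (intro conjI allI impI)
    fix k assume k: "k < M"
    show "0 \<le> x' k" using x'[OF k] d(2)[OF k] k0(3)[OF k] x0[OF k] x0[OF k0(1)] by auto
    show "x' k \<in> \<int>" using x'[OF k] d(2)[OF k] x0[OF k] x0[OF k0(1)] by (auto intro!: Ints_add Ints_diff)
  next
    have "L (\<lambda>k. (x k - x0 k) + x k0 * d k)" using L_add[OF _ L_scale[OF d(1)]] fx by (simp add: feas_def)
    then show "L (\<lambda>k. x' k - x0 k)" by (rule L_cong[rotated]) (simp add: x')
  qed
  show "invar Z x' r" using invar fx' x' dZ by (simp add: invar_def)
  have mono: "x' k \<le> x k" if "k < M" "0 < r k" for k
    using x'[OF that(1)] d(2)[OF that(1)] pos[OF that(1)] x0[OF k0(1)] that by auto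
  show "eps_opt Z x' r e" unfolding eps_opt_def
  proof (intro allI impI conjI)
    fix k assume k: "k < M" "\<not> Z k"
    show "- e \<le> r k" using eo k by (simp add: eps_opt_def)
    assume "0 < x' k"
    show "r k \<le> e"
    proof (cases "0 < r k")
      case True
      then have "0 < x k" using mono[OF k(1)] \<open>0 < x' k\<close> by simp
      then show ?thesis using eo k by (simp add: eps_opt_def)
    qed (use e in simp)
  qed
  have "{k. k < M \<and> \<not> Z k \<and> 0 < r k \<and> 0 < x' k} \<subset> {k. k < M \<and> \<not> Z k \<and> 0 < r k \<and> 0 < x k}"
  proof
    show "{k. k < M \<and> \<not> Z k \<and> 0 < r k \<and> 0 < x' k} \<subseteq> {k. k < M \<and> \<not> Z k \<and> 0 < r k \<and> 0 < x k}"
      using mono by force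
    have "x' k0 = 0" using x'[OF k0(1)] k0(2) by simp
    then have "k0 \<notin> {k. k < M \<and> \<not> Z k \<and> 0 < r k \<and> 0 < x' k}" by simp
    moreover have "k0 \<in> {k. k < M \<and> \<not> Z k \<and> 0 < r k \<and> 0 < x k}" using neg[OF k0(1,2)] k0(1) by simp
    ultimately show "{k. k < M \<and> \<not> Z k \<and> 0 < r k \<and> 0 < x' k} \<noteq> {k. k < M \<and> \<not> Z k \<and> 0 < r k \<and> 0 < x k}"
      by blast
  qed
  then show "card {k. k < M \<and> \<not> Z k \<and> 0 < r k \<and> 0 < x' k} < card {k. k < M \<and> \<not> Z k \<and> 0 < r k \<and> 0 < x k}"
    by (intro psubset_card_mono) auto
qed

text \<open>The step length \<open>e / (K + 1)\<close> balances two dangers. A violating reduced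
  cost moves towards 0 by at least \<open>e / (K + 1)\<close>, from \<open>e\<close> to
  \<open>e * (K / (K + 1))\<close>; one on the harmless side of 0 is moved by at most
  \<open>K\<close> times the step length, to the same bound.\<close>

lemma tighten_step:
  assumes invar: "invar Z x r" and eo: "eps_opt Z x r e" and e: "0 \<le> e" and K: "0 \<le> K"
    and orth: "\<And>h. L h \<Longrightarrow> (\<Sum>i<M. p i * h i) = 0"
    and bd: "\<And>i. i < M \<Longrightarrow> \<bar>p i\<bar> \<le> K"
    and lo: "\<And>i. i < M \<Longrightarrow> \<not> Z i \<Longrightarrow> r i < 0 \<Longrightarrow> 1 \<le> p i"
    and hi: "\<And>i. i < M \<Longrightarrow> \<not> Z i \<Longrightarrow> 0 < r i \<Longrightarrow> 0 < x i \<Longrightarrow> p i \<le> -1"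
    and r': "\<And>i. i < M \<Longrightarrow> r' i = r i + e / (K + 1) * p i"
  shows "invar Z x r'" "eps_opt Z x r' (e * (K / (K + 1)))"
proof -
  let ?c = "e / (K + 1)"
  have c: "0 \<le> ?c" using e K by simp
  have "(\<Sum>i<M. r' i * h i) = (\<Sum>i<M. r i * h i)" if "L h" for h
  proof -
    have "(\<Sum>i<M. r' i * h i) = (\<Sum>i<M. r i * h i + ?c * (p i * h i))"
      by (intro sum.cong) (simp_all add: r' algebra_simps)
    also have "\<dots> = (\<Sum>i<M. r i * h i) + ?c * (\<Sum>i<M. p i * h i)"
      by (simp only: sum.distrib sum_distrib_left)
    finally show ?thesis using orth[OF that] by simp
  qed
  then show "invar Z x r'" using invar by (simp add: invar_def)
  have "e * (K / (K + 1)) + ?c = (e * (K + 1)) / (K + 1)"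
    by (simp add: add_divide_distrib[symmetric] algebra_simps)
  then have split: "e = e * (K / (K + 1)) + ?c" using K by simp
  have cK: "?c * K = e * (K / (K + 1))" by simp
  show "eps_opt Z x r' (e * (K / (K + 1)))" unfolding eps_opt_def
  proof (intro allI impI conjI)
    fix i assume i: "i < M" "\<not> Z i"
    have ri: "- e \<le> r i" "0 < x i \<Longrightarrow> r i \<le> e" using eo i by (auto simp: eps_opt_def)
    have b: "- (e * (K / (K + 1))) \<le> ?c * p i" "?c * p i \<le> e * (K / (K + 1))"
    proof -
      have "\<bar>?c * p i\<bar> \<le> ?c * K"
        using mult_left_mono[OF bd[OF i(1)] c] e K by (simp add: abs_mult)
      then have "\<bar>?c * p i\<bar> \<le> e * (K / (K + 1))" by (simp only: cK)
      then show "- (e * (K / (K + 1))) \<le> ?c * p i" "?c * p i \<le> e * (K / (K + 1))" by (simp_all only: abs_le_iff minus_le_iff)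
    qed
    show "- (e * (K / (K + 1))) \<le> r' i"
    proof (cases "r i < 0")
      case True
      then have "?c * 1 \<le> ?c * p i" using lo[OF i] c by (intro mult_left_mono) auto
      then show ?thesis using r'[OF i(1)] ri split by linarith
    qed (use b r'[OF i(1)] in linarith)
    show "r' i \<le> e * (K / (K + 1))" if x: "0 < x i"
    proof (cases "0 < r i")
      case True
      then have "?c * p i \<le> ?c * (-1)" using hi[OF i _ x] c by (intro mult_left_mono) auto
      then show ?thesis using r'[OF i(1)] ri(2)[OF x] split by linarith
    qed (use b r'[OF i(1)] in linarith)
  qed
qed

end

section \<open>The perceptron\<close>

context unimodular_lp
begin

definition "colprod p j = (\<Sum>i<M. A i j * p i)"

definition "mulA q i = (\<Sum>j<N. A i j * q j)"

definition "box s c p \<longleftrightarrow> (\<forall>i<M. \<bar>p i\<bar> \<le> c * real M \<and> (s i = 1 \<longrightarrow> c \<le> p i) \<and> (s i = -1 \<longrightarrow> p i \<le> - c))"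

text \<open>For signs \<open>s\<close> in -1, 0, 1 this minimizes the pairing with \<open>v\<close>
  over \<open>box s 1\<close>, whose coordinate ranges are \<open>[1, M]\<close>,
  \<open>[-M, -1]\<close> and \<open>[-M, M]\<close>. If the minimum is positive for some
  \<open>v\<close> in \<open>L\<close>, the box contains no vector orthogonal to
  \<open>L\<close>.\<close>

definition "response (s :: nat \<Rightarrow> real) v i =
  (if s i = 1 \<and> 0 < v i then 1 else if s i = -1 \<and> v i < 0 then -1
   else if s i = 1 \<or> v i < 0 \<and> s i \<noteq> -1 then real M else - real M)"

lemma mulA_L: "L (mulA q)"
  unfolding L_def mulA_def by blast

lemma box_response: "box s 1 (response s v)"
  by (auto simp: box_def response_def)

lemma box_add: "box s c p \<Longrightarrow> box s c' p' \<Longrightarrow> box s (c + c') (\<lambda>i. p i + p' i)"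
  unfolding box_def by (force simp: distrib_right intro: order_trans[OF abs_triangle_ineq] add_mono)

lemma colprod_add: "colprod (\<lambda>i. p i + p' i) j = colprod p j + colprod p' j"
  by (simp add: colprod_def distrib_left sum.distrib)

lemma colprod_pairing: "(\<Sum>j<N. q j * colprod p j) = (\<Sum>i<M. p i * mulA q i)"
proof -
  have "(\<Sum>j<N. q j * colprod p j) = (\<Sum>j<N. \<Sum>i<M. p i * (A i j * q j))"
    by (simp add: colprod_def sum_distrib_left mult.left_commute mult.commute)
  also have "\<dots> = (\<Sum>i<M. \<Sum>j<N. p i * (A i j * q j))" by (rule sum.swap)
  finally show ?thesis by (simp add: mulA_def sum_distrib_left)
qed

lemma colprod_bound:
  assumes "box s 1 p" "j < N"
  shows "\<bar>colprod p j\<bar> \<le> real M ^ 2"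
proof -
  have "\<bar>colprod p j\<bar> \<le> (\<Sum>i<M. \<bar>A i j * p i\<bar>)" unfolding colprod_def by (rule sum_abs)
  also have "\<dots> \<le> (\<Sum>i<M. 1 * real M)"
    unfolding abs_mult using assms A_bound by (intro sum_mono mult_mono) (auto simp: box_def)
  finally show ?thesis by (simp add: power2_eq_square)
qed

definition "perceptron_inv s t p \<longleftrightarrow> box s (real t) p \<and> (\<Sum>j<N. colprod p j ^ 2) \<le> real t * real M ^ 5"

lemma perceptron_0: "perceptron_inv s 0 (\<lambda>i. 0)"
  by (simp add: perceptron_inv_def box_def colprod_def)

text \<open>\<open>colprod p\<close> measures how far \<open>p\<close> is from being orthogonal to
  \<open>L\<close>. When its squared norm is expanded, the cross term pairs the response with the
  vector \<open>mulA (colprod p)\<close> of \<open>L\<close> and is not positive. The new square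
  contributes at most \<open>M^4\<close> for each of \<open>N \<le> M\<close> columns. So the
  squared norm grows linearly with the number of steps, as does the margin of \<open>p\<close>: the
  norm falls behind the margin.\<close>

lemma perceptron_step:
  assumes inv: "perceptron_inv s t p"
    and nonpos: "(\<Sum>i<M. response s (mulA (colprod p)) i * mulA (colprod p) i) \<le> 0"
  shows "perceptron_inv s (Suc t) (\<lambda>i. p i + response s (mulA (colprod p)) i)"
proof -
  let ?b = "response s (mulA (colprod p))"
  have "(\<Sum>j<N. colprod (\<lambda>i. p i + ?b i) j ^ 2) =
      (\<Sum>j<N. colprod p j ^ 2) + 2 * (\<Sum>j<N. colprod p j * colprod ?b j) + (\<Sum>j<N. colprod ?b j ^ 2)"
    by (simp add: colprod_add power2_sum sum.distrib sum_distrib_left mult.assoc)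
  also have "(\<Sum>j<N. colprod p j * colprod ?b j) = (\<Sum>i<M. ?b i * mulA (colprod p) i)" by (rule colprod_pairing)
  also have "(\<Sum>j<N. colprod ?b j ^ 2) \<le> (\<Sum>j<N. real M ^ 4)"
  proof (rule sum_mono)
    fix j assume "j \<in> {..<N}"
    then have "\<bar>colprod ?b j\<bar> ^ 2 \<le> (real M ^ 2) ^ 2"
      using colprod_bound[OF box_response, of j s "mulA (colprod p)"] by (intro power_mono) auto
    then show "colprod ?b j ^ 2 \<le> real M ^ 4" by simp
  qed
  also have "(\<Sum>j<N. real M ^ 4) \<le> real M ^ 5"
  proof -
    have "real N * real M ^ 4 \<le> real M * real M ^ 4" using NM by (intro mult_right_mono) auto
    also have "\<dots> = real M ^ Suc 4" by (rule power_Suc[symmetric])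
    finally show ?thesis by simp
  qed
  finally have "(\<Sum>j<N. colprod (\<lambda>i. p i + ?b i) j ^ 2) \<le> real (Suc t) * real M ^ 5"
    using inv nonpos by (simp add: perceptron_inv_def distrib_right)
  moreover have "box s (real (Suc t)) (\<lambda>i. p i + ?b i)"
    using box_add[OF _ box_response, of s "real t" p] inv by (simp add: perceptron_inv_def add.commute)
  ultimately show ?thesis by (simp add: perceptron_inv_def)
qed

text \<open>Since the first \<open>N\<close> rows of \<open>A\<close> are the identity, subtracting \<open>colprod p\<close> there makes \<open>p\<close>
  orthogonal to \<open>L\<close>; after \<open>4 M\<^sup>5\<close> steps this correction is at most half of the margin of \<open>p\<close>.\<close>

lemma perceptron_final:
  assumes inv: "perceptron_inv s (4 * M ^ 5) p" and M: "M > 0"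
    and p': "\<And>i. i < M \<Longrightarrow> p' i = (if i < N then p i - colprod p i else p i) / (2 * real M ^ 5)"
  shows "L h \<Longrightarrow> (\<Sum>i<M. p' i * h i) = 0" "i < M \<Longrightarrow> \<bar>p' i\<bar> \<le> real (2 * M + 1)"
    "i < M \<Longrightarrow> s i = 1 \<Longrightarrow> 1 \<le> p' i" "i < M \<Longrightarrow> s i = -1 \<Longrightarrow> p' i \<le> -1"
proof -
  let ?T = "2 * real M ^ 5"
  have T: "?T > 0" using M by simp
  have q: "\<bar>colprod p j\<bar> \<le> ?T" if "j < N" for j
  proof -
    have "colprod p j ^ 2 \<le> (\<Sum>j<N. colprod p j ^ 2)" using that by (intro member_le_sum) auto
    \<comment> \<open>The number of steps is chosen so that \<open>4 * M^5\<close> times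
      \<open>M^5\<close> is the square of \<open>2 * M^5\<close>. Division by this half margin later
      gives margin 1 and, from entries up to \<open>4 * M^6 + 2 * M^5\<close>, the bound
      \<open>2 * M + 1\<close>.\<close>
    also have "\<dots> \<le> ?T ^ 2" using inv by (simp add: perceptron_inv_def power_mult_distrib mult.assoc flip: power_add power_mult)
    finally show ?thesis using T abs_le_square_iff[of "colprod p j" ?T] by simp
  qed
  have b: "\<bar>p i\<bar> \<le> 2 * ?T * real M" "s i = 1 \<Longrightarrow> 2 * ?T \<le> p i" "s i = -1 \<Longrightarrow> p i \<le> - (2 * ?T)" if "i < M" for i
    using inv that by (auto simp: perceptron_inv_def box_def)
  define d where "d i = (if i < N then colprod p i else 0)" for i
  have d: "\<bar>d i\<bar> \<le> ?T" for i using q T by (simp add: d_def)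
  have p'T: "p' i * ?T = p i - d i" if "i < M" for i
    using p'[OF that] T by (simp add: d_def)
  show "(\<Sum>i<M. p' i * h i) = 0" if Lh: "L h"
  proof -
    obtain z where z: "\<forall>i<M. h i = mulA z i" using Lh by (auto simp: L_def mulA_def)
    let ?p = "\<lambda>i. if i < N then p i - colprod p i else p i"
    have col: "colprod ?p j = 0" if j: "j < N" for j
    proof -
      have "colprod ?p j = (\<Sum>i<M. A i j * p i - (if i < N then A i j * colprod p i else 0))"
        unfolding colprod_def[of ?p] by (intro sum.cong) (auto simp: right_diff_distrib)
      also have "\<dots> = colprod p j - (\<Sum>i<M. if i < N then A i j * colprod p i else 0)"
        by (simp add: sum_subtractf colprod_def)
      also have "(\<Sum>i<M. if i < N then A i j * colprod p i else 0) = (\<Sum>i<M. if i = j then colprod p j else 0)"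
        by (intro sum.cong) (use A_id j NM in \<open>auto\<close>)
      also have "\<dots> = colprod p j" using j NM by simp
      finally show ?thesis by simp
    qed
    have "(\<Sum>i<M. p' i * h i) = (\<Sum>i<M. ?p i * mulA z i) / ?T"
      unfolding sum_divide_distrib by (intro sum.cong) (simp_all add: p' z)
    also have "\<dots> = 0" by (simp add: colprod_pairing[symmetric] col)
    finally show ?thesis .
  qed
  show "\<bar>p' i\<bar> \<le> real (2 * M + 1)" if i: "i < M"
  proof -
    have "\<bar>p' i\<bar> * ?T = \<bar>p' i * ?T\<bar>" using T by (simp add: abs_mult)
    also have "\<dots> \<le> \<bar>p i\<bar> + ?T" unfolding p'T[OF i] using d[of i] by linarith
    also have "\<dots> \<le> real (2 * M + 1) * ?T" using b(1)[OF i] by (simp add: algebra_simps)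
    finally show ?thesis using T by simp
  qed
  show "1 \<le> p' i" if i: "i < M" "s i = 1"
  proof -
    have "1 * ?T \<le> p' i * ?T" unfolding p'T[OF i(1)] using d[of i] b(2)[OF i] by linarith
    then show ?thesis using T by (simp only: mult_le_cancel_right_pos)
  qed
  show "p' i \<le> -1" if i: "i < M" "s i = -1"
  proof -
    have "p' i * ?T \<le> (-1) * ?T" unfolding p'T[OF i(1)] using d[of i] b(3)[OF i] by linarith
    then show ?thesis using T by (simp only: mult_le_cancel_right_pos)
  qed
qed

section \<open>Rounding to entries -1, 0 and 1\<close>

definition "integral_at v i \<longleftrightarrow> v i \<in> {-1, 0, 1 :: real}"

text \<open>\<open>b\<close> is to be the response to the initial vector \<open>v0\<close>. It stays
  fixed, so the pairing is linear in \<open>v\<close>; it also remains a minimizer over the box,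
  because \<open>v\<close> has the signs of \<open>v0\<close> wherever it is not 0.\<close>

definition "rounding_inv b v0 v \<longleftrightarrow> L v \<and> (\<forall>i<M. \<bar>v i\<bar> \<le> 1 \<and> (v i \<noteq> 0 \<longrightarrow> 0 < v i * v0 i)) \<and> 0 < (\<Sum>i<M. b i * v i)"

text \<open>The time at which coordinate \<open>i\<close>, moving from \<open>v\<close> in direction
  \<open>h\<close>, hits -1, 0 or 1: outward motion ends at absolute value 1, inward motion at
  0.\<close>

definition "reach h v i = (if 0 < h i * v i then (1 - \<bar>v i\<bar>) / \<bar>h i\<bar> else \<bar>v i\<bar> / \<bar>h i\<bar>)" for h v :: "nat \<Rightarrow> real"

lemma conformal_move:
  fixes v w c :: real
  assumes "0 < v * c" "\<bar>v\<bar> \<le> 1" "0 \<le> w * v \<and> \<bar>w\<bar> \<le> 1 - \<bar>v\<bar> \<or> w * v \<le> 0 \<and> \<bar>w\<bar> \<le> \<bar>v\<bar>"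
  shows "\<bar>v + w\<bar> \<le> 1 \<and> (v + w \<noteq> 0 \<longrightarrow> 0 < (v + w) * c)"
proof (cases "0 < v")
  case True
  then have "0 < c" using assms(1) by (simp add: zero_less_mult_iff)
  moreover have "0 \<le> w \<and> \<bar>w\<bar> \<le> 1 - \<bar>v\<bar> \<or> w \<le> 0 \<and> \<bar>w\<bar> \<le> \<bar>v\<bar>"
    using assms(3) True by (auto simp: zero_le_mult_iff mult_le_0_iff)
  ultimately show ?thesis using True assms(2) by (auto simp: zero_less_mult_iff)
next
  case False
  then have v: "v < 0" using assms(1) by (cases "v = 0") auto
  then have "c < 0" using assms(1) by (simp add: zero_less_mult_iff)
  moreover have "w \<le> 0 \<and> \<bar>w\<bar> \<le> 1 - \<bar>v\<bar> \<or> 0 \<le> w \<and> \<bar>w\<bar> \<le> \<bar>v\<bar>"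
    using assms(3) v by (auto simp: zero_le_mult_iff mult_le_0_iff)
  ultimately show ?thesis using v assms(2) by (auto simp: zero_less_mult_iff)
qed

text \<open>Integral coordinates stay put because \<open>h\<close> vanishes there. With the least
  reach no coordinate leaves the interval between 0 and the unit of its sign, and the minimizing
  coordinate \<open>k0\<close> becomes integral.\<close>

lemma rounding_step:
  assumes inv: "rounding_inv b v0 v" and h: "L h" and hint: "\<And>i. i < M \<Longrightarrow> integral_at v i \<Longrightarrow> h i = 0"
    and up: "0 \<le> (\<Sum>i<M. b i * h i)" and k0: "k0 < M" "h k0 \<noteq> 0"
    and mn: "\<And>k. k < M \<Longrightarrow> h k \<noteq> 0 \<Longrightarrow> reach h v k0 \<le> reach h v k"
    and v': "\<And>i. i < M \<Longrightarrow> v' i = v i + reach h v k0 * h i"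
  shows "rounding_inv b v0 v'" "card {i. i < M \<and> integral_at v i} < card {i. i < M \<and> integral_at v' i}"
proof -
  let ?t = "reach h v k0"
  have bd: "\<bar>v i\<bar> \<le> 1" if "i < M" for i using inv that by (simp add: rounding_inv_def)
  have t0: "0 \<le> ?t" using bd[OF k0(1)] by (simp add: reach_def)
  have step: "\<bar>v' i\<bar> \<le> 1 \<and> (v' i \<noteq> 0 \<longrightarrow> 0 < v' i * v0 i)" if i: "i < M" for i
  proof (cases "h i = 0")
    case True
    then show ?thesis using inv i v' by (simp add: rounding_inv_def)
  next
    case False
    then have vi: "v i \<noteq> 0" using hint[OF i] by (auto simp: integral_at_def)
    then have c: "0 < v i * v0 i" using inv i by (simp add: rounding_inv_def)
    have th: "\<bar>?t * h i\<bar> \<le> reach h v i * \<bar>h i\<bar>"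
      using mn[OF i False] t0 by (simp add: abs_mult mult_right_mono)
    show ?thesis
    proof (cases "0 < h i * v i")
      case True
      then have a: "\<bar>?t * h i\<bar> \<le> 1 - \<bar>v i\<bar>" using th False by (simp add: reach_def)
      have "0 \<le> ?t * h i * v i" using True t0 by (simp add: mult.assoc)
      then show ?thesis unfolding v'[OF i] using a c bd[OF i] by (intro conformal_move) auto
    next
      case F: False
      then have a: "\<bar>?t * h i\<bar> \<le> \<bar>v i\<bar>" using th False by (simp add: reach_def)
      have "?t * (h i * v i) \<le> 0" using F t0 by (simp add: mult_le_0_iff not_less)
      then have "?t * h i * v i \<le> 0" by (simp add: mult.assoc)
      then show ?thesis unfolding v'[OF i] using a c bd[OF i] by (intro conformal_move) auto
    qed
  qed
  have "L v'" by (rule L_cong[OF _ L_add[OF _ L_scale[OF h, of ?t], of v]]) (use inv v' in \<open>auto simp: rounding_inv_def\<close>)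
  moreover have "(\<Sum>i<M. b i * v' i) = (\<Sum>i<M. b i * v i) + ?t * (\<Sum>i<M. b i * h i)"
    unfolding sum_distrib_left sum.distrib[symmetric] by (intro sum.cong) (simp_all add: v' algebra_simps)
  ultimately show "rounding_inv b v0 v'" using step inv up t0
    by (simp add: rounding_inv_def add_pos_nonneg)
  have k0v: "\<not> integral_at v k0" using hint k0 by blast
  have "integral_at v' k0"
  proof (cases "0 < h k0 * v k0")
    case True
    then consider "0 < h k0" "0 < v k0" | "h k0 < 0" "v k0 < 0" by (auto simp: zero_less_mult_iff)
    then show ?thesis
    proof cases
      case 1
      then have "reach h v k0 * h k0 = 1 - v k0" using True by (simp add: reach_def)
      then show ?thesis using v'[OF k0(1)] by (simp add: integral_at_def)
    next
      case 2
      then have "reach h v k0 * h k0 = - 1 - v k0" using True by (simp add: reach_def)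
      then show ?thesis using v'[OF k0(1)] by (simp add: integral_at_def)
    qed
  next
    case False
    moreover have "h k0 * v k0 \<noteq> 0" using k0(2) k0v by (simp add: integral_at_def)
    ultimately have "h k0 * v k0 < 0" by linarith
    then consider "0 < h k0" "v k0 < 0" | "h k0 < 0" "0 < v k0" by (auto simp: mult_less_0_iff)
    then have "reach h v k0 * h k0 = - v k0" using False by cases (simp_all add: reach_def)
    then show ?thesis using v'[OF k0(1)] by (simp add: integral_at_def)
  qed
  moreover have "integral_at v' i" if "i < M" "integral_at v i" for i
    using that v'[OF that(1)] hint[OF that] by (simp add: integral_at_def)
  ultimately have "{i. i < M \<and> integral_at v i} \<subset> {i. i < M \<and> integral_at v' i}" using k0(1) k0v by blast
  then show "card {i. i < M \<and> integral_at v i} < card {i. i < M \<and> integral_at v' i}" by (intro psubset_card_mono) auto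
qed

lemma rounding_stop:
  assumes inv: "rounding_inv b v0 v" and det: "determined {i. i < M \<and> integral_at v i}" and i: "i < M"
  shows "integral_at v i"
proof -
  have "v i \<in> \<int>"
    by (rule determined_integral[OF det]) (use inv i in \<open>auto simp: rounding_inv_def integral_at_def\<close>)
  then obtain k where k: "v i = of_int k" by (auto elim: Ints_cases)
  moreover have "\<bar>v i\<bar> \<le> 1" using inv i by (simp add: rounding_inv_def)
  ultimately have "\<bar>k\<bar> \<le> 1" by (simp flip: of_int_abs)
  then have "k = -1 \<or> k = 0 \<or> k = 1" by arith
  with k show ?thesis by (auto simp: integral_at_def)
qed

text \<open>A single violated entry costs \<open>M\<close>, more than all other entries of a vector over \<open>{-1, 0, 1}\<close> can gain.\<close>

lemma rounding_final:
  assumes inv: "rounding_inv (response s v0) v0 d" and int: "\<And>i. i < M \<Longrightarrow> integral_at d i"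
    and s: "\<And>i. i < M \<Longrightarrow> s i \<in> {-1, 0, 1}"
  shows "i < M \<Longrightarrow> d i \<noteq> 0 \<Longrightarrow> s i = d i" "\<exists>i<M. d i \<noteq> 0"
proof -
  let ?b = "response s v0"
  have pos: "0 < (\<Sum>i<M. ?b i * d i)" using inv by (simp add: rounding_inv_def)
  then show "\<exists>i<M. d i \<noteq> 0" using sum.neutral[of "{..<M}" "\<lambda>i. ?b i * d i"] by fastforce
  have le1: "?b i * d i \<le> 1" if "i < M" for i
    using int[OF that] inv that
    by (auto simp: integral_at_def rounding_inv_def response_def zero_less_mult_iff)
  show "s i = d i" if i: "i < M" "d i \<noteq> 0"
  proof (rule ccontr)
    assume ne: "s i \<noteq> d i"
    have c: "0 < d i * v0 i" using inv i by (simp add: rounding_inv_def)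
    have "?b i * d i = - real M"
      using ne int[OF i(1)] i(2) c s[OF i(1)] by (auto simp: integral_at_def response_def zero_less_mult_iff)
    moreover have "(\<Sum>k\<in>{..<M} - {i}. ?b k * d k) \<le> (\<Sum>k\<in>{..<M} - {i}. 1)" by (intro sum_mono) (use le1 in auto)
    moreover have "(\<Sum>k<M. ?b k * d k) = ?b i * d i + (\<Sum>k\<in>{..<M} - {i}. ?b k * d k)"
      using i by (simp add: sum.remove[of _ i])
    ultimately show False using pos i by (simp add: card_Diff_singleton of_nat_diff)
  qed
qed

end

section \<open>Echelon bases of coordinate sections of L\<close>

context unimodular_lp
begin

text \<open>The rows \<open>F\<close> are the ones required to vanish, and the rows \<open>R\<close> have been processed. A used column has
  become \<open>0\<close> altogether or is the unit vector of a pivot row; \<open>pc\<close> maps pivot rows to their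
  columns and all other rows to \<open>N\<close>.\<close>

definition "ech_inv F R C used pc \<longleftrightarrow>
  (\<forall>j<N. L (\<lambda>k. C k j)) \<and>
  (\<forall>h. L h \<longrightarrow> (\<forall>k<M. F k \<and> R k \<longrightarrow> h k = 0) \<longrightarrow> (\<exists>z. \<forall>k<M. h k = (\<Sum>j<N. C k j * z j))) \<and>
  (\<forall>k<M. R k \<longrightarrow> (\<forall>j<N. used j = (0::real) \<or> F k \<longrightarrow> C k j = 0)) \<and>
  (\<forall>i<M. pc i < N \<longrightarrow> R i \<and> \<not> F i \<and> used (pc i) \<noteq> 0 \<and> C i (pc i) = 1 \<and>
     (\<forall>j<N. j \<noteq> pc i \<longrightarrow> C i j = 0) \<and> (\<forall>k<M. pc k = pc i \<longrightarrow> k = i)) \<and>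
  (\<forall>j<N. used j \<noteq> 0 \<longrightarrow> (\<exists>i<M. pc i = j) \<or> (\<forall>k<M. C k j = 0))"

lemma ech_invD:
  assumes "ech_inv F R C used pc"
  shows "j < N \<Longrightarrow> L (\<lambda>k. C k j)"
    "L h \<Longrightarrow> \<forall>k<M. F k \<and> R k \<longrightarrow> h k = 0 \<Longrightarrow> \<exists>z. \<forall>k<M. h k = (\<Sum>j<N. C k j * z j)"
    "k < M \<Longrightarrow> R k \<Longrightarrow> j < N \<Longrightarrow> used j = 0 \<or> F k \<Longrightarrow> C k j = 0"
    "i < M \<Longrightarrow> pc i < N \<Longrightarrow> R i \<and> \<not> F i \<and> used (pc i) \<noteq> 0 \<and> C i (pc i) = 1 \<and>
       (\<forall>j<N. j \<noteq> pc i \<longrightarrow> C i j = 0) \<and> (\<forall>k<M. pc k = pc i \<longrightarrow> k = i)"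
    "j < N \<Longrightarrow> used j \<noteq> 0 \<Longrightarrow> (\<exists>i<M. pc i = j) \<or> (\<forall>k<M. C k j = 0)"
  using assms unfolding ech_inv_def by blast+

lemma ech_basic:
  assumes "ech_inv F R C used pc" "i < M" "pc i < N"
  shows "R i" "\<not> F i" "used (pc i) \<noteq> 0" "C i (pc i) = 1" "j < N \<Longrightarrow> j \<noteq> pc i \<Longrightarrow> C i j = 0"
    "k < M \<Longrightarrow> pc k = pc i \<Longrightarrow> k = i"
  using ech_invD(4)[OF assms] by blast+

lemma ech_inv_cong:
  assumes "ech_inv F R C used pc" "\<And>k. k < M \<Longrightarrow> R' k = R k"
    "\<And>k j. k < M \<Longrightarrow> j < N \<Longrightarrow> C' k j = C k j"
  shows "ech_inv F R' C' used pc"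
proof -
  have "L (\<lambda>k. C' k j)" if "j < N" for j
    by (rule L_cong[of "\<lambda>k. C k j"]) (use assms that in \<open>auto simp: ech_inv_def\<close>)
  moreover have "(\<Sum>j<N. C' k j * z j) = (\<Sum>j<N. C k j * z j)" if "k < M" for k z
    by (intro sum.cong) (use assms(3) that in auto)
  moreover have "\<exists>z. \<forall>k<M. h k = (\<Sum>j<N. C k j * z j)"
    if "L h" "\<forall>k<M. F k \<and> R' k \<longrightarrow> h k = 0" for h
    using assms(1,2) that unfolding ech_inv_def by blast
  moreover have "\<forall>k<M. R' k \<longrightarrow> (\<forall>j<N. used j = 0 \<or> F k \<longrightarrow> C' k j = 0)"
    using assms(1) unfolding ech_inv_def by (simp add: assms(2,3))
  moreover have "\<forall>i<M. pc i < N \<longrightarrow> R' i \<and> \<not> F i \<and> used (pc i) \<noteq> 0 \<and> C' i (pc i) = 1 \<and>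
     (\<forall>j<N. j \<noteq> pc i \<longrightarrow> C' i j = 0) \<and> (\<forall>k<M. pc k = pc i \<longrightarrow> k = i)"
    using assms(1) unfolding ech_inv_def by (simp add: assms(2,3))
  moreover have "\<forall>j<N. used j \<noteq> 0 \<longrightarrow> (\<exists>i<M. pc i = j) \<or> (\<forall>k<M. C' k j = 0)"
    using assms(1) unfolding ech_inv_def by (simp add: assms(2,3))
  ultimately show ?thesis unfolding ech_inv_def by simp
qed

lemma ech_start:
  assumes "\<And>i. i < M \<Longrightarrow> pc i = N" "\<And>j. j < N \<Longrightarrow> used j = 0"
  shows "ech_inv F (\<lambda>_. False) A used pc"
  using assms L_column by (auto simp: ech_inv_def L_def)

lemma ech_skip:
  assumes inv: "ech_inv F R C used pc" and i: "i < M" and none: "\<And>j. j < N \<Longrightarrow> used j = 0 \<Longrightarrow> C i j = 0"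
    and ph: "F i \<Longrightarrow> \<forall>k<M. \<not> pc k < N"
  shows "ech_inv F (\<lambda>k. R k \<or> k = i) C used pc"
proof -
  have "C i j = 0" if "j < N" "F i" for j
    using none[OF that(1)] ech_invD(5)[OF inv that(1)] ph[OF that(2)] that(1) i by (cases "used j = 0") auto
  then have rows: "\<forall>k<M. R k \<or> k = i \<longrightarrow> (\<forall>j<N. used j = 0 \<or> F k \<longrightarrow> C k j = 0)"
    using none ech_invD(3)[OF inv] by blast
  have span: "\<forall>h. L h \<longrightarrow> (\<forall>k<M. F k \<and> (R k \<or> k = i) \<longrightarrow> h k = 0) \<longrightarrow> (\<exists>z. \<forall>k<M. h k = (\<Sum>j<N. C k j * z j))"
    using ech_invD(2)[OF inv] by blast
  show ?thesis unfolding ech_inv_def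
    by (intro conjI rows span) (use ech_invD(1,4,5)[OF inv] in blast)+
qed

lemma ech_pivot:
  assumes inv: "ech_inv F R C used pc" and i: "i < M" "\<not> R i" and ph: "F i \<Longrightarrow> \<forall>k<M. \<not> pc k < N"
    and ph1: "\<not> F i \<Longrightarrow> \<forall>k<M. F k \<longrightarrow> R k"
    and jj: "jj < N" "used jj = 0" "C i jj \<noteq> 0"
    and C': "\<And>k j. k < M \<Longrightarrow> j < N \<Longrightarrow> C' k j =
      (if j = jj then if F i then 0 else C k jj / C i jj else C k j - C i j * (C k jj / C i jj))"
    and used': "used' = used(jj := 1)" and pc': "pc' = (if F i then pc else pc(i := jj))"
  shows "ech_inv F (\<lambda>k. R k \<or> k = i) C' used' pc'"
proof -
  let ?w = "\<lambda>k. C k jj / C i jj"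
  have col: "\<And>j. j < N \<Longrightarrow> L (\<lambda>k. C k j)" by (rule ech_invD(1)[OF inv])
  have wR: "C k jj = 0" if "k < M" "R k" for k using ech_invD(3)[OF inv that jj(1)] jj(2) by simp
  have L': "L (\<lambda>k. C' k j)" if j: "j < N" for j
  proof (cases "j = jj")
    case True
    have "L (\<lambda>k. (if F i then 0 else 1 / C i jj) * C k jj)" by (rule L_scale[OF col[OF jj(1)]])
    then show ?thesis by (rule L_cong[rotated]) (use C' True j in auto)
  next
    case False
    have "L (\<lambda>k. C k j - C i j / C i jj * C k jj)" by (rule L_diff[OF col[OF j] L_scale[OF col[OF jj(1)]]])
    then show ?thesis by (rule L_cong[rotated]) (use C' False j in auto)
  qed
  have span: "\<exists>z. \<forall>k<M. h k = (\<Sum>j<N. C' k j * z j)"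
    if h: "L h" "\<forall>k<M. F k \<and> (R k \<or> k = i) \<longrightarrow> h k = 0" for h
  proof -
    have "\<exists>z. \<forall>k<M. h k = (\<Sum>j<N. C k j * z j)" by (rule ech_invD(2)[OF inv h(1)]) (use h(2) in blast)
    then obtain z where z: "\<forall>k<M. h k = (\<Sum>j<N. C k j * z j)" ..
    have split: "(\<Sum>j<N. f j) = f jj + (\<Sum>j\<in>{..<N} - {jj}. f j)" for f :: "nat \<Rightarrow> real"
      using jj(1) by (simp add: sum.remove)
    show ?thesis
    \<comment> \<open>Once row \<open>i\<close> is a unit vector, the coefficient of its column is
      the entry of \<open>h\<close> in this row.\<close>
    proof (intro exI[of _ "z(jj := h i)"] allI impI)
      fix k assume k: "k < M"
      have "(\<Sum>j<N. C' k j * (z(jj := h i)) j) = C' k jj * h i + (\<Sum>j\<in>{..<N} - {jj}. (C k j - C i j * ?w k) * z j)"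
        unfolding split using C'[OF k] by (intro arg_cong2[where f="(+)"] sum.cong) auto
      also have "(\<Sum>j\<in>{..<N} - {jj}. (C k j - C i j * ?w k) * z j) =
          (\<Sum>j\<in>{..<N} - {jj}. C k j * z j) - ?w k * (\<Sum>j\<in>{..<N} - {jj}. C i j * z j)"
        by (simp add: sum_subtractf sum_distrib_left algebra_simps)
      also have "\<dots> = (h k - C k jj * z jj) - ?w k * (h i - C i jj * z jj)"
        using z k i(1) split[of "\<lambda>j. C k j * z j"] split[of "\<lambda>j. C i j * z j"] by simp
      also have "\<dots> = h k - ?w k * h i" using jj(3) by (simp add: algebra_simps)
      also have "C' k jj * h i + (h k - ?w k * h i) = h k"
        using C'[OF k jj(1)] h(2) i(1) by auto
      finally show "h k = (\<Sum>j<N. C' k j * (z(jj := h i)) j)" by simp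
    qed
  qed
  have rows: "C' k j = 0" if k: "k < M" "R k \<or> k = i" and j: "j < N" "used' j = 0 \<or> F k" for k j
  proof (cases "k = i")
    case True
    have "F i" if "j = jj" using j(2) True that by (auto simp: used')
    then show ?thesis using C'[OF k(1) j(1)] jj(3) True by auto
  next
    case False
    then have R: "R k" using k by simp
    have "C k j = 0 \<or> j = jj" using ech_invD(3)[OF inv k(1) R j(1)] j(2) by (cases "j = jj") (simp_all add: used')
    then show ?thesis using C'[OF k(1) j(1)] wR[OF k(1) R] by auto
  qed
  have piv: "(R a \<or> a = i) \<and> \<not> F a \<and> used' (pc' a) \<noteq> 0 \<and> C' a (pc' a) = 1 \<and>
     (\<forall>j<N. j \<noteq> pc' a \<longrightarrow> C' a j = 0) \<and> (\<forall>k<M. pc' k = pc' a \<longrightarrow> k = a)" if a: "a < M" "pc' a < N" for a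
  proof (cases "F i")
    case True
    then show ?thesis using ph a pc' by auto
  next
    case nF: False
    have old: "R b \<and> \<not> F b \<and> used (pc b) \<noteq> 0 \<and> C b (pc b) = 1 \<and>
     (\<forall>j<N. j \<noteq> pc b \<longrightarrow> C b j = 0) \<and> (\<forall>k<M. pc k = pc b \<longrightarrow> k = b)" if "b < M" "pc b < N" for b
      by (rule ech_invD(4)[OF inv that])
    have fresh: "pc b \<noteq> jj" if "b < M" for b using old[OF that] jj(1,2) by metis
    show ?thesis
    proof (cases "a = i")
      case True
      then show ?thesis using nF C'[OF i(1)] jj fresh by (auto simp: pc' used')
    next
      case False
      then have pa: "pc' a = pc a" "pc a < N" using a(2) nF by (auto simp: pc')
      have ne: "pc a \<noteq> jj" by (rule fresh[OF a(1)])
      have w0: "C a jj = 0" by (rule wR[OF a(1)]) (use old[OF a(1) pa(2)] in blast)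
      have row: "C' a j = C a j" if "j < N" for j using C'[OF a(1) that] w0 nF by auto
      have "k = a" if "k < M" "pc' k = pc a" for k
        using that old[OF a(1) pa(2)] ne nF by (auto simp: pc' split: if_splits)
      then show ?thesis using old[OF a(1) pa(2)] pa row ne by (simp add: used')
    qed
  qed
  have cols: "(\<exists>a<M. pc' a = j) \<or> (\<forall>k<M. C' k j = 0)" if j: "j < N" "used' j \<noteq> 0" for j
  proof (cases "j = jj")
    case True
    then show ?thesis using C'[OF _ j(1)] i(1) by (auto simp: pc')
  next
    case False
    then have "(\<exists>a<M. pc a = j) \<or> (\<forall>k<M. C k j = 0)" using j by (intro ech_invD(5)[OF inv]) (simp_all add: used')
    then show ?thesis
    proof
      assume "\<exists>a<M. pc a = j"
      then obtain a where a: "a < M" "pc a = j" by blast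
      have pa: "pc a < N" using a j(1) by simp
      have "R a" by (rule ech_basic(1)[OF inv a(1) pa])
      moreover have "\<not> F i" using ph a(1) pa by blast
      ultimately have "pc' a = j" using a i(2) by (cases "a = i") (simp_all add: pc')
      with a show ?thesis by blast
    next
      assume "\<forall>k<M. C k j = 0"
      then show ?thesis using C'[OF _ j(1)] False i(1) by auto
    qed
  qed
  have "\<forall>j<N. L (\<lambda>k. C' k j)" using L' by blast
  moreover have "\<forall>h. L h \<longrightarrow> (\<forall>k<M. F k \<and> (R k \<or> k = i) \<longrightarrow> h k = 0) \<longrightarrow> (\<exists>z. \<forall>k<M. h k = (\<Sum>j<N. C' k j * z j))"
    using span by blast
  moreover have "\<forall>k<M. R k \<or> k = i \<longrightarrow> (\<forall>j<N. used' j = 0 \<or> F k \<longrightarrow> C' k j = 0)"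
    using rows by blast
  moreover have "\<forall>a<M. pc' a < N \<longrightarrow> (R a \<or> a = i) \<and> \<not> F a \<and> used' (pc' a) \<noteq> 0 \<and> C' a (pc' a) = 1 \<and>
     (\<forall>j<N. j \<noteq> pc' a \<longrightarrow> C' a j = 0) \<and> (\<forall>k<M. pc' k = pc' a \<longrightarrow> k = a)"
    by (intro allI impI) (rule piv)
  moreover have "\<forall>j<N. used' j \<noteq> 0 \<longrightarrow> (\<exists>a<M. pc' a = j) \<or> (\<forall>k<M. C' k j = 0)"
    by (intro allI impI) (rule cols)
  ultimately show ?thesis unfolding ech_inv_def by (intro conjI)
qed

text \<open>Pivot rows are unit vectors, so the coefficient of a pivot column is the entry of
  \<open>h\<close> in the pivot row. Columns without a pivot row are 0.\<close>

lemma ech_end: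
  assumes inv: "ech_inv F (\<lambda>_. True) C used pc" and h: "L h" "\<forall>k<M. F k \<longrightarrow> h k = 0" and k: "k < M"
  shows "h k = (\<Sum>i | i < M \<and> pc i < N. h i * C k (pc i))"
proof -
  have "\<exists>z. \<forall>k<M. h k = (\<Sum>j<N. C k j * z j)" using inv h unfolding ech_inv_def by blast
  then obtain z where z: "\<forall>k<M. h k = (\<Sum>j<N. C k j * z j)" ..
  let ?B = "{i. i < M \<and> pc i < N}"
  have inj: "inj_on pc ?B" unfolding inj_on_def using ech_basic(6)[OF inv] by auto
  have basic: "h i = z (pc i)" if "i \<in> ?B" for i
  proof -
    have "h i = (\<Sum>j<N. C i j * z j)" using z that by simp
    also have "\<dots> = (\<Sum>j<N. if j = pc i then z j else 0)"
      using ech_basic(4,5)[OF inv, of i] that by (intro sum.cong) simp_all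
    finally show ?thesis using that by simp
  qed
  have "h k = (\<Sum>j<N. C k j * z j)" using z k by simp
  also have "\<dots> = (\<Sum>j\<in>pc ` ?B. C k j * z j)"
  proof (rule sum.mono_neutral_right)
    show "\<forall>j\<in>{..<N} - pc ` ?B. C k j * z j = 0"
    proof
      fix j assume j: "j \<in> {..<N} - pc ` ?B"
      then have "\<not> (\<exists>i<M. pc i = j)" by auto
      then have "C k j = 0" using ech_invD(3)[OF inv k, of j] ech_invD(5)[OF inv, of j] k j by (cases "used j = 0") auto
      then show "C k j * z j = 0" by simp
    qed
  qed auto
  also have "\<dots> = (\<Sum>i\<in>?B. C k (pc i) * z (pc i))" by (rule sum.reindex[OF inj, simplified])
  also have "\<dots> = (\<Sum>i\<in>?B. h i * C k (pc i))" by (intro sum.cong) (auto simp: basic)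
  finally show ?thesis .
qed

text \<open>By \<open>ech_end\<close>, the rows \<open>F\<close> together with all pivot rows
  determine a vector of \<open>L\<close>. The column of \<open>i\<close> is 0 on all of these rows
  except \<open>i\<close>, where it is 1, so \<open>unit_entries\<close> applies.\<close>

lemma ech_entries:
  assumes inv: "ech_inv F (\<lambda>_. True) C used pc" and i: "i < M" "pc i < N" and k: "k < M"
  shows "\<bar>C k (pc i)\<bar> \<le> 1"
proof -
  let ?F = "{k. k < M \<and> (F k \<or> pc k < N \<and> k \<noteq> i)}"
  have p: "L (\<lambda>k. C k (pc i))" "C i (pc i) = 1" "\<not> F i" using ech_invD(1)[OF inv i(2)] ech_basic[OF inv i] by auto
  have zero: "\<forall>k\<in>?F. C k (pc i) = 0"
  proof
    fix b assume b: "b \<in> ?F"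
    show "C b (pc i) = 0"
    proof (cases "F b")
      case True then show ?thesis using ech_invD(3)[OF inv _ _ i(2), of b] b by simp
    next
      case False
      then have "pc b < N" "b \<noteq> i" "b < M" using b by blast+
      then have "pc i \<noteq> pc b" using ech_basic(6)[OF inv \<open>b < M\<close> _ i(1)] by metis
      then show ?thesis by (rule ech_basic(5)[OF inv \<open>b < M\<close> \<open>pc b < N\<close> i(2)])
    qed
  qed
  have "determined (insert i ?F)" unfolding determined_def
  proof (intro allI impI)
    fix h b assume h: "L h" "\<forall>k\<in>insert i ?F. h k = 0" and b: "b < M"
    have "h b = (\<Sum>i | i < M \<and> pc i < N. h i * C b (pc i))"
      by (rule ech_end[OF inv h(1) _ b]) (use h(2) in auto)
    also have "\<dots> = 0" using h(2) by (intro sum.neutral) auto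
    finally show "h b = 0" .
  qed
  then have "C k (pc i) \<in> {-1, 0, 1}" by (intro unit_entries[OF p(1) i(1) p(2) _ zero _ k]) auto
  then show ?thesis by auto
qed

lemma ech_determined:
  assumes inv: "ech_inv F (\<lambda>_. True) C used pc" and none: "\<And>i. i < M \<Longrightarrow> \<not> pc i < N"
  shows "determined {i. i < M \<and> F i}"
  unfolding determined_def
proof (intro allI impI)
  fix h b assume h: "L h" "\<forall>k\<in>{i. i < M \<and> F i}. h k = 0" and b: "b < M"
  have "h b = (\<Sum>i | i < M \<and> pc i < N. h i * C b (pc i))"
    by (rule ech_end[OF inv h(1) _ b]) (use h(2) in auto)
  also have "{i. i < M \<and> pc i < N} = {}" using none by auto
  finally show "h b = 0" by simp
qed

lemma ech_column:
  assumes inv: "ech_inv F (\<lambda>_. True) C used pc" and i: "i < M" "pc i < N"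
  shows "L (\<lambda>k. C k (pc i))" "C i (pc i) = 1" "\<And>k. k < M \<Longrightarrow> F k \<Longrightarrow> C k (pc i) = 0"
  using ech_invD(1)[OF inv i(2)] ech_basic(4)[OF inv i] ech_invD(3)[OF inv _ _ i(2)] by auto

end

text \<open>Memory layout, besides the input and output arrays.

  Natural numbers: array 3 holds the constants \<open>1, M, N, m, n, p + 1, p + 2, 4 M\<^sup>5\<close>, the number of rounds per epoch,
  \<open>M + 1\<close> and \<open>2\<close> in this order; array 5 the pivot columns; arrays 10, 11, 12 results of searches; arrays 20, 21
  the list being sorted when an orientation sign is computed.

  Real numbers: arrays 4 to 9 hold \<open>A\<close>, the echelon form, \<open>x\<close>, \<open>r\<close>, \<open>\<epsilon>\<close> and the flags of the fixed coordinates.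
  For the perceptron, 11 to 16 hold the signs, \<open>p\<close>, its column products, the vector \<open>v\<close> of \<open>L\<close>, the response
  and the flag of success; for rounding and echelon forms, 18 and 19 flag the rows to be zero and the used columns, and 21 and 22
  hold step lengths and the direction. Array 23 is the boundary matrix.\<close>

abbreviation "cM \<equiv> NG 3 (NC 1)"
abbreviation "cN \<equiv> NG 3 (NC 2)"
text \<open>Array 100 is protected, hence this assignment has no effect.\<close>

abbreviation nop :: stmt where "nop \<equiv> RSet 100 (NC 0) (RC 0)"
text \<open>A vector is a matrix with a single row: of the two levels bound here, the first is always \<open>0\<close>.\<close>

abbreviation "Vec a n x \<equiv> Map2 a 0 n x"
abbreviation "IfEq i j x y \<equiv> IfN i j y (IfN j i y x)"
abbreviation "at2 i j \<equiv> NAdd (NMul i cN) j"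

text \<open>\<open>Find\<close> looks for a positive value, and the square is positive exactly when
  the entry is not 0. Used columns yield 0.\<close>

definition ech_find :: "nat \<Rightarrow> stmt" where
  "ech_find l = Find 10 2 (IfR (RG 19 (NV (l + 2))) (RC 1)
     (Times (RG 5 (at2 (NV (l + 1)) (NV (l + 2)))) (RG 5 (at2 (NV (l + 1)) (NV (l + 2))))) (RC 0))"

definition ech_eliminate :: "nat \<Rightarrow> stmt" where
  "ech_eliminate l =
    Sq (Map2 5 1 2
      (IfEq (NV (l + 3)) (NG 10 (NC 0))
        (IfN (NV l) (NC 1) (RC 0)
          (Div (RG 5 (at2 (NV (l + 2)) (NG 10 (NC 0)))) (RG 5 (at2 (NV (l + 1)) (NG 10 (NC 0))))))
        (Minus (RG 5 (at2 (NV (l + 2)) (NV (l + 3))))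
          (Times (RG 5 (at2 (NV (l + 1)) (NV (l + 3))))
            (Div (RG 5 (at2 (NV (l + 2)) (NG 10 (NC 0)))) (RG 5 (at2 (NV (l + 1)) (NG 10 (NC 0)))))))))
    (Sq (RSet 19 (NG 10 (NC 0)) (RC 1))
      (If0 (IfN (NV l) (NC 1) (RC 0) (RC 1)) (NSet 5 (NV (l + 1)) (NG 10 (NC 0))) nop))"

text \<open>There are two passes: pass \<open>0\<close> eliminates the rows to be zero, pass \<open>1\<close> puts the
  remaining rows into echelon form.\<close>

definition ech_row :: "nat \<Rightarrow> stmt" where
  "ech_row l =
    If0 (IfN (NV l) (NC 1) (RG 18 (NV (l + 1))) (Minus (RC 1) (RG 18 (NV (l + 1)))))
      (Sq (ech_find l) (If0 (IfN (NG 10 (NC 0)) cN (RC 1) (RC 0)) (ech_eliminate l) nop))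
      nop"

definition ech_init :: "nat \<Rightarrow> stmt" where
  "ech_init l =
    Sq (Map2 5 1 2 (RG 4 (at2 (NV l) (NV (l + 1)))))
   (Sq (Vec 19 2 (RC 0)) (For 1 (NSet 5 (NV l) cN)))"

definition echelon :: "nat \<Rightarrow> stmt" where
  "echelon l = Sq (ech_init l) (For 10 (For 1 (ech_row l)))"

lemma nth_append_level [simp]:
  "(v @ xs) ! length v = xs ! 0"
  "(v @ xs) ! Suc (length v) = xs ! 1"
  "(v @ xs) ! Suc (Suc (length v)) = xs ! 2"
  "(v @ xs) ! (length v + numeral k) = xs ! numeral k"
  by (simp_all add: nth_append numeral_2_eq_2)

lemma cell_div_mod: "j < n \<Longrightarrow> (i * n + j) div n = i" "j < n \<Longrightarrow> (i * n + j) mod n = (j::nat)"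
  by auto

lemma first_below_cases:
  obtains "first_below n P = n" "\<And>j. j < n \<Longrightarrow> \<not> P j"
  | "first_below n P < n" "P (first_below n P)"
proof (cases "\<exists>k<n. P k")
  case True
  then obtain k where k: "k < n" "P k" by blast
  have "first_below n P = n \<or> first_below n P < n \<and> P (first_below n P)"
    unfolding first_below_def by (rule LeastI[where k = n]) simp
  moreover have "first_below n P \<le> k" unfolding first_below_def using k by (intro Least_le) simp
  ultimately show ?thesis using k that(2) by auto
next
  case False
  then have "first_below n P = n" by (intro first_below_eqI) auto
  then show ?thesis using False that(1) by blast
qed

lemma nwrites_echelon [simp]: "nwrites (echelon l) = {5, 10}"
  by (auto simp: echelon_def ech_init_def ech_row_def ech_find_def ech_eliminate_def)

lemma rwrites_echelon [simp]: "rwrites (echelon l) = {5, 19, 100}"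
  by (auto simp: echelon_def ech_init_def ech_row_def ech_find_def ech_eliminate_def)

context unimodular_lp
begin

definition "consts s \<longleftrightarrow> fst s 3 0 = 1 \<and> fst s 3 1 = M \<and> fst s 3 2 = N \<and> fst s 3 10 = 2"

definition "matA s \<longleftrightarrow> (\<forall>i<M. \<forall>j<N. snd s 4 (i * N + j) = A i j)"

lemma run_ech_find:
  assumes "fst u 3 = fst s 3" "consts s"
  shows "run (ech_find (length v)) (v @ [ph, i]) u =
    iput 10 0 (first_below N (\<lambda>j. snd u 19 j < 1 \<and> 0 < snd u 5 (i * N + j) * snd u 5 (i * N + j))) u"
  using assms unfolding ech_find_def run.simps consts_def
  by (simp cong: if_cong) (intro arg_cong2[where f="iput 10 0"] arg_cong2[where f=first_below] refl ext, auto)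

lemma run_ech_eliminate:
  assumes "fst u 3 = fst s 3" "consts s" and jj: "fst u 10 0 = jj"
  shows "snd (run (ech_eliminate (length v)) (v @ [ph, i]) u) = (snd u)(5 := \<lambda>x. if x < M * N then
       (if x mod N = jj then if ph = 0 then 0 else snd u 5 (x div N * N + jj) / snd u 5 (i * N + jj)
        else snd u 5 (x div N * N + x mod N) - snd u 5 (i * N + x mod N) * (snd u 5 (x div N * N + jj) / snd u 5 (i * N + jj)))
     else snd u 5 x, 19 := (snd u 19)(jj := 1))"
    "fst (run (ech_eliminate (length v)) (v @ [ph, i]) u) 5 = (if ph = 0 then fst u 5 else (fst u 5)(i := jj))"
  using assms by (auto simp: ech_eliminate_def consts_def fun_eq_iff)

lemma run_echelon:
  assumes c: "consts s" and A: "matA s"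
    and F: "\<And>i. i < M \<Longrightarrow> snd s 18 i = (if F i then 1 else 0)"
  shows "ech_inv F (\<lambda>_. True) (\<lambda>k j. snd (run (echelon (length v)) v s) 5 (k * N + j))
     (snd (run (echelon (length v)) v s) 19) (fst (run (echelon (length v)) v s) 5)"
proof -
  let ?l = "length v"
  let ?J = "\<lambda>R ph (s :: store). ech_inv F R (\<lambda>k j. snd s 5 (k * N + j)) (snd s 19) (fst s 5) \<and>
     (\<forall>i<M. snd s 18 i = (if F i then 1 else 0)) \<and> (\<forall>j<N. snd s 19 j = 0 \<or> snd s 19 j = 1) \<and>
     (ph \<longrightarrow> (\<forall>i<M. \<not> fst s 5 i < N))"
  let ?R = "\<lambda>ph k. if ph = 0 then False else if ph = Suc 0 then F k else True"
  let ?I = "\<lambda>ph s. ?J (?R ph) (ph \<le> 1) s"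
  \<comment> \<open>The rows processed before step \<open>i\<close> of pass \<open>ph\<close>. Pass
    0 visits only the rows in \<open>F\<close>, so throughout pass 1 all of them count as
    processed.\<close>
  let ?Q = "\<lambda>ph i k. if ph = 0 then F k \<and> k < i else F k \<or> k < (i :: nat)"
  have c3: "fst s 3 0 = 1" "fst s 3 (Suc 0) = M" "fst s 3 2 = N" "fst s 3 10 = 2" using c by (simp_all add: consts_def)
  define s1 where "s1 = run (Vec 19 2 (RC 0)) v (run (Map2 5 1 2 (RG 4 (at2 (NV ?l) (NV (?l + 1))))) v s)"
  define s2 where "s2 = run (For 1 (NSet 5 (NV ?l) cN)) v s1"
  have s1c: "fst s1 = fst s" by (simp add: s1_def)
  have s1C: "snd s1 5 (k * N + j) = A k j" if "k < M" "j < N" for k j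
    using that A c3 cell_less[OF that] by (simp add: s1_def matA_def cell_div_mod)
  have s1u: "snd s1 19 j = 0" if "j < N" for j using that c3 by (simp add: s1_def)
  have s1F: "snd s1 18 = snd s 18" by (simp add: s1_def)
  have "(\<forall>i<M. fst s2 5 i = N) \<and> snd s2 = snd s1"
    unfolding s2_def
    by (rule run_For_const[where I = "\<lambda>k t. (\<forall>i<k. fst t 5 i = N) \<and> snd t = snd s1" and c = "fst s 3"])
      (use c3 s1c in \<open>auto simp: less_Suc_eq\<close>)
  then have s2: "\<And>i. i < M \<Longrightarrow> fst s2 5 i = N" "snd s2 = snd s1" by auto
  have s2c: "fst s2 3 = fst s 3" using s1c by (simp add: s2_def)
  have start: "?I 0 s2"
  proof -
    have "ech_inv F (\<lambda>_. False) (\<lambda>k j. snd s2 5 (k * N + j)) (snd s2 19) (fst s2 5)"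
      by (rule ech_inv_cong[OF ech_start[where used="snd s2 19" and pc="fst s2 5"]])
        (simp_all add: s2 s1u s1C)
    then show ?thesis using s2 F s1F s1u by simp
  qed
  have step: "?J (?Q ph (Suc i)) (ph = 0) (run (ech_row ?l) (v @ [ph, i]) u)"
    if ph: "ph < 2" and i: "i < M" and u3: "fst u 3 = fst s 3" and J: "?J (?Q ph i) (ph = 0) u" for ph i u
  proof -
    let ?C = "\<lambda>k j. snd u 5 (k * N + j)"
    let ?P = "\<lambda>j. snd u 19 j < 1 \<and> 0 < ?C i j * ?C i j"
    let ?w = "run (ech_row ?l) (v @ [ph, i]) u"
    show ?thesis
    proof (cases "(ph = 0) = F i")
      case False
      have w: "?w = u"
        using ph J i False by (cases "ph = 0") (auto simp: ech_row_def)
      have "ech_inv F (?Q ph (Suc i)) ?C (snd u 19) (fst u 5)"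
        by (rule ech_inv_cong[of F "?Q ph i"]) (use J False in \<open>auto simp: less_Suc_eq\<close>)
      then show ?thesis unfolding w using J by blast
    next
      case True
      have Qeq: "?Q ph (Suc i) k = (?Q ph i k \<or> k = i)" for k using True by (auto simp: less_Suc_eq)
      let ?jj = "first_below N ?P"
      let ?u = "iput 10 0 ?jj u"
      have u3': "fst ?u 3 = fst s 3" using u3 by simp
      have w: "?w = (if ?jj < N then run (ech_eliminate ?l) (v @ [ph, i]) ?u else ?u)"
        using ph J i True c3 u3 by (cases "ph = 0") (auto simp: ech_row_def run_ech_find[OF u3 c])
      have invu: "ech_inv F (?Q ph i) ?C (snd u 19) (fst u 5)" using J by simp
      have phi: "\<forall>k<M. \<not> fst u 5 k < N" if "F i" using J True that by simp
      show ?thesis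
      proof (cases rule: first_below_cases[of N ?P])
        case 1
        have "ech_inv F (\<lambda>k. ?Q ph i k \<or> k = i) ?C (snd u 19) (fst u 5)"
        proof (rule ech_skip[OF invu i _ phi])
          fix j assume "j < N" "snd u 19 j = 0"
          then have "\<not> 0 < ?C i j * ?C i j" using 1(2)[of j] by simp
          then show "?C i j = 0" by (auto simp: not_less mult_le_0_iff)
        qed
        then have "ech_inv F (?Q ph (Suc i)) ?C (snd u 19) (fst u 5)" by (simp only: Qeq)
        then have J': "?J (?Q ph (Suc i)) (ph = 0) ?u" using J by simp
        have w': "?w = ?u" using w 1(1) by simp
        show ?thesis unfolding w' by (rule J')
      next
        case 2
        have eq: "?w = run (ech_eliminate ?l) (v @ [ph, i]) ?u" using w 2(1) by simp
        have jj: "fst ?u 10 0 = ?jj" by simp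
        have w2: "snd ?w = (snd u)(5 := \<lambda>x. if x < M * N then
              (if x mod N = ?jj then if ph = 0 then 0 else ?C (x div N) ?jj / ?C i ?jj
               else ?C (x div N) (x mod N) - ?C i (x mod N) * (?C (x div N) ?jj / ?C i ?jj))
            else snd u 5 x, 19 := (snd u 19)(?jj := 1))"
          "fst ?w 5 = (if ph = 0 then fst u 5 else (fst u 5)(i := ?jj))"
          unfolding eq run_ech_eliminate[OF u3' c jj] store_simps by simp_all
        have "ech_inv F (\<lambda>k. ?Q ph i k \<or> k = i) (\<lambda>k j. snd ?w 5 (k * N + j)) (snd ?w 19) (fst ?w 5)"
        proof (rule ech_pivot[OF invu i _ phi, where jj = ?jj])
          show "\<not> ?Q ph i i" using True by auto
          show "\<forall>k<M. F k \<longrightarrow> ?Q ph i k" if "\<not> F i" using that True by simp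
          show "?jj < N" "?C i ?jj \<noteq> 0" using 2 by auto
          show "snd u 19 ?jj = 0" using J 2 by force
          show "snd ?w 5 (k * N + j) = (if j = ?jj then if F i then 0 else ?C k ?jj / ?C i ?jj
              else ?C k j - ?C i j * (?C k ?jj / ?C i ?jj))" if "k < M" "j < N" for k j
            using cell_less[OF that] that True by (simp add: w2 cell_div_mod)
          show "snd ?w 19 = (snd u 19)(?jj := 1)" by (simp add: w2)
          show "fst ?w 5 = (if F i then fst u 5 else (fst u 5)(i := ?jj))" using True by (simp add: w2)
        qed
        then have "ech_inv F (?Q ph (Suc i)) (\<lambda>k j. snd ?w 5 (k * N + j)) (snd ?w 19) (fst ?w 5)" by (simp only: Qeq)
        moreover have "\<forall>i<M. snd ?w 18 i = (if F i then 1 else 0)" unfolding w2 using J by simp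
        moreover have "\<forall>j<N. snd ?w 19 j = 0 \<or> snd ?w 19 j = 1" unfolding w2 using J by simp
        moreover have "ph = 0 \<longrightarrow> (\<forall>i<M. \<not> fst ?w 5 i < N)" unfolding w2 using J by simp
        ultimately show ?thesis by blast
      qed
    qed
  qed
  have "?I 2 (run (For 10 (For 1 (ech_row ?l))) v s2)"
  proof (rule run_For_const[where I = ?I and c = "fst s 3"])
    fix ph and t :: store assume ph: "ph < 2" and t: "fst t 3 = fst s 3" and I: "?I ph t"
    have J0: "?J (?Q ph M) (ph = 0) (run (For 1 (ech_row ?l)) (v @ [ph]) t)"
    proof (rule run_For_const[where I = "\<lambda>i. ?J (?Q ph i) (ph = 0)" and c = "fst s 3"])
      have "ech_inv F (?Q ph 0) (\<lambda>k j. snd t 5 (k * N + j)) (snd t 19) (fst t 5)"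
        by (rule ech_inv_cong[of F "?R ph"]) (use I ph in \<open>auto simp: less_2_cases_iff\<close>)
      with I show "?J (?Q ph 0) (ph = 0) t" by simp
      fix i u assume "i < M" "fst u 3 = fst s 3" "?J (?Q ph i) (ph = 0) u"
      then show "?J (?Q ph (Suc i)) (ph = 0) (run (ech_row ?l) ((v @ [ph]) @ [i]) u)"
        unfolding append_assoc append.simps by (rule step[OF ph])
    qed (use t c3 in auto)
    define t' where "t' = run (For 1 (ech_row ?l)) (v @ [ph]) t"
    have J: "?J (?Q ph M) (ph = 0) t'" unfolding t'_def by (rule J0)
    have "ech_inv F (?R (Suc ph)) (\<lambda>k j. snd t' 5 (k * N + j)) (snd t' 19) (fst t' 5)"
      by (rule ech_inv_cong[of F "?Q ph M"]) (use J ph in \<open>auto simp: less_2_cases_iff\<close>)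
    with J show "?I (Suc ph) (run (For 1 (ech_row ?l)) (v @ [ph]) t)" unfolding t'_def[symmetric] by simp
  qed (use start s2c c3 in auto)
  moreover have "run (echelon ?l) v s = run (For 10 (For 1 (ech_row ?l))) v s2"
    by (simp only: echelon_def ech_init_def s2_def s1_def run.simps(5))
  ultimately show ?thesis by simp
qed

end

section \<open>The algorithm for unimodular programs\<close>

definition AbsX :: "real_term \<Rightarrow> real_term" where "AbsX e = IfR e (RC 0) (Minus (RC 0) e) e"
definition LeX :: "real_term \<Rightarrow> real_term \<Rightarrow> real_term" where "LeX e f = IfR f e (RC 0) (RC 1)"
text \<open>A universal quantifier is evaluated by counting counterexamples.\<close>

definition AllX :: "nat \<Rightarrow> real_term \<Rightarrow> real_term" where
  "AllX b e = IfR (RC 0) (SumTo b (IfR (RC 0) e (RC 0) (RC 1))) (RC 0) (RC 1)"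

lemma xval_AbsX [simp]: "xval (AbsX e) v s = \<bar>xval e v s\<bar>"
  by (simp add: AbsX_def)

lemma xval_LeX [simp]: "xval (LeX e f) v s = (if xval e v s \<le> xval f v s then 1 else 0)"
  by (simp add: LeX_def)

lemma xval_AllX [simp]: "xval (AllX b e) v s = (if \<forall>k<fst s 3 b. 0 < xval e (v @ [k]) s then 1 else 0)"
proof -
  let ?f = "\<lambda>k. if 0 < xval e (v @ [k]) s then 0 else (1::real)"
  have "(\<Sum>k<fst s 3 b. ?f k) = 0 \<longleftrightarrow> (\<forall>k<fst s 3 b. 0 < xval e (v @ [k]) s)"
    by (subst sum_nonneg_eq_0_iff) auto
  moreover have "0 \<le> (\<Sum>k<fst s 3 b. ?f k)" by (intro sum_nonneg) auto
  ultimately have "0 < (\<Sum>k<fst s 3 b. ?f k) \<longleftrightarrow> \<not> (\<forall>k<fst s 3 b. 0 < xval e (v @ [k]) s)" by (metis order_less_le)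
  then show ?thesis by (simp add: AllX_def cong: if_cong)
qed

lemma run_Vec:
  assumes "fst s 3 0 = 1" "fst s 3 c = n" "a < 100"
  shows "run (Vec a c x) v s = (fst s, (snd s)(a := \<lambda>i. if i < n then xval x (v @ [0, i]) s else snd s a i))"
  using assms by (auto simp: fun_eq_iff)

lemma first_below_argmax:
  fixes f :: "nat \<Rightarrow> real"
  assumes "0 < n"
  shows "first_below n (\<lambda>i. \<forall>k<n. f k \<le> f i) < n"
    "k < n \<Longrightarrow> f k \<le> f (first_below n (\<lambda>i. \<forall>k<n. f k \<le> f i))"
proof -
  let ?P = "\<lambda>i. \<forall>k<n. f k \<le> f i"
  have "Max (f ` {..<n}) \<in> f ` {..<n}" using assms by (intro Max_in) auto
  then obtain i where "i < n" "f i = Max (f ` {..<n})" by auto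
  then have i: "i < n" "?P i" by auto
  have *: "first_below n ?P < n \<and> ?P (first_below n ?P)"
    using i by (cases rule: first_below_cases[of n ?P]) blast+
  then show "first_below n ?P < n" by blast
  show "k < n \<Longrightarrow> f k \<le> f (first_below n ?P)" using * by blast
qed

lemma first_below_argmin:
  fixes f :: "nat \<Rightarrow> real"
  assumes "j < n" "Q j"
  defines "k0 \<equiv> first_below n (\<lambda>i. Q i \<and> (\<forall>k<n. Q k \<longrightarrow> f i \<le> f k))"
  shows "k0 < n" "Q k0" "k < n \<Longrightarrow> Q k \<Longrightarrow> f k0 \<le> f k"
proof -
  let ?P = "\<lambda>i. Q i \<and> (\<forall>k<n. Q k \<longrightarrow> f i \<le> f k)"
  have "Min (f ` {i. i < n \<and> Q i}) \<in> f ` {i. i < n \<and> Q i}" using assms by (intro Min_in) auto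
  then obtain i where "i < n" "Q i" "f i = Min (f ` {i. i < n \<and> Q i})" by auto
  then have i: "i < n" "?P i" by auto
  have "k0 < n \<and> ?P k0"
    unfolding k0_def using i by (cases rule: first_below_cases[of n ?P]) blast+
  then show "k0 < n" "Q k0" "k < n \<Longrightarrow> Q k \<Longrightarrow> f k0 \<le> f k" by blast+
qed

abbreviation "rM \<equiv> SumTo 1 (RC 1)"
abbreviation "rM5 \<equiv> Times rM (Times rM (Times rM (Times rM rM)))"
abbreviation "rK \<equiv> Plus (Times (RC 2) rM) (RC 1)"
abbreviation "scal a \<equiv> RG a (NC 0)"

definition signs :: "nat \<Rightarrow> stmt" where
  "signs l = Vec 11 1 (IfR (RC 0) (RG 9 (NV (l + 1))) (RC 0)
     (IfR (RG 7 (NV (l + 1))) (RC 0) (RC 1)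
       (IfR (RC 0) (RG 7 (NV (l + 1))) (IfR (RC 0) (RG 6 (NV (l + 1))) (RC (-1)) (RC 0)) (RC 0))))"

definition col_products :: "nat \<Rightarrow> stmt" where
  "col_products l = Vec 13 2 (SumTo 1 (Times (RG 4 (at2 (NV (l + 2)) (NV (l + 1)))) (RG 12 (NV (l + 2)))))"

text \<open>Cell 0 of array 16 is set once a separating vector has been found. The loop around it
  cannot stop, so all further rounds do nothing and preserve that vector together with its
  response.\<close>

definition perceptron_iteration :: "nat \<Rightarrow> stmt" where
  "perceptron_iteration l =
    If0 (Minus (RC 1) (scal 16))
     (Sq (col_products l)
     (Sq (Vec 14 1 (SumTo 2 (Times (RG 4 (at2 (NV (l + 1)) (NV (l + 2)))) (RG 13 (NV (l + 2))))))
     (Sq (Vec 15 1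
        (IfR (RC 0) (RG 11 (NV (l + 1))) (IfR (RC 0) (RG 14 (NV (l + 1))) (RC 1) rM)
          (IfR (RG 11 (NV (l + 1))) (RC 0) (IfR (RG 14 (NV (l + 1))) (RC 0) (RC (-1)) (Minus (RC 0) rM))
            (IfR (RG 14 (NV (l + 1))) (RC 0) rM (Minus (RC 0) rM)))))
     (Sq (RSet 17 (NC 0) (SumTo 1 (Times (RG 15 (NV l)) (RG 14 (NV l)))))
       (If0 (scal 17) (RSet 16 (NC 0) (RC 1))
         (Vec 12 1 (Plus (RG 12 (NV (l + 1))) (RG 15 (NV (l + 1))))))))))
     nop"

definition perceptron :: "nat \<Rightarrow> stmt" where
  "perceptron l = Sq (Vec 12 1 (RC 0)) (Sq (RSet 16 (NC 0) (RC 0)) (For 7 (perceptron_iteration (l + 1))))"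

text \<open>The column is reversed if necessary, so that moving along it does not decrease the
  pairing with the response.\<close>

definition rounding_dir :: "nat \<Rightarrow> stmt" where
  "rounding_dir l =
     Sq (Vec 22 1 (RG 5 (at2 (NV (l + 1)) (NG 5 (NG 11 (NC 0))))))
    (Sq (RSet 17 (NC 0) (SumTo 1 (Times (RG 15 (NV l)) (RG 22 (NV l)))))
        (If0 (IfR (scal 17) (RC 0) (RC 1) (RC 0)) (Vec 22 1 (Minus (RC 0) (RG 22 (NV (l + 1))))) nop))"

definition rounding_move :: "nat \<Rightarrow> stmt" where
  "rounding_move l =
     Sq (Vec 21 1 (IfR (RC 0) (Times (RG 22 (NV (l + 1))) (RG 14 (NV (l + 1))))
          (Div (Minus (RC 1) (AbsX (RG 14 (NV (l + 1))))) (AbsX (RG 22 (NV (l + 1)))))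
          (Div (AbsX (RG 14 (NV (l + 1)))) (AbsX (RG 22 (NV (l + 1)))))))
    (Sq (Find 11 1 (IfR (RC 0) (AbsX (RG 22 (NV l)))
          (AllX 1 (IfR (RC 0) (AbsX (RG 22 (NV (l + 1)))) (LeX (RG 21 (NV l)) (RG 21 (NV (l + 1)))) (RC 1))) (RC 0)))
        (Vec 14 1 (Plus (RG 14 (NV (l + 1))) (Times (RG 21 (NG 11 (NC 0))) (RG 22 (NV (l + 1)))))))"

definition rounding_iteration :: "nat \<Rightarrow> stmt" where
  "rounding_iteration l =
    Sq (Vec 18 1 (IfR (RC 0) (Times (AbsX (RG 14 (NV (l + 1)))) (Minus (RC 1) (AbsX (RG 14 (NV (l + 1)))))) (RC 0) (RC 1)))
   (Sq (echelon l)
   (Sq (Find 11 1 (IfN (NG 5 (NV l)) cN (RC 1) (RC 0)))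
       (If0 (IfN (NG 11 (NC 0)) cM (RC 1) (RC 0)) (Sq (rounding_dir l) (rounding_move l)) nop)))"

definition round_direction :: "nat \<Rightarrow> stmt" where
  "round_direction l =
    Sq (Find 11 1 (AllX 1 (LeX (AbsX (RG 14 (NV (l + 1)))) (AbsX (RG 14 (NV l))))))
   (Sq (Vec 14 1 (Div (RG 14 (NV (l + 1))) (AbsX (RG 14 (NG 11 (NC 0))))))
       (For 1 (rounding_iteration (l + 1))))"

definition cancel :: "nat \<Rightarrow> stmt" where
  "cancel l =
    Sq (Find 11 1 (IfR (RG 14 (NV l)) (RC 0)
         (AllX 1 (IfR (RG 14 (NV (l + 1))) (RC 0) (LeX (RG 6 (NV l)) (RG 6 (NV (l + 1)))) (RC 1))) (RC 0)))
       (Vec 6 1 (Plus (RG 6 (NV (l + 1))) (Times (RG 6 (NG 11 (NC 0))) (RG 14 (NV (l + 1))))))"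

definition tighten :: "nat \<Rightarrow> stmt" where
  "tighten l =
    Sq (col_products l)
   (Sq (Vec 7 1 (Plus (RG 7 (NV (l + 1))) (Times (Div (scal 8) (Plus rK (RC 1)))
         (Div (IfN (NV (l + 1)) cN (Minus (RG 12 (NV (l + 1))) (RG 13 (NV (l + 1)))) (RG 12 (NV (l + 1))))
              (Times (RC 2) rM5)))))
       (RSet 8 (NC 0) (Times (scal 8) (Div rK (Plus rK (RC 1))))))"

definition improve :: "nat \<Rightarrow> stmt" where
  "improve l = Sq (signs l) (Sq (perceptron l)
     (If0 (scal 16) (Sq (round_direction l) (cancel l)) (tighten l)))"

text \<open>A vector of \<open>L\<close> that vanishes on the fixed coordinates is the combination
  of the basis columns with its own pivot entries as coefficients. Hence pairing \<open>r\<close>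
  with each column, and putting 0 elsewhere, represents the same functional. The largest absolute
  value obtained is taken as the new \<open>\<epsilon>\<close>.\<close>

definition rebase :: "nat \<Rightarrow> stmt" where
  "rebase l =
    Sq (Vec 18 1 (IfR (RC 0) (RG 9 (NV (l + 1))) (RC 1) (RC 0)))
   (Sq (echelon l)
   (Sq (Vec 7 1 (IfN (NG 5 (NV (l + 1))) cN
         (SumTo 1 (Times (RG 7 (NV (l + 2))) (RG 5 (at2 (NV (l + 2)) (NG 5 (NV (l + 1))))))) (RC 0)))
   (Sq (Find 11 1 (AllX 1 (LeX (AbsX (RG 7 (NV (l + 1)))) (AbsX (RG 7 (NV l))))))
       (RSet 8 (NC 0) (AbsX (RG 7 (NG 11 (NC 0))))))))"

definition fix_zero :: "nat \<Rightarrow> stmt" where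
  "fix_zero l = Vec 9 1 (IfR (RC 0) (RG 9 (NV (l + 1))) (RC 1)
     (IfR (Times rM (scal 8)) (RG 7 (NV (l + 1))) (RC 1) (RC 0)))"

definition epoch :: "nat \<Rightarrow> stmt" where
  "epoch l = Sq (rebase l) (Sq (For 8 (improve (l + 1))) (fix_zero l))"

definition lp_solve :: "nat \<Rightarrow> stmt" where
  "lp_solve l = For 9 (epoch (l + 1))"

lemma writes [simp]:
  "nwrites (signs l) = {}" "rwrites (signs l) = {11}"
  "nwrites (col_products l) = {}" "rwrites (col_products l) = {13}"
  "nwrites (perceptron l) = {}" "rwrites (perceptron l) = {12, 13, 14, 15, 16, 17, 100}"
  "nwrites (round_direction l) = {5, 10, 11}" "rwrites (round_direction l) = {5, 14, 17, 18, 19, 21, 22, 100}"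
  "nwrites (cancel l) = {11}" "rwrites (cancel l) = {6}"
  "nwrites (tighten l) = {}" "rwrites (tighten l) = {7, 8, 13}"
  "nwrites (rebase l) = {5, 10, 11}" "rwrites (rebase l) = {5, 7, 8, 18, 19, 100}"
  "nwrites (fix_zero l) = {}" "rwrites (fix_zero l) = {9}"
  by (auto simp: signs_def col_products_def perceptron_def perceptron_iteration_def round_direction_def
      rounding_iteration_def rounding_dir_def rounding_move_def cancel_def tighten_def rebase_def fix_zero_def)

section \<open>Correctness of the perceptron and rounding programs\<close>

context unimodular_lp
begin

definition "base s \<longleftrightarrow> consts s \<and> matA s \<and> fst s 3 7 = 4 * M ^ 5"

lemma base_D:
  assumes "base s"
  shows "fst s 3 0 = 1" "fst s 3 (Suc 0) = M" "fst s 3 2 = N" "fst s 3 7 = 4 * M ^ 5" "consts s" "matA s"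
  using assms by (simp_all add: base_def consts_def)

lemma base_run: "base s \<Longrightarrow> 4 \<notin> rwrites p \<Longrightarrow> base (run p v s)"
  using rframe[of 4 p v s] by (simp add: base_def consts_def matA_def)

definition "signs_of Z r x i = (if Z i then 0 else if r i < 0 then 1 else if 0 < r i \<and> 0 < x i then -1 else (0::real))"

lemma run_signs:
  assumes "base s" "i < M"
  shows "snd (run (signs (length v)) v s) 11 i = signs_of (\<lambda>i. 0 < snd s 9 i) (snd s 7) (snd s 6) i"
  using assms by (simp add: signs_def signs_of_def run_Vec base_D del: run.simps(4))

lemma run_col_products:
  assumes "base s" "j < N"
  shows "snd (run (col_products (length v)) v s) 13 j = colprod (snd s 12) j"
  using assms base_D(6)[OF assms(1)]
  by (simp add: col_products_def colprod_def run_Vec base_D matA_def del: run.simps(4))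

lemma colprod_cong: "(\<And>i. i < M \<Longrightarrow> p i = p' i) \<Longrightarrow> colprod p j = colprod p' j"
  by (simp add: colprod_def)

lemma perceptron_inv_cong: "(\<And>i. i < M \<Longrightarrow> p' i = p i) \<Longrightarrow> perceptron_inv s t p \<Longrightarrow> perceptron_inv s t p'"
  using colprod_cong[of p' p] by (simp add: perceptron_inv_def box_def)

definition "separator sg b w \<longleftrightarrow> L w \<and> (\<forall>i<M. b i = response sg w i) \<and> 0 < (\<Sum>i<M. b i * w i)"

lemma run_perceptron_iteration:
  fixes v :: "nat list"
  assumes s: "base s" and sg: "\<And>i. i < M \<Longrightarrow> snd s 11 i = sg i \<and> sg i \<in> {-1, 0, 1}" and found: "snd s 16 0 = 0"
    and inv: "perceptron_inv sg t (snd s 12)"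
  defines "u \<equiv> run (perceptron_iteration (length v)) v s"
  shows "snd u 16 0 = 0 \<and> perceptron_inv sg (Suc t) (snd u 12) \<or> snd u 16 0 = 1 \<and> separator sg (snd u 15) (snd u 14)"
proof -
  let ?l = "length v"
  define s1 where "s1 = run (col_products ?l) v s"
  define s2 where "s2 = run (Vec 14 1 (SumTo 2 (Times (RG 4 (at2 (NV (?l + 1)) (NV (?l + 2)))) (RG 13 (NV (?l + 2)))))) v s1"
  define s3 where "s3 = run (Vec 15 1
        (IfR (RC 0) (RG 11 (NV (?l + 1))) (IfR (RC 0) (RG 14 (NV (?l + 1))) (RC 1) rM)
          (IfR (RG 11 (NV (?l + 1))) (RC 0) (IfR (RG 14 (NV (?l + 1))) (RC 0) (RC (-1)) (Minus (RC 0) rM))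
            (IfR (RG 14 (NV (?l + 1))) (RC 0) rM (Minus (RC 0) rM))))) v s2"
  define s4 where "s4 = run (RSet 17 (NC 0) (SumTo 1 (Times (RG 15 (NV ?l)) (RG 14 (NV ?l))))) v s3"
  have u: "u = run (If0 (scal 17) (RSet 16 (NC 0) (RC 1)) (Vec 12 1 (Plus (RG 12 (NV (?l + 1))) (RG 15 (NV (?l + 1)))))) v s4"
    using found by (simp add: u_def perceptron_iteration_def s4_def s3_def s2_def s1_def del: run.simps(1-4,7))
  have b: "base s1" "base s2" "base s3" "base s4"
    unfolding s4_def s3_def s2_def s1_def by (intro base_run s; simp)+
  let ?p = "snd s 12"
  have q: "snd s1 13 j = colprod ?p j" if "j < N" for j unfolding s1_def using s that by (rule run_col_products)
  have s1a: "snd s1 11 = snd s 11" "snd s1 12 = ?p" "snd s1 16 = snd s 16" by (simp_all add: s1_def rframe)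
  have w: "snd s2 14 i = mulA (colprod ?p) i" if "i < M" for i
    using that q base_D(6)[OF b(1)]
    by (simp add: s2_def run_Vec base_D[OF b(1)] mulA_def matA_def del: run.simps(4))
  have s2a: "snd s2 11 = snd s 11" "snd s2 12 = ?p" "snd s2 16 = snd s 16" by (simp_all add: s2_def rframe s1a)
  have resp: "snd s3 15 i = response sg (mulA (colprod ?p)) i" if "i < M" for i
    using that w[OF that] sg[OF that]
    by (auto simp: s3_def run_Vec base_D[OF b(2)] response_def s2a simp del: run.simps(4))
  have s3a: "snd s3 11 = snd s 11" "snd s3 12 = ?p" "snd s3 16 = snd s 16" "snd s3 14 = snd s2 14" by (simp_all add: s3_def rframe s2a)
  have s4a: "snd s4 12 = ?p" "snd s4 16 = snd s 16" "snd s4 14 = snd s2 14" "snd s4 15 = snd s3 15"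
    "snd s4 17 0 = (\<Sum>i<M. snd s3 15 i * snd s2 14 i)"
    by (simp_all add: s4_def s3a base_D[OF b(3)])
  have sum: "snd s4 17 0 = (\<Sum>i<M. response sg (mulA (colprod ?p)) i * mulA (colprod ?p) i)"
    unfolding s4a by (intro sum.cong) (simp_all add: resp w)
  show ?thesis
  proof (cases "0 < snd s4 17 0")
    case True
    then have u': "snd u 16 0 = 1" "snd u 15 = snd s3 15" "snd u 14 = snd s2 14" by (simp_all add: u s4a)
    have "L (snd s2 14)" by (rule L_cong[OF _ mulA_L[of "colprod ?p"]]) (simp add: w)
    moreover have "\<forall>i<M. snd s3 15 i = response sg (snd s2 14) i"
      by (simp add: resp response_def w)
    ultimately show ?thesis using u' True s4a by (simp add: separator_def)
  next
    case False
    then have u': "snd u 16 0 = 0" "\<And>i. i < M \<Longrightarrow> snd u 12 i = ?p i + snd s3 15 i"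
      using found by (simp_all add: u s4a run_Vec base_D[OF b(4)] del: run.simps(4))
    have "perceptron_inv sg (Suc t) (snd u 12)"
      by (rule perceptron_inv_cong[OF _ perceptron_step[OF inv]]) (use False sum u'(2) resp in auto)
    then show ?thesis using u' by simp
  qed
qed

lemma run_perceptron:
  fixes v :: "nat list"
  assumes s: "base s" and sg: "\<And>i. i < M \<Longrightarrow> snd s 11 i = sg i \<and> sg i \<in> {-1, 0, 1}"
  defines "u \<equiv> run (perceptron (length v)) v s"
  shows "snd u 16 0 = 0 \<and> perceptron_inv sg (4 * M ^ 5) (snd u 12) \<or> snd u 16 0 = 1 \<and> separator sg (snd u 15) (snd u 14)"
proof -
  let ?l = "length v"
  define s1 where "s1 = run (RSet 16 (NC 0) (RC 0)) v (run (Vec 12 1 (RC 0)) v s)"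
  have u: "u = run (For 7 (perceptron_iteration (?l + 1))) v s1"
    by (simp add: u_def perceptron_def s1_def del: run.simps(1-4,7))
  have b1: "base s1" unfolding s1_def by (intro base_run s; simp)
  let ?I = "\<lambda>t (u :: store). base u \<and> (\<forall>i<M. snd u 11 i = sg i) \<and>
    (snd u 16 0 = 0 \<and> perceptron_inv sg t (snd u 12) \<or> snd u 16 0 = 1 \<and> separator sg (snd u 15) (snd u 14))"
  have "?I (4 * M ^ 5) u" unfolding u
  proof (rule run_For_const[where I = ?I and c = "fst s1 3"])
    have "snd s1 12 i = 0" if "i < M" for i using that base_D[OF s] by (simp add: s1_def run_Vec del: run.simps(4))
    then have "perceptron_inv sg 0 (snd s1 12)" by (intro perceptron_inv_cong[OF _ perceptron_0]) simp
    then show "?I 0 s1" using b1 sg by (simp add: s1_def)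
  next
    fix t and u :: store assume I: "?I t u"
    let ?u = "run (perceptron_iteration (?l + 1)) (v @ [t]) u"
    have "base ?u" using I by (intro base_run) (auto simp: perceptron_iteration_def)
    moreover have "snd ?u 11 = snd u 11" by (rule rframe) (auto simp: perceptron_iteration_def)
    moreover have "snd ?u 16 0 = 0 \<and> perceptron_inv sg (Suc t) (snd ?u 12) \<or> snd ?u 16 0 = 1 \<and> separator sg (snd ?u 15) (snd ?u 14)"
    proof (cases "snd u 16 0 = 0")
      case True
      then show ?thesis using run_perceptron_iteration[of u sg t "v @ [t]"] I sg by auto
    next
      case False
      then have "snd u 16 0 = 1" using I by blast
      then have "?u = u" by (simp add: perceptron_iteration_def)
      then show ?thesis using I False by (simp del: run.simps)
    qed
    ultimately show "?I (Suc t) ?u" using I by simp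
  qed (use base_D[OF b1] in auto)
  then show ?thesis by blast
qed

lemma run_rounding_dir:
  fixes v :: "nat list"
  assumes s: "base s" and h: "L h" "i < M" "h i \<noteq> 0"
    and col: "\<And>k. k < M \<Longrightarrow> snd s 5 (k * N + fst s 5 (fst s 11 0)) = h k"
  defines "u \<equiv> run (rounding_dir (length v)) v s"
  obtains c where "c \<noteq> 0" "\<And>k. k < M \<Longrightarrow> snd u 22 k = c * h k" "0 \<le> (\<Sum>k<M. snd s 15 k * snd u 22 k)"
    "snd u 14 = snd s 14" "snd u 15 = snd s 15" "base u"
proof -
  let ?l = "length v"
  define s1 where "s1 = run (Vec 22 1 (RG 5 (at2 (NV (?l + 1)) (NG 5 (NG 11 (NC 0)))))) v s"
  define s2 where "s2 = run (RSet 17 (NC 0) (SumTo 1 (Times (RG 15 (NV ?l)) (RG 22 (NV ?l))))) v s1"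
  have u: "u = run (If0 (IfR (scal 17) (RC 0) (RC 1) (RC 0)) (Vec 22 1 (Minus (RC 0) (RG 22 (NV (?l + 1))))) nop) v s2"
    by (simp add: u_def rounding_dir_def s2_def s1_def del: run.simps(1-4,6,7))
  have b: "base s1" "base s2" "base u" unfolding s1_def s2_def u by (intro base_run s; simp)+
  have s1h: "snd s1 22 k = h k" if "k < M" for k
    using that col base_D[OF s] by (simp add: s1_def run_Vec del: run.simps(4))
  have s1a: "snd s1 15 = snd s 15" by (simp add: s1_def)
  have s2h: "snd s2 22 = snd s1 22" "snd s2 17 0 = (\<Sum>k<M. snd s 15 k * h k)"
    using base_D[OF b(1)] by (simp_all add: s2_def s1h s1a)
  define c :: real where "c = (if snd s2 17 0 < 0 then -1 else 1)"
  have uh: "snd u 22 k = c * h k" if "k < M" for k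
    using that base_D[OF b(2)] s2h(1) s1h[OF that] by (simp add: u c_def run_Vec del: run.simps(4))
  have "(\<Sum>k<M. snd s 15 k * snd u 22 k) = c * snd s2 17 0"
    unfolding s2h(2) sum_distrib_left by (intro sum.cong) (simp_all add: uh)
  also have "0 \<le> \<dots>" by (simp add: c_def)
  finally have "0 \<le> (\<Sum>k<M. snd s 15 k * snd u 22 k)" .
  moreover have "c \<noteq> 0" by (simp add: c_def)
  moreover have "snd u 14 = snd s 14" "snd u 15 = snd s 15"
    unfolding u_def by (rule rframe, simp add: rounding_dir_def)+
  ultimately show ?thesis using that[of c, OF _ uh] b(3) by simp
qed

lemma run_rounding_move:
  fixes v :: "nat list"
  assumes s: "base s" and j: "j < M" "snd s 22 j \<noteq> 0"
  defines "u \<equiv> run (rounding_move (length v)) v s"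
  obtains k0 where "k0 < M" "snd s 22 k0 \<noteq> 0"
    "\<And>k. k < M \<Longrightarrow> snd s 22 k \<noteq> 0 \<Longrightarrow> reach (snd s 22) (snd s 14) k0 \<le> reach (snd s 22) (snd s 14) k"
    "\<And>k. k < M \<Longrightarrow> snd u 14 k = snd s 14 k + reach (snd s 22) (snd s 14) k0 * snd s 22 k"
proof -
  let ?l = "length v"
  let ?h = "snd s 22" let ?w = "snd s 14"
  define s1 where "s1 = run (Vec 21 1 (IfR (RC 0) (Times (RG 22 (NV (?l + 1))) (RG 14 (NV (?l + 1))))
          (Div (Minus (RC 1) (AbsX (RG 14 (NV (?l + 1))))) (AbsX (RG 22 (NV (?l + 1)))))
          (Div (AbsX (RG 14 (NV (?l + 1)))) (AbsX (RG 22 (NV (?l + 1))))))) v s"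
  define s2 where "s2 = run (Find 11 1 (IfR (RC 0) (AbsX (RG 22 (NV ?l)))
          (AllX 1 (IfR (RC 0) (AbsX (RG 22 (NV (?l + 1)))) (LeX (RG 21 (NV ?l)) (RG 21 (NV (?l + 1)))) (RC 1))) (RC 0))) v s1"
  have u: "u = run (Vec 14 1 (Plus (RG 14 (NV (?l + 1))) (Times (RG 21 (NG 11 (NC 0))) (RG 22 (NV (?l + 1)))))) v s2"
    by (simp add: u_def rounding_move_def s2_def s1_def del: run.simps(1-4,6,7))
  have b: "base s1" "base s2" unfolding s1_def s2_def by (intro base_run s; simp)+
  have s1r: "snd s1 21 k = reach ?h ?w k" if "k < M" for k
    using that base_D[OF s] by (simp add: s1_def run_Vec reach_def del: run.simps(4))
  have s1a: "snd s1 22 = ?h" "snd s1 14 = ?w" by (simp_all add: s1_def)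
  let ?P = "\<lambda>i. ?h i \<noteq> 0 \<and> (\<forall>k<M. ?h k \<noteq> 0 \<longrightarrow> snd s1 21 i \<le> snd s1 21 k)"
  have s2: "s2 = iput 11 0 (first_below M ?P) s1"
    using base_D[OF b(1)] unfolding s2_def run.simps
    by (simp add: s1a) (intro arg_cong2[where f="iput 11 0"] arg_cong2[where f=first_below] refl ext, auto)
  let ?k0 = "first_below M ?P"
  note k0 = first_below_argmin[where f = "snd s1 21" and Q = "\<lambda>i. ?h i \<noteq> 0" and n = M, OF j]
  show ?thesis
  proof (rule that[of ?k0])
    show "?k0 < M" "?h ?k0 \<noteq> 0" by (rule k0(1), rule k0(2))
    show "reach ?h ?w ?k0 \<le> reach ?h ?w k" if "k < M" "?h k \<noteq> 0" for k
      using k0(3)[OF that] s1r[OF that(1)] s1r[OF k0(1)] by simp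
    show "snd u 14 k = ?w k + reach ?h ?w ?k0 * ?h k" if "k < M" for k
      using that base_D[OF b(2)] s1r[OF k0(1)] by (simp add: u run_Vec s2 s1a del: run.simps(4))
  qed
qed

lemma run_rounding_iteration:
  fixes v :: "nat list"
  assumes s: "base s" and inv: "rounding_inv (snd s 15) v0 (snd s 14)"
  defines "u \<equiv> run (rounding_iteration (length v)) v s"
  shows "rounding_inv (snd s 15) v0 (snd u 14)"
    "(\<forall>i<M. integral_at (snd u 14) i) \<or>
     card {i. i < M \<and> integral_at (snd s 14) i} < card {i. i < M \<and> integral_at (snd u 14) i}"
    "base u" "snd u 15 = snd s 15"
proof -
  let ?l = "length v"
  let ?w = "snd s 14"
  define s1 where "s1 = run (Vec 18 1 (IfR (RC 0) (Times (AbsX (RG 14 (NV (?l + 1)))) (Minus (RC 1) (AbsX (RG 14 (NV (?l + 1)))))) (RC 0) (RC 1))) v s"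
  define s2 where "s2 = run (echelon ?l) v s1"
  define s3 where "s3 = run (Find 11 1 (IfN (NG 5 (NV ?l)) cN (RC 1) (RC 0))) v s2"
  have u: "u = run (If0 (IfN (NG 11 (NC 0)) cM (RC 1) (RC 0)) (Sq (rounding_dir ?l) (rounding_move ?l)) nop) v s3"
    by (simp add: u_def rounding_iteration_def s3_def s2_def s1_def del: run.simps(1-4,6,7))
  have b: "base s1" "base s2" "base s3" unfolding s1_def s2_def s3_def by (intro base_run s; simp)+
  show "base u"
    unfolding u_def by (intro base_run s) (simp add: rounding_iteration_def rounding_dir_def rounding_move_def)
  show "snd u 15 = snd s 15"
    unfolding u_def by (rule rframe) (simp add: rounding_iteration_def rounding_dir_def rounding_move_def)
  let ?F = "integral_at ?w"
  have flag: "snd s1 18 i = (if ?F i then 1 else 0)" if i: "i < M" for i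
  proof -
    have bd: "\<bar>?w i\<bar> \<le> 1" using inv i by (simp add: rounding_inv_def)
    \<comment> \<open>On the interval from -1 to 1 this product is 0 only at -1, 0 and 1, which lets
      the program flag integral entries with one comparison.\<close>
    then have "0 < \<bar>?w i\<bar> * (1 - \<bar>?w i\<bar>) \<longleftrightarrow> \<not> ?F i"
      by (auto simp: integral_at_def zero_less_mult_iff)
    then show ?thesis using i base_D[OF s] by (simp add: s1_def run_Vec del: run.simps(4))
  qed
  have s1a: "snd s1 14 = ?w" "snd s1 15 = snd s 15" by (simp_all add: s1_def)
  have s2a: "snd s2 14 = ?w" "snd s2 15 = snd s 15" by (simp_all add: s2_def rframe s1a)
  let ?C = "\<lambda>k j. snd s2 5 (k * N + j)"
  have ech: "ech_inv ?F (\<lambda>_. True) ?C (snd s2 19) (fst s2 5)"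
    unfolding s2_def by (rule run_echelon[OF base_D(5,6)[OF b(1)] flag])
  let ?i = "first_below M (\<lambda>i. fst s2 5 i < N)"
  have s3: "s3 = iput 11 0 ?i s2"
    using base_D[OF b(2)] unfolding s3_def run.simps by (simp cong: if_cong)
  have "rounding_inv (snd s 15) v0 (snd u 14) \<and> ((\<forall>i<M. integral_at (snd u 14) i) \<or>
     card {i. i < M \<and> ?F i} < card {i. i < M \<and> integral_at (snd u 14) i})"
  proof (cases rule: first_below_cases[of M "\<lambda>i. fst s2 5 i < N"])
    case 1
    then have "u = s3" using base_D[OF b(3)] by (simp add: u s3 del: run.simps(5))
    then have "snd u 14 = ?w" by (simp add: s3 s2a)
    moreover have "integral_at ?w i" if "i < M" for i
      by (rule rounding_stop[OF inv ech_determined[OF ech] that]) (use 1 in blast)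
    ultimately show ?thesis using inv by simp
  next
    case 2
    let ?h = "\<lambda>k. ?C k (fst s2 5 ?i)"
    note h = ech_column[OF ech 2]
    have nc: "fst s3 11 0 = ?i" "fst s3 5 = fst s2 5" "snd s3 = snd s2" by (simp_all add: s3)
    define s4 where "s4 = run (rounding_dir ?l) v s3"
    have u4: "u = run (rounding_move ?l) v s4"
      using base_D[OF b(3)] 2 by (simp add: u nc s4_def)
    have "snd s3 5 (k * N + fst s3 5 (fst s3 11 0)) = ?h k" if "k < M" for k by (simp add: nc)
    from run_rounding_dir[OF b(3) h(1) 2(1) _ this, of v] h(2) obtain c where c: "c \<noteq> 0"
      "\<And>k. k < M \<Longrightarrow> snd s4 22 k = c * ?h k" "0 \<le> (\<Sum>k<M. snd s3 15 k * snd s4 22 k)"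
      "snd s4 14 = snd s3 14" "snd s4 15 = snd s3 15" "base s4" unfolding s4_def by auto
    have a: "snd s4 14 = ?w" "snd s3 15 = snd s 15" using c(4,5) nc s2a by simp_all
    have nz: "snd s4 22 ?i \<noteq> 0" using c(1) c(2)[OF 2(1)] h(2) by simp
    obtain k0 where k0: "k0 < M" "snd s4 22 k0 \<noteq> 0"
      "\<And>k. k < M \<Longrightarrow> snd s4 22 k \<noteq> 0 \<Longrightarrow> reach (snd s4 22) ?w k0 \<le> reach (snd s4 22) ?w k"
      "\<And>k. k < M \<Longrightarrow> snd u 14 k = ?w k + reach (snd s4 22) ?w k0 * snd s4 22 k"
      using run_rounding_move[OF c(6) 2(1) nz, of v] unfolding u4 a(1) by metis
    have Lh: "L (snd s4 22)" by (rule L_cong[OF _ L_scale[OF h(1), of c]]) (simp add: c(2))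
    have z: "snd s4 22 k = 0" if "k < M" "?F k" for k using c(2)[OF that(1)] h(3)[OF that] by simp
    have up: "0 \<le> (\<Sum>k<M. snd s 15 k * snd s4 22 k)" using c(3) a(2) by simp
    show ?thesis using rounding_step[OF inv Lh z up k0] by simp
  qed
  then show "rounding_inv (snd s 15) v0 (snd u 14)"
    "(\<forall>i<M. integral_at (snd u 14) i) \<or>
     card {i. i < M \<and> integral_at (snd s 14) i} < card {i. i < M \<and> integral_at (snd u 14) i}" by auto
qed

end

context unimodular_lp
begin

lemma rounding_inv_cong: "(\<And>i. i < M \<Longrightarrow> b i = b' i) \<Longrightarrow> rounding_inv b v0 w \<Longrightarrow> rounding_inv b' v0 w"
proof -
  assume "\<And>i. i < M \<Longrightarrow> b i = b' i"
  then have "(\<Sum>i<M. b i * w i) = (\<Sum>i<M. b' i * w i)" by (intro sum.cong) auto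
  then show "rounding_inv b v0 w \<Longrightarrow> rounding_inv b' v0 w" by (simp add: rounding_inv_def)
qed

lemma run_round_direction:
  fixes v :: "nat list"
  assumes s: "base s" and sep: "separator sg (snd s 15) (snd s 14)" and sg: "\<And>i. i < M \<Longrightarrow> sg i \<in> {-1, 0, 1}"
  defines "d \<equiv> snd (run (round_direction (length v)) v s) 14"
  shows "L d" "k < M \<Longrightarrow> d k \<in> {-1, 0, 1}" "k < M \<Longrightarrow> d k \<noteq> 0 \<Longrightarrow> sg k = d k" "\<exists>k<M. d k \<noteq> 0"
proof -
  let ?l = "length v" let ?w = "snd s 14" let ?b = "snd s 15"
  have Lw: "L ?w" and b: "\<And>i. i < M \<Longrightarrow> ?b i = response sg ?w i" and pos: "0 < (\<Sum>i<M. ?b i * ?w i)"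
    using sep by (auto simp: separator_def)
  obtain j where j: "j < M" "?w j \<noteq> 0" using pos sum.neutral[of "{..<M}" "\<lambda>i. ?b i * ?w i"] by fastforce
  \<comment> \<open>Division by the largest absolute value puts all entries between -1 and 1, as
    \<open>rounding_inv\<close> demands.\<close>
  let ?i = "first_below M (\<lambda>i. \<forall>k<M. \<bar>?w k\<bar> \<le> \<bar>?w i\<bar>)"
  let ?m = "\<bar>?w ?i\<bar>"
  have mx: "\<bar>?w k\<bar> \<le> ?m" if "k < M" for k
    using first_below_argmax(2)[where f = "\<lambda>k. \<bar>?w k\<bar>" and n = M] that j(1) by simp
  have m: "0 < ?m" using mx[OF j(1)] j(2) by linarith
  define s1 where "s1 = run (Find 11 1 (AllX 1 (LeX (AbsX (RG 14 (NV (?l + 1)))) (AbsX (RG 14 (NV ?l)))))) v s"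
  define s2 where "s2 = run (Vec 14 1 (Div (RG 14 (NV (?l + 1))) (AbsX (RG 14 (NG 11 (NC 0)))))) v s1"
  have d: "d = snd (run (For 1 (rounding_iteration (?l + 1))) v s2) 14"
    by (simp add: d_def round_direction_def s2_def s1_def del: run.simps(1-4,6,7))
  have s1: "s1 = iput 11 0 ?i s"
    using base_D[OF s] unfolding s1_def run.simps
    by simp (intro arg_cong2[where f="iput 11 0"] arg_cong2[where f=first_below] refl ext, auto)
  have bs: "base s1" "base s2" unfolding s1_def s2_def by (intro base_run s; simp)+
  have s2w: "snd s2 14 i = ?w i / ?m" if "i < M" for i
    using that base_D[OF bs(1)] by (simp add: s2_def run_Vec s1 del: run.simps(4))
  have s2b: "snd s2 15 = ?b" by (simp add: s2_def s1)
  have start: "rounding_inv ?b ?w (snd s2 14)"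
  proof -
    have "L (snd s2 14)" by (rule L_cong[OF _ L_scale[OF Lw, of "1 / ?m"]]) (simp add: s2w)
    moreover have "\<bar>snd s2 14 i\<bar> \<le> 1 \<and> (snd s2 14 i \<noteq> 0 \<longrightarrow> 0 < snd s2 14 i * ?w i)" if "i < M" for i
      using mx[OF that] m by (simp add: s2w[OF that] zero_less_divide_iff zero_less_mult_iff) linarith
    moreover have "(\<Sum>i<M. ?b i * snd s2 14 i) = (\<Sum>i<M. ?b i * ?w i) / ?m"
      unfolding sum_divide_distrib by (intro sum.cong) (simp_all add: s2w)
    ultimately show ?thesis using pos m by (simp add: rounding_inv_def)
  qed
  \<comment> \<open>Each round adds an integral coordinate unless all are integral already, so
    \<open>M\<close> rounds suffice.\<close>
  let ?I = "\<lambda>k (u :: store). base u \<and> snd u 15 = ?b \<and> rounding_inv ?b ?w (snd u 14) \<and>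
    (k \<le> card {i. i < M \<and> integral_at (snd u 14) i} \<or> (\<forall>i<M. integral_at (snd u 14) i))"
  have cardle: "card {i. i < M \<and> P i} \<le> M" for P :: "nat \<Rightarrow> bool"
    using card_mono[of "{..<M}" "{i. i < M \<and> P i}"] by auto
  have "?I M (run (For 1 (rounding_iteration (?l + 1))) v s2)"
  proof (rule run_For_const[where I = ?I and c = "fst s2 3"])
    show "?I 0 s2" using bs s2b start by simp
    fix k and u :: store assume I: "?I k u"
    let ?u = "run (rounding_iteration (?l + 1)) (v @ [k]) u"
    have inv: "rounding_inv (snd u 15) ?w (snd u 14)" using I by simp
    note r = run_rounding_iteration[OF conjunct1[OF I] inv, of "v @ [k]"]
    have len: "length (v @ [k]) = ?l + 1" by simp
    have "Suc k \<le> card {i. i < M \<and> integral_at (snd ?u 14) i} \<or> (\<forall>i<M. integral_at (snd ?u 14) i)"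
    proof (cases "\<forall>i<M. integral_at (snd u 14) i")
      case True
      then have "{i. i < M \<and> integral_at (snd u 14) i} = {..<M}" by auto
      then have "card {i. i < M \<and> integral_at (snd u 14) i} = M" by simp
      then have "\<not> card {i. i < M \<and> integral_at (snd u 14) i} < card {i. i < M \<and> integral_at (snd ?u 14) i}"
        using cardle[of "integral_at (snd ?u 14)"] by linarith
      then show ?thesis using r(2)[unfolded len] by blast
    next
      case False
      then have "k \<le> card {i. i < M \<and> integral_at (snd u 14) i}" using I by blast
      then show ?thesis using r(2)[unfolded len] by (meson Suc_leI le_less_trans)
    qed
    moreover have e: "snd u 15 = ?b" using I by simp
    ultimately show "?I (Suc k) ?u" using r(1,3,4)[unfolded len e] by blast
  qed (use base_D[OF bs(2)] in auto)
  then have fin: "rounding_inv ?b ?w d" "M \<le> card {i. i < M \<and> integral_at d i} \<or> (\<forall>i<M. integral_at d i)"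
    by (simp_all only: d[symmetric])
  have int: "integral_at d i" if "i < M" for i
  proof (cases "M \<le> card {i. i < M \<and> integral_at d i}")
    case True
    then have "{i. i < M \<and> integral_at d i} = {..<M}" by (intro card_seteq) auto
    then show ?thesis using that by auto
  qed (use fin that in blast)
  have fin': "rounding_inv (response sg ?w) ?w d" by (rule rounding_inv_cong[OF b fin(1)])
  show "L d" using fin by (simp add: rounding_inv_def)
  show "d k \<in> {-1, 0, 1}" if "k < M" using int[OF that] by (simp add: integral_at_def)
  show "sg k = d k" if "k < M" "d k \<noteq> 0" by (rule rounding_final(1)[OF fin' int sg that])
  show "\<exists>k<M. d k \<noteq> 0" by (rule rounding_final(2)[OF fin' int sg])
qed

section \<open>Rounds and epochs\<close>

definition "zeros s i \<longleftrightarrow> 0 < snd s 9 (i :: nat)" for s :: store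

definition "state s \<longleftrightarrow> base s \<and> invar (zeros s) (snd s 6) (snd s 7)"

definition "eps_state s \<longleftrightarrow> state s \<and> 0 \<le> snd s 8 0 \<and> eps_opt (zeros s) (snd s 6) (snd s 7) (snd s 8 0)"

text \<open>The potential of the cancelling rounds: each of them lowers it. It never exceeds
  \<open>M\<close>, whatever a tightening round does to it, so at most \<open>M\<close> cancelling
  rounds occur in a row.\<close>

definition "slack_count s = card {k. k < M \<and> \<not> zeros s k \<and> 0 < snd s 7 k \<and> 0 < snd s 6 k}" for s :: store

text \<open>The factor \<open>K / (K + 1)\<close> of \<open>tighten_step\<close> for the bound
  \<open>K = 2 * M + 1\<close> of \<open>perceptron_final\<close>.\<close>

definition "contraction = real (2 * M + 1) / (real (2 * M + 1) + 1)"

lemma run_cancel: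
  fixes v :: "nat list"
  assumes s: "eps_state s"
    and d: "L (snd s 14)" "\<And>k. k < M \<Longrightarrow> snd s 14 k \<in> {-1, 0, 1}" "\<exists>k<M. snd s 14 k \<noteq> 0"
    and sg: "\<And>k. k < M \<Longrightarrow> snd s 14 k \<noteq> 0 \<Longrightarrow> signs_of (zeros s) (snd s 7) (snd s 6) k = snd s 14 k"
  defines "u \<equiv> run (cancel (length v)) v s"
  shows "eps_state u" "slack_count u < slack_count s"
proof -
  let ?l = "length v" let ?d = "snd s 14" let ?x = "snd s 6" let ?r = "snd s 7"
  have bs: "base s" and inv: "invar (zeros s) ?x ?r" and e: "0 \<le> snd s 8 0"
    and eo: "eps_opt (zeros s) ?x ?r (snd s 8 0)" using s by (auto simp: eps_state_def state_def)
  have pos: "\<not> zeros s k \<and> ?r k < 0" if "k < M" "?d k = 1" for k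
    using sg[OF that(1)] that by (auto simp: signs_of_def split: if_splits)
  have neg: "\<not> zeros s k \<and> 0 < ?r k \<and> 0 < ?x k" if "k < M" "?d k = -1" for k
    using sg[OF that(1)] that by (auto simp: signs_of_def split: if_splits)
  obtain k1 where k1: "k1 < M" "?d k1 \<noteq> 0" using d(3) by blast
  obtain j where j: "j < M" "?d j = -1" using L_cost_pos[OF inv d(1,2) k1 pos neg] by blast
  have dneg: "?d k < 0 \<longleftrightarrow> ?d k = -1" if "k < M" for k using d(2)[OF that] by auto
  let ?P = "\<lambda>i. ?d i < 0 \<and> (\<forall>k<M. ?d k < 0 \<longrightarrow> ?x i \<le> ?x k)"
  let ?k0 = "first_below M ?P"
  have jneg: "?d j < 0" using j by simp
  note k0 = first_below_argmin[where f = ?x and Q = "\<lambda>i. ?d i < 0" and n = M, OF j(1) jneg]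
  define s1 where "s1 = run (Find 11 1 (IfR (RG 14 (NV ?l)) (RC 0)
         (AllX 1 (IfR (RG 14 (NV (?l + 1))) (RC 0) (LeX (RG 6 (NV ?l)) (RG 6 (NV (?l + 1)))) (RC 1))) (RC 0))) v s"
  have s1: "s1 = iput 11 0 ?k0 s"
    using base_D[OF bs] unfolding s1_def run.simps
    by simp (intro arg_cong2[where f="iput 11 0"] arg_cong2[where f=first_below] refl ext, auto)
  have b1: "base s1" unfolding s1_def by (intro base_run bs) simp
  have u: "u = run (Vec 6 1 (Plus (RG 6 (NV (?l + 1))) (Times (RG 6 (NG 11 (NC 0))) (RG 14 (NV (?l + 1)))))) v s1"
    by (simp add: u_def cancel_def s1_def del: run.simps(1-4,6,7))
  have x': "snd u 6 k = ?x k + ?x ?k0 * ?d k" if "k < M" for k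
    using that base_D[OF b1] by (simp add: u run_Vec s1 del: run.simps(4))
  have fr: "snd u 7 = ?r" "snd u 8 = snd s 8" "snd u 9 = snd s 9"
    unfolding u_def by (rule rframe, simp)+
  have z: "zeros u = zeros s" by (simp add: zeros_def fun_eq_iff fr)
  have kk: "?k0 < M" "?d ?k0 = -1" using k0(1,2) dneg by auto
  have kmin: "?x ?k0 \<le> ?x k" if "k < M" "?d k = -1" for k using k0(3)[OF that(1)] that(2) by simp
  note c = cancel_step[OF inv eo d(1,2) pos neg kk kmin x' e]
  have "base u" unfolding u_def by (intro base_run bs) simp
  then show "eps_state u" unfolding eps_state_def state_def z fr using c(1,2) e by blast
  show "slack_count u < slack_count s" unfolding slack_count_def z fr using c(3) by blast
qed

lemma run_tighten:
  fixes v :: "nat list"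
  assumes s: "eps_state s" and M: "0 < M"
    and P: "perceptron_inv (signs_of (zeros s) (snd s 7) (snd s 6)) (4 * M ^ 5) (snd s 12)"
  defines "u \<equiv> run (tighten (length v)) v s"
  shows "eps_state u" "snd u 8 0 = snd s 8 0 * contraction" "snd s 8 0 = 0 \<Longrightarrow> i < M \<Longrightarrow> snd u 7 i = snd s 7 i"
proof -
  let ?l = "length v" let ?x = "snd s 6" let ?r = "snd s 7" let ?e = "snd s 8 0" let ?K = "real (2 * M + 1)"
  let ?sg = "signs_of (zeros s) ?r ?x"
  have bs: "base s" and inv: "invar (zeros s) ?x ?r" and e: "0 \<le> ?e"
    and eo: "eps_opt (zeros s) ?x ?r ?e" using s by (auto simp: eps_state_def state_def)
  define s1 where "s1 = run (col_products ?l) v s"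
  have b1: "base s1" unfolding s1_def by (intro base_run bs) simp
  have q: "snd s1 13 j = colprod (snd s 12) j" if "j < N" for j unfolding s1_def using bs that by (rule run_col_products)
  have s1f: "snd s1 7 = ?r" "snd s1 8 = snd s 8" "snd s1 12 = snd s 12" unfolding s1_def by (rule rframe, simp)+
  define p where "p i = (if i < N then snd s 12 i - colprod (snd s 12) i else snd s 12 i) / (2 * real M ^ 5)" for i
  note pf = perceptron_final[OF P M, of p, OF p_def]
  have r': "snd u 7 i = ?r i + ?e / (?K + 1) * p i" if "i < M" for i
    using that base_D[OF b1] NM q[of i] s1f
    by (simp add: u_def tighten_def s1_def[symmetric] run_Vec p_def eval_nat_numeral del: run.simps(4) cong: if_cong)
  have fr: "snd u 6 = ?x" "snd u 9 = snd s 9" unfolding u_def by (rule rframe, simp)+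
  have z: "zeros u = zeros s" by (simp add: zeros_def fun_eq_iff fr)
  show eps: "snd u 8 0 = ?e * contraction"
    using base_D[OF b1] s1f
    by (simp add: u_def tighten_def s1_def[symmetric] run_Vec contraction_def del: run.simps(4))
  have lo: "1 \<le> p i" if "i < M" "\<not> zeros s i" "?r i < 0" for i
    by (rule pf(3)[OF that(1)]) (use that in \<open>auto simp: signs_of_def\<close>)
  have hi: "p i \<le> -1" if "i < M" "\<not> zeros s i" "0 < ?r i" "0 < ?x i" for i
    by (rule pf(4)[OF that(1)]) (use that in \<open>auto simp: signs_of_def\<close>)
  have K: "0 \<le> ?K" by simp
  note t = tighten_step[OF inv eo e K pf(1) pf(2) lo hi r']
  have c: "?K / (?K + 1) = contraction" by (simp add: contraction_def)
  have "base u" unfolding u_def by (intro base_run bs) simp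
  moreover have "0 \<le> ?e * contraction" using e by (simp add: contraction_def)
  ultimately show "eps_state u" using t[unfolded c] eps by (simp add: eps_state_def state_def z fr)
  show "snd u 7 i = ?r i" if "?e = 0" "i < M" using r'[OF that(2)] that(1) by simp
qed

text \<open>The last claim serves the end of the algorithm: cancelling leaves \<open>r\<close> alone
  and tightening shifts it by a multiple of \<open>\<epsilon>\<close>, so reduced costs that have
  become 0 stay 0.\<close>

lemma run_improve:
  fixes v :: "nat list"
  assumes s: "eps_state s" and M: "0 < M"
  defines "u \<equiv> run (improve (length v)) v s"
  shows "eps_state u" "snd u 9 = snd s 9"
    "snd u 8 0 = snd s 8 0 \<and> slack_count u < slack_count s \<or> snd u 8 0 = snd s 8 0 * contraction"
    "snd s 8 0 = 0 \<Longrightarrow> i < M \<Longrightarrow> snd u 7 i = snd s 7 i"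
proof -
  let ?l = "length v"
  have bs: "base s" using s by (simp add: eps_state_def state_def)
  define s1 where "s1 = run (signs ?l) v s"
  define s2 where "s2 = run (perceptron ?l) v s1"
  have b: "base s1" "base s2" unfolding s1_def s2_def by (intro base_run bs; simp)+
  let ?sg = "signs_of (zeros s) (snd s 7) (snd s 6)"
  have sgv: "?sg i \<in> {-1, 0, 1}" for i by (simp add: signs_of_def)
  have "snd s1 11 i = ?sg i" if "i < M" for i
    using run_signs[OF bs that, of v] by (simp add: s1_def zeros_def[abs_def])
  then have s1: "\<And>i. i < M \<Longrightarrow> snd s1 11 i = ?sg i \<and> ?sg i \<in> {-1, 0, 1}" using sgv by blast
  note perc = run_perceptron[OF b(1) s1, of v, folded s2_def]
  have fr: "snd s2 a = snd s a" if "a \<in> {6, 7, 8, 9}" for a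
    using that by (auto simp: s2_def s1_def rframe)
  have z: "zeros s2 = zeros s" by (simp add: zeros_def fun_eq_iff fr)
  have es2: "eps_state s2" using s b(2) by (simp add: eps_state_def state_def z fr)
  have u: "u = (if 0 < snd s2 16 0 then run (cancel ?l) v (run (round_direction ?l) v s2) else run (tighten ?l) v s2)"
    by (simp add: u_def improve_def s1_def s2_def)
  show "snd u 9 = snd s 9" unfolding u_def by (rule rframe) (simp add: improve_def)
  have "eps_state u \<and> (snd u 8 0 = snd s 8 0 \<and> slack_count u < slack_count s \<or> snd u 8 0 = snd s 8 0 * contraction) \<and>
    (snd s 8 0 = 0 \<longrightarrow> (\<forall>i<M. snd u 7 i = snd s 7 i))"
  proof (cases "snd s2 16 0 = 0")
    case True
    then have P: "perceptron_inv (signs_of (zeros s2) (snd s2 7) (snd s2 6)) (4 * M ^ 5) (snd s2 12)"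
      using perc by (simp add: z fr)
    have "u = run (tighten ?l) v s2" using u True by simp
    then show ?thesis using run_tighten[where v = v, OF es2 M P] by (auto simp: fr)
  next
    case False
    then have f: "snd s2 16 0 = 1" "separator ?sg (snd s2 15) (snd s2 14)" using perc by auto
    define s3 where "s3 = run (round_direction ?l) v s2"
    note rd = run_round_direction[where v = v, OF b(2) f(2) sgv, folded s3_def]
    have fr3: "snd s3 a = snd s a" if "a \<in> {6, 7, 8, 9}" for a
      using that fr[OF that] by (auto simp: s3_def rframe)
    have z3: "zeros s3 = zeros s" by (simp add: zeros_def fun_eq_iff fr3)
    have "base s3" unfolding s3_def by (intro base_run b) simp
    then have es3: "eps_state s3" using s by (simp add: eps_state_def state_def z3 fr3)
    have sg3: "signs_of (zeros s3) (snd s3 7) (snd s3 6) k = snd s3 14 k" if "k < M" "snd s3 14 k \<noteq> 0" for k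
      using rd(3)[OF that] by (simp add: z3 fr3)
    have u3: "u = run (cancel ?l) v s3" using u f(1) by (simp add: s3_def)
    have "snd u 8 = snd s3 8" "snd u 7 = snd s3 7" unfolding u3 by (rule rframe, simp)+
    moreover have "slack_count s3 = slack_count s" by (simp add: slack_count_def z3 fr3)
    ultimately show ?thesis using run_cancel[where v = v, OF es3 rd(1,2,4) sg3] by (simp add: u3[symmetric] fr3)
  qed
  then show "eps_state u" "snd u 8 0 = snd s 8 0 \<and> slack_count u < slack_count s \<or> snd u 8 0 = snd s 8 0 * contraction"
    "snd s 8 0 = 0 \<Longrightarrow> i < M \<Longrightarrow> snd u 7 i = snd s 7 i" by auto
qed

text \<open>The maximal reduced cost is attained at a pivot row, where it is the pairing of
  \<open>r\<close> with a basis column \<open>h\<close>. By \<open>ech_entries\<close> this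
  \<open>h\<close> has entries of absolute value at most 1; it is the witness that an epoch carries
  along.\<close>

lemma run_rebase:
  fixes v :: "nat list"
  assumes s: "state s" and M: "0 < M"
  defines "u \<equiv> run (rebase (length v)) v s"
  shows "eps_state u" "snd u 9 = snd s 9" "snd u 8 0 = 0 \<Longrightarrow> i < M \<Longrightarrow> snd u 7 i = 0"
    "0 < snd u 8 0 \<Longrightarrow> \<exists>h. L h \<and> (\<forall>i<M. zeros u i \<longrightarrow> h i = 0) \<and> (\<forall>i<M. \<bar>h i\<bar> \<le> 1) \<and>
       snd u 8 0 = \<bar>\<Sum>i<M. snd u 7 i * h i\<bar>"
    "\<forall>i<M. \<not> zeros s i \<longrightarrow> snd s 7 i = 0 \<Longrightarrow> snd u 8 0 = 0"
proof -
  let ?l = "length v" let ?r = "snd s 7" let ?x = "snd s 6"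
  have bs: "base s" and inv: "invar (zeros s) ?x ?r" using s by (auto simp: state_def)
  define s1 where "s1 = run (Vec 18 1 (IfR (RC 0) (RG 9 (NV (?l + 1))) (RC 1) (RC 0))) v s"
  define s2 where "s2 = run (echelon ?l) v s1"
  define s3 where "s3 = run (Vec 7 1 (IfN (NG 5 (NV (?l + 1))) cN
         (SumTo 1 (Times (RG 7 (NV (?l + 2))) (RG 5 (at2 (NV (?l + 2)) (NG 5 (NV (?l + 1))))))) (RC 0))) v s2"
  define s4 where "s4 = run (Find 11 1 (AllX 1 (LeX (AbsX (RG 7 (NV (?l + 1)))) (AbsX (RG 7 (NV ?l)))))) v s3"
  have u: "u = run (RSet 8 (NC 0) (AbsX (RG 7 (NG 11 (NC 0))))) v s4"
    by (simp add: u_def rebase_def s4_def s3_def s2_def s1_def del: run.simps(1-4,6,7))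
  have b: "base s1" "base s2" "base s3" "base s4"
    unfolding s4_def s3_def s2_def s1_def by (intro base_run bs; simp)+
  have flag: "snd s1 18 i = (if zeros s i then 1 else 0)" if "i < M" for i
    using that base_D[OF bs] by (simp add: s1_def run_Vec zeros_def del: run.simps(4))
  let ?C = "\<lambda>k j. snd s2 5 (k * N + j)" let ?pc = "fst s2 5"
  have ech: "ech_inv (zeros s) (\<lambda>_. True) ?C (snd s2 19) ?pc"
    unfolding s2_def by (rule run_echelon[OF base_D(5,6)[OF b(1)] flag])
  have s2r: "snd s2 7 = ?r" by (simp add: s2_def s1_def rframe)
  define r' where "r' i = (if ?pc i < N then \<Sum>k<M. ?r k * ?C k (?pc i) else 0)" for i
  have s3r: "snd s3 7 i = r' i" if "i < M" for i
    using that base_D[OF b(2)] s2r by (simp add: s3_def run_Vec r'_def del: run.simps(4))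
  let ?i = "first_below M (\<lambda>i. \<forall>k<M. \<bar>snd s3 7 k\<bar> \<le> \<bar>snd s3 7 i\<bar>)"
  note i0 = first_below_argmax[where f = "\<lambda>k. \<bar>snd s3 7 k\<bar>" and n = M, OF M]
  have s4: "s4 = iput 11 0 ?i s3"
    using base_D[OF b(3)] unfolding s4_def run.simps
    by simp (intro arg_cong2[where f="iput 11 0"] arg_cong2[where f=first_below] refl ext, auto)
  have ur: "snd u 7 = snd s3 7" "snd u 8 0 = \<bar>r' ?i\<bar>" by (simp_all add: u s4 s3r[OF i0(1)])
  have fr: "snd u 6 = ?x" "snd u 9 = snd s 9" unfolding u_def by (rule rframe, simp)+
  show "snd u 9 = snd s 9" by fact
  have z: "zeros u = zeros s" by (simp add: zeros_def fun_eq_iff fr)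
  have le: "\<bar>snd u 7 k\<bar> \<le> snd u 8 0" if "k < M" for k
    using i0(2)[OF that] s3r[OF i0(1)] ur by simp
  have same: "(\<Sum>i<M. snd u 7 i * h i) = (\<Sum>k<M. ?r k * h k)" if h: "L h" "\<forall>i<M. zeros s i \<longrightarrow> h i = 0" for h
  proof -
    have "(\<Sum>i<M. snd u 7 i * h i) = (\<Sum>i<M. r' i * h i)" by (intro sum.cong) (simp_all add: ur s3r)
    also have "\<dots> = (\<Sum>i | i < M \<and> ?pc i < N. r' i * h i)"
      by (rule sum.mono_neutral_right) (auto simp: r'_def)
    also have "\<dots> = (\<Sum>i | i < M \<and> ?pc i < N. \<Sum>k<M. ?r k * (h i * ?C k (?pc i)))"
      by (intro sum.cong refl) (simp add: r'_def sum_distrib_left sum_distrib_right mult_ac)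
    also have "\<dots> = (\<Sum>k<M. \<Sum>i | i < M \<and> ?pc i < N. ?r k * (h i * ?C k (?pc i)))" by (rule sum.swap)
    also have "\<dots> = (\<Sum>k<M. ?r k * h k)"
      unfolding sum_distrib_left[symmetric] by (intro sum.cong refl) (simp add: ech_end[OF ech h])
    finally show ?thesis .
  qed
  have "invar (zeros u) (snd u 6) (snd u 7)"
    using inv same by (simp add: invar_def z fr)
  moreover have "base u" unfolding u_def by (intro base_run bs) simp
  moreover have "0 \<le> snd u 8 0" by (simp add: ur)
  moreover have "- snd u 8 0 \<le> snd u 7 k \<and> snd u 7 k \<le> snd u 8 0" if "k < M" for k
    using le[OF that] by linarith
  ultimately show "eps_state u" by (simp add: eps_state_def state_def eps_opt_def)
  show "snd u 7 i = 0" if "snd u 8 0 = 0" "i < M" using le[OF that(2)] that(1) by simp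
  have basic: "r' ?i = (\<Sum>k<M. ?r k * ?C k (?pc ?i))" "?pc ?i < N" if "r' ?i \<noteq> 0"
    using that by (auto simp: r'_def split: if_splits)
  show "\<exists>h. L h \<and> (\<forall>i<M. zeros u i \<longrightarrow> h i = 0) \<and> (\<forall>i<M. \<bar>h i\<bar> \<le> 1) \<and>
       snd u 8 0 = \<bar>\<Sum>i<M. snd u 7 i * h i\<bar>" if "0 < snd u 8 0"
  proof -
    have nz: "r' ?i \<noteq> 0" using that ur by auto
    note h = ech_column[OF ech i0(1) basic(2)[OF nz]]
    show ?thesis
      using h same[OF h(1)] ech_entries[OF ech i0(1) basic(2)[OF nz]] basic(1)[OF nz] ur(2)
      by (intro exI[of _ "\<lambda>k. ?C k (?pc ?i)"]) (simp add: z)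
  qed
  show "snd u 8 0 = 0" if r0: "\<forall>i<M. \<not> zeros s i \<longrightarrow> ?r i = 0"
  proof (rule ccontr)
    assume "snd u 8 0 \<noteq> 0"
    then have nz: "r' ?i \<noteq> 0" using ur by auto
    have "(\<Sum>k<M. ?r k * ?C k (?pc ?i)) = 0"
      using r0 ech_column(3)[OF ech i0(1) basic(2)[OF nz]] by (intro sum.neutral) auto
    then show False using basic(1)[OF nz] nz by simp
  qed
qed

text \<open>The inverse of \<open>contraction\<close> is \<open>1 + 1 / K\<close> with
  \<open>K = 2 * M + 1\<close>, and by Bernoulli's inequality its power \<open>a\<close> is at least
  \<open>1 + a / K\<close>, which exceeds \<open>M^2\<close>.\<close>

lemma contraction_power:
  assumes M: "0 < M" and a: "(2 * M + 1) * M ^ 2 < a"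
  shows "real M ^ 2 * contraction ^ a < 1"
proof -
  let ?K = "real (2 * M + 1)"
  have K: "0 < ?K" by simp
  have "1 + 1 / ?K = (?K + 1) / ?K" using K by (simp only: add_divide_distrib divide_self_if) simp
  then have inv: "contraction * (1 + 1 / ?K) = 1" unfolding contraction_def using K by simp
  have "?K * real M ^ 2 < real a" using a by (metis of_nat_less_iff of_nat_mult of_nat_power)
  then have "real M ^ 2 < real a * (1 / ?K)" using K by (simp add: field_simps)
  also have "\<dots> < (1 + 1 / ?K) ^ a"
  proof -
    have "-1 \<le> 1 / ?K" by (rule order_trans[of _ 0]) simp_all
    from Bernoulli_inequality[OF this, of a] show ?thesis by linarith
  qed
  finally have lt: "real M ^ 2 < (1 + 1 / ?K) ^ a" .
  have cp: "0 < contraction ^ a" by (simp add: contraction_def)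
  have "real M ^ 2 * contraction ^ a < (1 + 1 / ?K) ^ a * contraction ^ a"
    by (rule mult_strict_right_mono[OF lt cp])
  also have "\<dots> = (contraction * (1 + 1 / ?K)) ^ a" by (simp only: power_mult_distrib mult.commute)
  also have "\<dots> = 1" by (simp only: inv power_one)
  finally show ?thesis .
qed

definition "clock s \<longleftrightarrow> fst s 3 8 = ((2 * M + 1) * M ^ 2 + 1) * (M + 1) \<and> fst s 3 9 = M + 1"

definition "settled s \<longleftrightarrow> (\<forall>i<M. \<not> zeros s i \<longrightarrow> snd s 7 i = 0)"

definition "free_count s = card {i. i < M \<and> \<not> zeros s i}"

text \<open>Let \<open>h\<close> be the witness from \<open>run_rebase\<close>. Its pairing with
  \<open>r\<close> keeps the absolute value \<open>?eb\<close> during the epoch. Were all free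
  reduced costs at most \<open>M * ?e\<close>, those bounds together with \<open>- ?e\<close> from
  below would limit the pairing to \<open>M * M * ?e\<close>, which is less than \<open>?eb\<close>
  by \<open>contraction_power\<close>. So \<open>fix_zero\<close> finds a new coordinate.\<close>

lemma run_epoch:
  fixes v :: "nat list"
  assumes s: "state s" and M: "0 < M" and cl: "clock s"
  defines "u \<equiv> run (epoch (length v)) v s"
  shows "state u" "settled u \<or> free_count u < free_count s" "settled s \<Longrightarrow> settled u"
proof -
  let ?l = "length v" let ?T = "((2 * M + 1) * M ^ 2 + 1) * (M + 1)"
  define s1 where "s1 = run (rebase ?l) v s"
  define s2 where "s2 = run (For 8 (improve (?l + 1))) v s1"
  have u: "u = run (fix_zero ?l) v s2" by (simp add: u_def epoch_def s1_def s2_def)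
  note rb = run_rebase[where v = v, OF s M, folded s1_def]
  let ?eb = "snd s1 8 0"
  have slack: "slack_count w \<le> M" for w :: store
    using card_mono[of "{..<M}" "{k. k < M \<and> \<not> zeros w k \<and> 0 < snd w 7 k \<and> 0 < snd w 6 k}"]
    by (auto simp: slack_count_def)
  \<comment> \<open>\<open>a\<close> counts the tightening rounds. Each pays for itself and for at
    most \<open>M\<close> cancelling rounds; the current run of cancelling rounds is paid for by the
    drop of \<open>slack_count\<close> below \<open>M\<close>.\<close>
  let ?I = "\<lambda>k (w :: store). eps_state w \<and> snd w 9 = snd s1 9 \<and> (?eb = 0 \<longrightarrow> (\<forall>i<M. snd w 7 i = snd s1 7 i)) \<and>
    (\<exists>a. snd w 8 0 = ?eb * contraction ^ a \<and> k \<le> a * (M + 1) + (M - slack_count w))"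
  have "?I ?T s2" unfolding s2_def
  proof (rule run_For_const[where I = ?I and c = "fst s1 3"])
    show "?I 0 s1" using rb(1) by (intro conjI exI[of _ 0]) auto
    fix k and w :: store assume I: "?I k w"
    let ?w = "run (improve (?l + 1)) (v @ [k]) w"
    have len: "length (v @ [k]) = ?l + 1" by simp
    note im = run_improve[where v = "v @ [k]", OF conjunct1[OF I] M, unfolded len]
    obtain a where a: "snd w 8 0 = ?eb * contraction ^ a" "k \<le> a * (M + 1) + (M - slack_count w)" using I by blast
    have "\<exists>a. snd ?w 8 0 = ?eb * contraction ^ a \<and> Suc k \<le> a * (M + 1) + (M - slack_count ?w)"
      using im(3)
    proof
      assume h: "snd ?w 8 0 = snd w 8 0 \<and> slack_count ?w < slack_count w"
      then have "Suc k \<le> a * (M + 1) + (M - slack_count ?w)" using a(2) slack[of w] by linarith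
      then show ?thesis using h a(1) by auto
    next
      assume h: "snd ?w 8 0 = snd w 8 0 * contraction"
      have "Suc k \<le> Suc a * (M + 1) + (M - slack_count ?w)" using a(2) by simp
      then show ?thesis using h a(1) by (intro exI[of _ "Suc a"]) (simp add: mult.assoc mult.commute)
    qed
    moreover have "?eb = 0 \<longrightarrow> (\<forall>i<M. snd ?w 7 i = snd s1 7 i)" using im(4) I a(1) by auto
    ultimately show "?I (Suc k) ?w" using im(1,2) I by simp
  qed (use cl in \<open>auto simp: clock_def s1_def\<close>)
  then obtain a where es2: "eps_state s2" "snd s2 9 = snd s1 9" "?eb = 0 \<longrightarrow> (\<forall>i<M. snd s2 7 i = snd s1 7 i)"
    and a: "snd s2 8 0 = ?eb * contraction ^ a" "?T \<le> a * (M + 1) + (M - slack_count s2)" by blast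
  \<comment> \<open>The last term of the budget is at most \<open>M\<close>, so more than
    \<open>(2 * M + 1) * M^2\<close> tightening rounds have taken place.\<close>
  have "?T < (a + 1) * (M + 1)" using a(2) by (simp add: algebra_simps)
  then have "(2 * M + 1) * M ^ 2 + 1 < a + 1" by (simp only: mult_less_cancel2)
  then have small: "real M ^ 2 * contraction ^ a < 1" by (intro contraction_power M) simp
  have z2: "zeros s2 = zeros s" "zeros s1 = zeros s" using es2(2) rb(2) by (simp_all add: zeros_def fun_eq_iff)
  let ?e = "snd s2 8 0"
  have b2: "base s2" and inv: "invar (zeros s2) (snd s2 6) (snd s2 7)" and e: "0 \<le> ?e"
    and eo: "eps_opt (zeros s2) (snd s2 6) (snd s2 7) ?e" using es2(1) by (auto simp: eps_state_def state_def)
  have z': "zeros u i \<longleftrightarrow> zeros s2 i \<or> snd s2 7 i > real M * ?e" if "i < M" for i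
    using that base_D[OF b2] by (simp add: u fix_zero_def run_Vec zeros_def del: run.simps(4) cong: if_cong)
  have fr: "snd u 6 = snd s2 6" "snd u 7 = snd s2 7" unfolding u by (rule rframe, simp)+
  have "base u" unfolding u by (intro base_run b2) simp
  then show "state u" using invar_fix[OF inv eo e z'] by (simp add: state_def fr)
  have keep: "settled u" if "?eb = 0"
    using rb(3)[OF that] es2(3) that by (simp add: settled_def fr)
  show "settled u" if "settled s"
    by (rule keep, rule rb(5)) (use that in \<open>simp add: settled_def\<close>)
  show "settled u \<or> free_count u < free_count s"
  proof (cases "?eb = 0")
    case False
    have "0 \<le> ?eb" using rb(1) by (simp add: eps_state_def)
    then have e0: "0 < ?eb" using False by simp
    obtain h where h: "L h" "\<forall>i<M. zeros s1 i \<longrightarrow> h i = 0" "\<forall>i<M. \<bar>h i\<bar> \<le> 1" "?eb = \<bar>\<Sum>i<M. snd s1 7 i * h i\<bar>"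
      using rb(4)[OF e0] by blast
    have hz: "\<forall>i<M. zeros s i \<longrightarrow> h i = 0" using h(2) z2 by simp
    have "(\<Sum>i<M. snd s1 7 i * h i) = (\<Sum>i<M. snd s2 7 i * h i)"
      using inv rb(1) h(1) hz z2 by (simp add: eps_state_def state_def invar_def)
    then have he: "?eb = \<bar>\<Sum>i<M. snd s2 7 i * h i\<bar>" using h(4) by simp
    have "\<exists>i<M. \<not> zeros s i \<and> snd s2 7 i > real M * ?e"
    proof (rule ccontr)
      assume no: "\<not> ?thesis"
      have "\<bar>snd s2 7 i * h i\<bar> \<le> real M * ?e" if i: "i < M" for i
      proof (cases "zeros s i")
        case True
        then show ?thesis using hz i e by simp
      next
        case False
        have "1 * ?e \<le> real M * ?e" using M e by (intro mult_right_mono) auto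
        then have "\<bar>snd s2 7 i\<bar> \<le> real M * ?e" using no False i eo z2 by (force simp: eps_opt_def)
        then have "\<bar>snd s2 7 i\<bar> * \<bar>h i\<bar> \<le> real M * ?e * 1" using h(3) i e by (intro mult_mono) auto
        then show ?thesis by (simp add: abs_mult)
      qed
      then have "\<bar>\<Sum>i<M. snd s2 7 i * h i\<bar> \<le> (\<Sum>i<M. real M * ?e)"
        by (intro order_trans[OF sum_abs] sum_mono) simp
      also have "\<dots> = ?eb * (real M ^ 2 * contraction ^ a)" by (simp add: a(1) power2_eq_square)
      also have "\<dots> < ?eb * 1" using small e0 by (intro mult_strict_left_mono)
      finally show False using he by simp
    qed
    then obtain i where i: "i < M" "\<not> zeros s i" "snd s2 7 i > real M * ?e" by blast
    have "{i. i < M \<and> \<not> zeros u i} \<subset> {i. i < M \<and> \<not> zeros s i}"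
      using z' z2 i by auto
    then have "free_count u < free_count s" unfolding free_count_def by (intro psubset_card_mono) auto
    then show ?thesis ..
  qed (use keep in blast)
qed

lemma run_lp_solve:
  fixes v :: "nat list"
  assumes s: "state s" and M: "0 < M" and cl: "clock s"
  defines "u \<equiv> run (lp_solve (length v)) v s"
  shows "feas (snd u 6)" "feas x' \<Longrightarrow> cost (snd u 6) \<le> cost x'"
proof -
  let ?l = "length v"
  have fc: "free_count w \<le> M" for w :: store
    using card_mono[of "{..<M}" "{i. i < M \<and> \<not> zeros w i}"] by (auto simp: free_count_def)
  let ?I = "\<lambda>k (w :: store). state w \<and> (settled w \<or> k + free_count w \<le> M)"
  have "?I (M + 1) u" unfolding u_def lp_solve_def
  proof (rule run_For_const[where I = ?I and c = "fst s 3"])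
    show "?I 0 s" using s fc by simp
    fix k and w :: store assume c: "fst w 3 = fst s 3" and I: "?I k w"
    have "clock w" using cl c by (simp add: clock_def)
    note ep = run_epoch[where v = "v @ [k]", OF conjunct1[OF I] M this]
    have len: "length (v @ [k]) = ?l + 1" by simp
    show "?I (Suc k) (run (epoch (?l + 1)) (v @ [k]) w)"
      using ep(1) ep(2) ep(3) I unfolding len by auto
  qed (use cl in \<open>auto simp: clock_def\<close>)
  then have st: "state u" "settled u" by auto
  then have inv: "invar (zeros u) (snd u 6) (snd u 7)" by (simp add: state_def)
  then show "feas (snd u 6)" by (simp add: invar_def)
  show "cost (snd u 6) \<le> cost x'" if "feas x'"
    by (rule invar_optimal[OF inv _ that]) (use st(2) in \<open>simp add: settled_def\<close>)
qed

end

section \<open>Computing the boundary matrix\<close>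

text \<open>Since \<open>l\<close> is distinct, the permutation carrying it to \<open>l'\<close> is
  unique, and the definite description in \<open>orientation_sign\<close> can be evaluated.\<close>

lemma orientation_sign_permute:
  assumes "distinct l" "\<pi> permutes {..<length l}" "permute_list \<pi> l = l'"
  shows "orientation_sign l l' = sign \<pi>"
proof -
  have "(THE \<pi>. \<pi> permutes {..<length l} \<and> permute_list \<pi> l = l') = \<pi>"
  proof (rule the_equality)
    fix \<rho> assume r: "\<rho> permutes {..<length l} \<and> permute_list \<rho> l = l'"
    have "\<rho> i = \<pi> i" for i
    proof (cases "i < length l")
      case True
      then have "l ! \<rho> i = l ! \<pi> i" using r assms by (metis permute_list_nth)
      moreover have "\<rho> i < length l" "\<pi> i < length l" using True r assms permutes_in_image by fastforce+
      ultimately show ?thesis using assms(1) by (simp add: nth_eq_iff_index_eq)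
    next
      case False
      then show ?thesis using r assms by (simp add: permutes_def)
    qed
    then show "\<rho> = \<pi>" by (simp add: fun_eq_iff)
  qed (use assms in simp)
  moreover have "set l = set l'" using set_permute_list[OF assms(2)] assms(3) by simp
  ultimately show ?thesis by (simp add: orientation_sign_def)
qed

lemma orientation_sign_refl: "distinct l \<Longrightarrow> orientation_sign l l = 1"
  using orientation_sign_permute[of l id l] by (simp add: permutes_id)

text \<open>A permutation from the swapped list to \<open>l'\<close>, composed with the
  transposition, leads from \<open>l\<close> to \<open>l'\<close>. If no permutation exists, the
  vertex sets differ before and after the swap, and both sides are 0.\<close>

lemma orientation_sign_swap:
  assumes l: "distinct l" "distinct l'" and ab: "a < length l" "b < length l" "a \<noteq> b"
  shows "orientation_sign l l' = - orientation_sign (l[a := l ! b, b := l ! a]) l'"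
proof -
  let ?t = "transpose a b" let ?w = "l[a := l ! b, b := l ! a]"
  have t: "?t permutes {..<length l}" using ab by (intro permutes_swap_id) auto
  have w: "permute_list ?t l = ?w"
    by (rule nth_equalityI) (use ab in \<open>auto simp: permute_list_nth[OF t] nth_list_update transpose_def\<close>)
  have sw: "set ?w = set l" "distinct ?w" using set_permute_list[OF t] distinct_permute_list[OF t] w l by simp_all
  show ?thesis
  proof (cases "set l = set l'")
    case True
    then have "mset l' = mset ?w" using sw l set_eq_iff_mset_eq_distinct by metis
    then obtain \<pi> where p: "\<pi> permutes {..<length ?w}" "permute_list \<pi> ?w = l'"
      by (rule mset_eq_permutation)
    have p': "\<pi> permutes {..<length l}" using p(1) by simp
    have "permute_list (?t \<circ> \<pi>) l = l'" using permute_list_compose[OF p'] w p(2) by simp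
    then have "orientation_sign l l' = sign (?t \<circ> \<pi>)"
      by (intro orientation_sign_permute[OF l(1)] permutes_compose p' t)
    also have "\<dots> = - sign \<pi>"
      using ab p' t by (simp add: sign_compose permutes_imp_permutation[of "{..<length l}"] sign_swap_id)
    finally show ?thesis using orientation_sign_permute[OF sw(2) p] by simp
  next
    case False
    then show ?thesis using sw by (simp add: orientation_sign_def)
  qed
qed

lemma nth_concat_uniform:
  assumes "\<forall>l\<in>set xs. length l = c" "i < length xs" "a < c"
  shows "concat xs ! (i * c + a) = xs ! i ! a \<and> i * c + a < length (concat xs)"
  using assms
proof (induction xs arbitrary: i)
  case (Cons x xs)
  then show ?case by (cases i) (auto simp: nth_append algebra_simps)
qed simp

text \<open>Selection sort of a face (array 20) into the order of the given simplex; each proper swap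
  changes the sign, and the sign becomes \<open>0\<close> if a vertex is missing.\<close>

definition sort_step :: stmt where
  "sort_step =
    Sq (Find 12 5 (IfN (NV 4) (NV 3) (RC 0)
         (IfEq (NG 20 (NV 4)) (NG 1 (NAdd (NMul (NV 0) (NG 3 (NC 5))) (NV 3))) (RC 1) (RC 0))))
   (If0 (IfN (NG 12 (NC 0)) (NG 3 (NC 5)) (RC 1) (RC 0))
     (Sq (RSet 24 (NC 0) (IfN (NV 3) (NG 12 (NC 0)) (Minus (RC 0) (scal 24)) (scal 24)))
     (Sq (NSet 21 (NC 0) (NG 20 (NV 3)))
     (Sq (NSet 20 (NV 3) (NG 20 (NG 12 (NC 0))))
         (NSet 20 (NG 12 (NC 0)) (NG 21 (NC 0))))))
     (RSet 24 (NC 0) (RC 0)))"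

text \<open>Truncated subtraction omits vertex \<open>k\<close>: the index
  \<open>a + (1 - (k - a))\<close> is \<open>a\<close> for \<open>a < k\<close> and
  \<open>a + 1\<close> otherwise.\<close>

definition face_sign :: stmt where
  "face_sign =
    Sq (For 5 (NSet 20 (NV 3)
         (NG 2 (NAdd (NMul (NV 1) (NG 3 (NC 6))) (NAdd (NV 3) (NSub (NC 1) (NSub (NV 2) (NV 3))))))))
   (Sq (RSet 24 (NC 0) (RC 1)) (For 5 sort_step))"

definition boundary_entry :: stmt where
  "boundary_entry =
    Sq (RSet 26 (NC 0) (RC 0))
   (Sq (RSet 25 (NC 0) (RC 1))
   (Sq (For 6 (Sq face_sign
        (Sq (RSet 26 (NC 0) (Plus (scal 26) (Times (scal 25) (scal 24))))
            (RSet 25 (NC 0) (Minus (RC 0) (scal 25))))))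
       (RSet 23 (NAdd (NMul (NV 0) (NG 3 (NC 4))) (NV 1)) (scal 26))))"

definition boundary_prog :: stmt where
  "boundary_prog = For 3 (For 4 boundary_entry)"

lemma boundary_writes [simp]:
  "nwrites sort_step = {12, 20, 21}" "rwrites sort_step = {24}"
  "nwrites face_sign = {12, 20, 21}" "rwrites face_sign = {24}"
  "nwrites boundary_entry = {12, 20, 21}" "rwrites boundary_entry = {23, 24, 25, 26}"
  "nwrites boundary_prog = {12, 20, 21}" "rwrites boundary_prog = {23, 24, 25, 26}"
  by (auto simp: sort_step_def face_sign_def boundary_entry_def boundary_prog_def)

locale bases =
  fixes p :: nat and Ps Qs :: "nat list list"
  assumes Ps: "\<And>l. l \<in> set Ps \<Longrightarrow> distinct l \<and> length l = p + 1"
    and Qs: "\<And>l. l \<in> set Qs \<Longrightarrow> distinct l \<and> length l = p + 2"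
begin

definition "input s \<longleftrightarrow> fst s 1 = cells (concat Ps) \<and> fst s 2 = cells (concat Qs) \<and>
   fst s 3 3 = length Ps \<and> fst s 3 4 = length Qs \<and> fst s 3 5 = p + 1 \<and> fst s 3 6 = p + 2"

lemma input_D:
  assumes "input s"
  shows "fst s 3 3 = length Ps" "fst s 3 4 = length Qs" "fst s 3 5 = Suc p" "fst s 3 6 = Suc (Suc p)"
    "i < length Ps \<Longrightarrow> a \<le> p \<Longrightarrow> fst s (Suc 0) (i + i * p + a) = Ps ! i ! a"
    "j < length Qs \<Longrightarrow> a \<le> Suc p \<Longrightarrow> fst s 2 (j + (j + j * p) + a) = Qs ! j ! a"
proof -
  show "fst s 3 3 = length Ps" "fst s 3 4 = length Qs" "fst s 3 5 = Suc p" "fst s 3 6 = Suc (Suc p)"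
    using assms by (simp_all add: input_def)
  show "fst s (Suc 0) (i + i * p + a) = Ps ! i ! a" if "i < length Ps" "a \<le> p"
    using nth_concat_uniform[of Ps "p + 1" i a] Ps that assms by (simp add: input_def cells_def)
  show "fst s 2 (j + (j + j * p) + a) = Qs ! j ! a" if "j < length Qs" "a \<le> Suc p"
    using nth_concat_uniform[of Qs "p + 2" j a] Qs that assms by (simp add: input_def cells_def)
qed

lemma input_run: "input s \<Longrightarrow> 1 \<notin> nwrites q \<Longrightarrow> 2 \<notin> nwrites q \<Longrightarrow> input (run q v s)"
  using nframe[of 1 q v s] nframe[of 2 q v s] by (simp add: input_def)

text \<open>The wanted sign is the accumulated sign times the sign of what remains to be sorted. An
  accumulated 0 is final, and nothing more is claimed of the array in that case.\<close>

definition "sort_inv l0 l' a s \<longleftrightarrow>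
  (let w = map (fst s 20) [0..<Suc p] in
     distinct w \<and> real_of_int (orientation_sign l0 l') = snd s 24 0 * real_of_int (orientation_sign w l') \<and>
     (snd s 24 0 = 0 \<or> (\<forall>b<a. fst s 20 b = l' ! b)))"

lemma run_sort_step:
  assumes s: "input s" and i: "i < length Ps" and a: "a \<le> p" and inv: "sort_inv l0 (Ps ! i) a s"
  shows "sort_inv l0 (Ps ! i) (Suc a) (run sort_step [i, j, k, a] s)"
proof -
  let ?W = "fst s 20" let ?l = "Ps ! i" let ?w = "map ?W [0..<Suc p]"
  let ?P = "\<lambda>b. a \<le> b \<and> ?W b = ?l ! a"
  let ?b = "first_below (Suc p) ?P"
  have l: "distinct ?l" "length ?l = Suc p" using Ps[OF nth_mem[OF i]] by simp_all
  have w: "distinct ?w" and o: "real_of_int (orientation_sign l0 ?l) = snd s 24 0 * real_of_int (orientation_sign ?w ?l)"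
    and pre: "snd s 24 0 = 0 \<or> (\<forall>b<a. ?W b = ?l ! b)" using inv by (simp_all add: sort_inv_def Let_def del: upt_Suc)
  let ?f = "Find 12 5 (IfN (NV 4) (NV 3) (RC 0)
         (IfEq (NG 20 (NV 4)) (NG 1 (NAdd (NMul (NV 0) (NG 3 (NC 5))) (NV 3))) (RC 1) (RC 0)))"
  have f: "run ?f [i, j, k, a] s = iput 12 0 ?b s"
    using input_D[OF s] i a
    by simp (intro arg_cong2[where f="iput 12 0"] arg_cong2[where f=first_below] refl ext, auto)
  let ?u = "run sort_step [i, j, k, a] s"
  show ?thesis
  proof (cases rule: first_below_cases[of "Suc p" ?P])
    case 1
    have u: "?u = rput 24 0 0 (iput 12 0 ?b s)"
      using f 1(1) input_D[OF s] unfolding sort_step_def run.simps(5) f by simp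
    have "real_of_int (orientation_sign l0 ?l) = 0"
    proof (cases "snd s 24 0 = 0")
      case False
      \<comment> \<open>The search covers positions from \<open>a\<close> on. Earlier positions hold
        earlier vertices of the distinct list \<open>?l\<close>, so the vertex is missing altogether
        and the vertex sets differ.\<close>
      have "?l ! a \<notin> set ?w"
      proof
        assume "?l ! a \<in> set ?w"
        then obtain b where b: "b < Suc p" "?W b = ?l ! a" by (auto simp del: upt_Suc)
        then have "\<not> a \<le> b" using 1(2)[of b] by simp
        then have "?l ! b = ?l ! a" "b < a" using pre False b by auto
        then show False using l a by (simp add: nth_eq_iff_index_eq)
      qed
      moreover have "?l ! a \<in> set ?l" using l a by simp
      ultimately have "set ?w \<noteq> set ?l" by metis
      then have "orientation_sign ?w ?l = 0" by (simp only: orientation_sign_def if_False)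
      then show ?thesis using o by simp
    qed (use o in simp)
    then show ?thesis using w by (simp add: u sort_inv_def Let_def del: upt_Suc)
  next
    case 2
    have b: "?b < Suc p" "a \<le> ?b" "?W ?b = ?l ! a" using 2 by auto
    define b where "b = ?b"
    note b = b[folded b_def]
    let ?c = "if a < b then - snd s 24 0 else snd s 24 0"
    let ?W' = "?W(a := ?W b, b := ?W a)"
    have u: "fst ?u 20 = ?W'" "snd ?u 24 0 = ?c"
      using input_D[OF s] b unfolding sort_step_def run.simps(5) f b_def[symmetric]
      by (auto simp: fun_eq_iff)
    have w': "map ?W' [0..<Suc p] = ?w[a := ?w ! b, b := ?w ! a]"
      by (rule nth_equalityI) (use a b in \<open>auto simp: nth_list_update simp del: upt_Suc\<close>)
    have "distinct (map ?W' [0..<Suc p]) \<and>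
       real_of_int (orientation_sign l0 ?l) = ?c * real_of_int (orientation_sign (map ?W' [0..<Suc p]) ?l)"
    proof (cases "a < b")
      case True
      have ab: "a < length ?w" "b < length ?w" "a \<noteq> b" using a b True by simp_all
      have "distinct (map ?W' [0..<Suc p])" unfolding w' using w ab by (subst distinct_swap) auto
      then show ?thesis using orientation_sign_swap[OF w l(1) ab] o True unfolding w' by simp
    next
      case False
      then have ab: "a = b" using b(2) by simp
      have "?W' = ?W" by (simp add: ab)
      then show ?thesis using w o False by (simp only: if_False)
    qed
    moreover have "?c = 0 \<or> (\<forall>d<Suc a. ?W' d = ?l ! d)"
      using pre b by (auto simp: less_Suc_eq)
    ultimately show ?thesis unfolding sort_inv_def Let_def u by blast
  qed
qed

definition "face k (l :: nat list) = take k l @ drop (Suc k) l"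

lemma face_props:
  assumes "distinct l" "length l = Suc (Suc p)" "k \<le> Suc p"
  shows "distinct (face k l)" "length (face k l) = Suc p"
    "a \<le> p \<Longrightarrow> face k l ! a = l ! (a + (1 - (k - a)))"
proof -
  show "distinct (face k l)" unfolding face_def using assms(1)
    by (simp add: set_take_disj_set_drop_if_distinct)
  show "length (face k l) = Suc p" unfolding face_def using assms by simp
  show "a \<le> p \<Longrightarrow> face k l ! a = l ! (a + (1 - (k - a)))"
    unfolding face_def using assms by (cases "a < k") (auto simp: nth_append)
qed

lemma run_face_sign:
  assumes s: "input s" and i: "i < length Ps" and j: "j < length Qs" and k: "k \<le> Suc p"
  shows "snd (run face_sign [i, j, k] s) 24 0 = real_of_int (orientation_sign (face k (Qs ! j)) (Ps ! i))"
proof -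
  let ?l = "Qs ! j"
  have l: "distinct ?l" "length ?l = Suc (Suc p)" using Qs[OF nth_mem[OF j]] by simp_all
  note fp = face_props[OF l k]
  let ?c = "For 5 (NSet 20 (NV 3)
         (NG 2 (NAdd (NMul (NV 1) (NG 3 (NC 6))) (NAdd (NV 3) (NSub (NC 1) (NSub (NV 2) (NV 3)))))))"
  define s1 where "s1 = run ?c [i, j, k] s"
  have "input s1 \<and> (\<forall>a<p + 1. fst s1 20 a = face k ?l ! a)"
    unfolding s1_def
  proof (rule run_For_const[where I = "\<lambda>a u. input u \<and> (\<forall>b<a. fst u 20 b = face k ?l ! b)" and c = "fst s 3"])
    fix a and u :: store assume a: "a < p + 1" and I: "input u \<and> (\<forall>b<a. fst u 20 b = face k ?l ! b)"
    let ?p = "NSet 20 (NV 3) (NG 2 (NAdd (NMul (NV 1) (NG 3 (NC 6))) (NAdd (NV 3) (NSub (NC 1) (NSub (NV 2) (NV 3))))))"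
    have iu: "input u" using I by simp
    have ap: "a \<le> p" using a by simp
    have le: "a + (1 - (k - a)) \<le> Suc p" using ap by simp
    have "fst u 2 (j * Suc (Suc p) + (a + (1 - (k - a)))) = ?l ! (a + (1 - (k - a)))"
      using input_D(6)[OF iu j le] by simp
    then have "run ?p ([i, j, k] @ [a]) u = iput 20 a (face k ?l ! a) u"
      using fp(3)[OF ap] by (simp add: input_D(4)[OF iu])
    then show "input (run ?p ([i, j, k] @ [a]) u) \<and> (\<forall>b<Suc a. fst (run ?p ([i, j, k] @ [a]) u) 20 b = face k ?l ! b)"
      using I by (auto simp: less_Suc_eq input_def)
  qed (use s input_D(3)[OF s] in auto)
  then have s1: "input s1" "\<And>a. a < Suc p \<Longrightarrow> fst s1 20 a = face k ?l ! a" by auto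
  define s2 where "s2 = run (RSet 24 (NC 0) (RC 1)) [i, j, k] s1"
  have w: "map (fst s2 20) [0..<Suc p] = face k ?l"
    by (rule nth_equalityI) (use s1(2) fp(2) in \<open>auto simp: s2_def simp del: upt_Suc\<close>)
  have is2: "input s2" unfolding s2_def by (rule input_run[OF s1(1)]) auto
  define u where "u = run (For 5 sort_step) [i, j, k] s2"
  have "input u \<and> sort_inv (face k ?l) (Ps ! i) (p + 1) u"
    unfolding u_def
  proof (rule run_For_const[where I = "\<lambda>a u. input u \<and> sort_inv (face k ?l) (Ps ! i) a u" and c = "fst s2 3"])
    show "input s2 \<and> sort_inv (face k ?l) (Ps ! i) 0 s2"
      using is2 fp(1) unfolding sort_inv_def Let_def w by (simp add: s2_def)
    fix a and t :: store assume a: "a < p + 1" and I: "input t \<and> sort_inv (face k ?l) (Ps ! i) a t"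
    have "a \<le> p" using a by simp
    then show "input (run sort_step ([i, j, k] @ [a]) t) \<and> sort_inv (face k ?l) (Ps ! i) (Suc a) (run sort_step ([i, j, k] @ [a]) t)"
      using I run_sort_step[OF _ i] by (auto intro: input_run)
  qed (use input_D(3)[OF is2] in simp_all)
  then have inv: "sort_inv (face k ?l) (Ps ! i) (Suc p) u" by simp
  have lp: "distinct (Ps ! i)" "length (Ps ! i) = Suc p" using Ps[OF nth_mem[OF i]] by simp_all
  have "real_of_int (orientation_sign (face k ?l) (Ps ! i)) = snd u 24 0"
  proof (cases "snd u 24 0 = 0")
    case False
    then have "map (fst u 20) [0..<Suc p] = Ps ! i"
      using inv lp by (intro nth_equalityI) (auto simp: sort_inv_def Let_def simp del: upt_Suc)
    then show ?thesis using inv orientation_sign_refl[OF lp(1)] by (simp add: sort_inv_def Let_def del: upt_Suc)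
  qed (use inv in \<open>simp add: sort_inv_def Let_def del: upt_Suc\<close>)
  moreover have "run face_sign [i, j, k] s = u"
    by (simp only: face_sign_def run.simps(5) u_def s2_def s1_def)
  ultimately show ?thesis by simp
qed

lemma run_boundary_entry:
  assumes s: "input s" and i: "i < length Ps" and j: "j < length Qs"
  shows "snd (run boundary_entry [i, j] s) 23 =
    (snd s 23)(i * length Qs + j := real_of_int (boundary_coeff (Ps ! i) (Qs ! j)))"
proof -
  let ?l = "Qs ! j"
  define s1 where "s1 = run (RSet 25 (NC 0) (RC 1)) [i, j] (run (RSet 26 (NC 0) (RC 0)) [i, j] s)"
  let ?p = "Sq face_sign (Sq (RSet 26 (NC 0) (Plus (scal 26) (Times (scal 25) (scal 24))))
            (RSet 25 (NC 0) (Minus (RC 0) (scal 25))))"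
  have i1: "input s1" unfolding s1_def by (intro input_run s) auto
  define u where "u = run (For 6 ?p) [i, j] s1"
  let ?I = "\<lambda>k (u :: store). input u \<and> snd u 23 = snd s 23 \<and> snd u 25 0 = (-1) ^ k \<and>
      snd u 26 0 = (\<Sum>k<k. (-1) ^ k * real_of_int (orientation_sign (face k ?l) (Ps ! i)))"
  have "?I (p + 2) u"
    unfolding u_def
  proof (rule run_For_const[where I = ?I and c = "fst s1 3"])
    show "?I 0 s1" using i1 by (simp add: s1_def)
    fix k and t :: store assume k: "k < p + 2" and I: "?I k t"
    let ?t = "run face_sign [i, j, k] t"
    have kp: "k \<le> Suc p" using k by simp
    have it: "input ?t" by (rule input_run) (use I in auto)
    have fr: "snd ?t 23 = snd t 23" "snd ?t 25 = snd t 25" "snd ?t 26 = snd t 26" by (rule rframe, simp)+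
    have sg: "snd ?t 24 0 = real_of_int (orientation_sign (face k ?l) (Ps ! i))"
      using run_face_sign[OF _ i j kp] I by blast
    have "input (run ?p ([i, j] @ [k]) t)" by (rule input_run) (use I in auto)
    then show "?I (Suc k) (run ?p ([i, j] @ [k]) t)" using I by (simp add: fr sg)
  qed (use input_D(4)[OF i1] in simp_all)
  then have u: "input u" "snd u 23 = snd s 23"
    "snd u 26 0 = (\<Sum>k<Suc (Suc p). (-1) ^ k * real_of_int (orientation_sign (face k ?l) (Ps ! i)))" by simp_all
  have "snd u 26 0 = real_of_int (boundary_coeff (Ps ! i) ?l)"
    using Qs[OF nth_mem[OF j]] by (simp add: u(3) boundary_coeff_def face_def)
  moreover have "run boundary_entry [i, j] s =
      run (RSet 23 (NAdd (NMul (NV 0) (NG 3 (NC 4))) (NV 1)) (scal 26)) [i, j] u"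
    by (simp only: boundary_entry_def run.simps(5) u_def s1_def)
  ultimately show ?thesis using u input_D(2)[OF u(1)] by simp
qed

lemma run_boundary_prog:
  assumes s: "input s"
  defines "u \<equiv> run boundary_prog [] s"
  shows "i < length Ps \<Longrightarrow> j < length Qs \<Longrightarrow> snd u 23 (i * length Qs + j) = real_of_int (boundary_coeff (Ps ! i) (Qs ! j))"
proof -
  let ?n = "length Qs"
  let ?f = "\<lambda>i j. real_of_int (boundary_coeff (Ps ! i) (Qs ! j))"
  let ?I = "\<lambda>i (u :: store). input u \<and> (\<forall>i'<i. \<forall>j<?n. snd u 23 (i' * ?n + j) = ?f i' j)"
  have "?I (length Ps) u" unfolding u_def boundary_prog_def
  proof (rule run_For_const[where I = ?I and c = "fst s 3"])
    show "?I 0 s" using s by simp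
    fix i and t :: store assume i: "i < length Ps" and I: "?I i t"
    have it: "input t" using I by simp
    note ip = i
    let ?J = "\<lambda>j (u :: store). ?I i u \<and> (\<forall>j'<j. snd u 23 (i * ?n + j') = ?f i j')"
    have "?J ?n (run (For 4 boundary_entry) ([] @ [i]) t)"
    proof (rule run_For_const[where I = ?J and c = "fst t 3"])
      show "?J 0 t" using I by simp
      fix j and w :: store assume j: "j < ?n" and J: "?J j w"
      have iw: "input w" using J by simp
      note jn = j
      have e: "run boundary_entry (([] @ [i]) @ [j]) w = run boundary_entry [i, j] w" by simp
      have inj: "i' * ?n + j' = i * ?n + j \<longleftrightarrow> i' = i \<and> j' = j" if "j' < ?n" for i' j'
        using cell_div_mod[OF that, of i'] cell_div_mod[OF jn, of i] by metis
      have "input (run boundary_entry [i, j] w)" by (rule input_run[OF iw]) auto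
      then show "?J (Suc j) (run boundary_entry (([] @ [i]) @ [j]) w)"
        unfolding e run_boundary_entry[OF iw ip jn] using J jn
        by (auto simp: inj less_Suc_eq)
    qed (use input_D(2)[OF it] in simp_all)
    then show "?I (Suc i) (run (For 4 boundary_entry) ([] @ [i]) t)" by (auto simp: less_Suc_eq)
  qed (use input_D(1)[OF s] in simp_all)
  then show "i < length Ps \<Longrightarrow> j < length Qs \<Longrightarrow> snd u 23 (i * length Qs + j) = ?f i j" by blast
qed

end

section \<open>The linear program of a chain\<close>

lemma sum_lessThan_add: "(\<Sum>j<a + b. f j) = (\<Sum>j<a. f j) + (\<Sum>j<b. f (a + j))"
  for f :: "nat \<Rightarrow> 'a :: comm_monoid_add"
  by (induction b) (simp_all add: add.assoc)

text \<open>The blocks of variables are \<open>b\<close> (negative part of the chain), \<open>p\<close>, \<open>q\<close> and \<open>a\<close> (positive part). The first three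
  are free and determine \<open>a = b + B (p - q)\<close> up to the translation by \<open>c\<close>.\<close>

definition lp_matrix :: "nat \<Rightarrow> nat \<Rightarrow> (nat \<Rightarrow> nat \<Rightarrow> real) \<Rightarrow> nat \<Rightarrow> nat \<Rightarrow> real" where
  "lp_matrix m n B i j =
    (if i < m + 2 * n then if i = j then 1 else 0
     else if j < m then if i - (m + 2 * n) = j then 1 else 0
     else if j < m + n then B (i - (m + 2 * n)) (j - m)
     else - B (i - (m + 2 * n)) (j - m - n))"

lemma lp_matrix_mult:
  shows "i < m + 2 * n \<Longrightarrow> (\<Sum>j<m + 2 * n. lp_matrix m n B i j * z j) = z i"
    "k < m \<Longrightarrow> (\<Sum>j<m + 2 * n. lp_matrix m n B (m + 2 * n + k) j * z j) =
       z k + (\<Sum>j<n. B k j * (z (m + j) - z (m + n + j)))"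
proof -
  show "(\<Sum>j<m + 2 * n. lp_matrix m n B i j * z j) = z i" if "i < m + 2 * n"
    using that by (simp add: lp_matrix_def if_distrib[of "\<lambda>x. x * _"] cong: if_cong)
  assume k: "k < m"
  let ?A = "lp_matrix m n B (m + 2 * n + k)"
  have "(\<Sum>j<m + 2 * n. ?A j * z j) = (\<Sum>j<m. ?A j * z j) + (\<Sum>j<n. ?A (m + j) * z (m + j)) +
      (\<Sum>j<n. ?A (m + n + j) * z (m + n + j))"
    using sum_lessThan_add[of "\<lambda>j. ?A j * z j" m "n + n"] sum_lessThan_add[of "\<lambda>j. ?A (m + j) * z (m + j)" n n]
    by (simp add: mult_2 add.assoc)
  also have "(\<Sum>j<m. ?A j * z j) = z k"
    using k by (simp add: lp_matrix_def if_distrib[of "\<lambda>x. x * _"] cong: if_cong)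
  finally show "(\<Sum>j<m + 2 * n. ?A j * z j) = z k + (\<Sum>j<n. B k j * (z (m + j) - z (m + n + j)))"
    by (simp add: lp_matrix_def right_diff_distrib sum_subtractf sum_negf)
qed

definition lp_row :: "nat \<Rightarrow> nat \<Rightarrow> (nat \<Rightarrow> nat \<Rightarrow> real) \<Rightarrow> (nat \<Rightarrow> real) \<Rightarrow> nat \<Rightarrow> real" where
  "lp_row m n B z i = (if i < m + 2 * n then z i else z (i - (m + 2 * n)) +
     (\<Sum>j<n. B (i - (m + 2 * n)) j * (z (m + j) - z (m + n + j))))"

text \<open>Everything reduces to integrality of \<open>y = p - q\<close>. Its entries are known to
  be integral where \<open>F\<close> contains both \<open>p\<close> and \<open>q\<close>; the
  others, \<open>J\<close>, are constrained by the rows \<open>I\<close> whose \<open>a\<close> and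
  \<open>b\<close> both lie in \<open>F\<close>. Since \<open>F\<close> is determining, these rows
  are injective on \<open>J\<close>, and total unimodularity applies. Each remaining variable is
  then recovered from its partner in \<open>F\<close>.\<close>

lemma lp_integral:
  fixes BM :: "int mat" and h z :: "nat \<Rightarrow> real"
  defines "m \<equiv> dim_row BM" and "n \<equiv> dim_col BM"
  defines "B \<equiv> \<lambda>i j. real_of_int (BM $$ (i, j))"
  defines "R \<equiv> lp_row m n B"
  assumes tu: "totally_unimodular BM" and F: "F \<subseteq> {..<2 * m + 2 * n}"
    and int: "\<And>i. i \<in> F \<Longrightarrow> R z i \<in> \<int>"
    and det: "\<And>z i. (\<And>i. i \<in> F \<Longrightarrow> R z i = 0) \<Longrightarrow> i < 2 * m + 2 * n \<Longrightarrow> R z i = 0"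
    and i: "i < 2 * m + 2 * n"
  shows "R z i \<in> \<int>"
proof -
  let ?N = "m + 2 * n"
  have R_eq: "R z i = (if i < ?N then z i else z (i - ?N) + (\<Sum>j<n. B (i - ?N) j * (z (m + j) - z (m + n + j))))" for z i
    by (simp add: R_def lp_row_def)
  \<comment> \<open>Raising \<open>p\<close> and \<open>q\<close> of the same index together changes
    no other coordinate, so a determining set must meet the pair.\<close>
  have F_pq: "m + j \<in> F \<or> m + n + j \<in> F" if j: "j < n" for j
  proof (rule ccontr)
    assume no: "\<not> ?thesis"
    let ?z = "\<lambda>i. if i = m + j \<or> i = m + n + j then 1 else 0 :: real"
    have "?z (m + k) = ?z (m + n + k)" if "k < n" for k using that j by auto
    then have Rz: "R ?z i = (if i < ?N then ?z i else ?z (i - ?N))" for i by (simp add: R_eq)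
    have "R ?z (m + j) = 0"
    proof (rule det)
      fix i assume "i \<in> F"
      then have "i < 2 * m + 2 * n" "i \<noteq> m + j" "i \<noteq> m + n + j" using no F by auto
      then show "R ?z i = 0" using j unfolding Rz by auto
    qed (use j in simp)
    then show False using j by (simp add: R_eq)
  qed
  \<comment> \<open>The same argument for the pair \<open>b\<close>, \<open>a\<close> of a
    row.\<close>
  have F_ab: "k \<in> F \<or> ?N + k \<in> F" if k: "k < m" for k
  proof (rule ccontr)
    assume no: "\<not> ?thesis"
    let ?z = "\<lambda>i. if i = k then 1 else 0 :: real"
    have Rz: "R ?z i = (if i < ?N then ?z i else ?z (i - ?N))" for i using k by (simp add: R_eq)
    have "R ?z k = 0"
    proof (rule det)
      fix i assume "i \<in> F"
      moreover from this have "i \<noteq> k" "i \<noteq> ?N + k" using no by auto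
      ultimately show "R ?z i = 0" unfolding Rz by auto
    qed (use k in simp)
    then show False using k by (simp add: R_eq)
  qed
  define y where "y j = z (m + j) - z (m + n + j)" for j
  define J where "J = {j. j < n \<and> \<not> (m + j \<in> F \<and> m + n + j \<in> F)}"
  define I where "I = {i. i < m \<and> i \<in> F \<and> ?N + i \<in> F}"
  have Bint: "B k j \<in> \<int>" for k j by (simp add: B_def)
  have split: "(\<Sum>j<n. f j) = (\<Sum>j\<in>J. f j) + (\<Sum>j\<in>{..<n} - J. f j)" for f :: "nat \<Rightarrow> real"
    using sum.subset_diff[of J "{..<n}" f] by (auto simp: J_def add.commute)
  have ynJ: "y j \<in> \<int>" if "j \<in> {..<n} - J" for j
    using int[of "m + j"] int[of "m + n + j"] that by (auto simp: y_def J_def R_eq)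
  have yJ: "y j \<in> \<int>" if "j \<in> J" for j
  proof (rule totally_unimodular_integral[OF tu, of I J y j])
    show "I \<subseteq> {..<dim_row BM}" "J \<subseteq> {..<dim_col BM}" by (auto simp: I_def J_def m_def n_def)
    show "(\<Sum>j\<in>J. real_of_int (BM $$ (k, j)) * y j) \<in> \<int>" if k: "k \<in> I" for k
    proof -
      have "(\<Sum>j\<in>J. B k j * y j) = R z (?N + k) - R z k - (\<Sum>j\<in>{..<n} - J. B k j * y j)"
        using k split[of "\<lambda>j. B k j * y j"] by (simp add: R_eq I_def y_def)
      also have "\<dots> \<in> \<int>" using int k ynJ Bint by (intro Ints_diff Ints_sum Ints_mult) (auto simp: I_def)
      finally show ?thesis by (simp add: B_def)
    qed
    fix u :: "nat \<Rightarrow> real"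
    assume u: "\<And>k. k \<in> I \<Longrightarrow> (\<Sum>j\<in>J. real_of_int (BM $$ (k, j)) * u j) = 0"
    \<comment> \<open>A kernel vector \<open>u\<close> of the rows \<open>I\<close> is lifted to a
      vector of the subspace that vanishes on \<open>F\<close>: each \<open>u j\<close> goes to
      whichever of \<open>p\<close> and \<open>q\<close> is outside \<open>F\<close>, and each free
      \<open>b\<close> absorbs its row sum so that the \<open>a\<close> of this row becomes
      0.\<close>
    define w where "w i = (if i < m then if i \<in> F then 0 else - (\<Sum>j\<in>J. B i j * u j)
       else if i < m + n then if i - m \<in> J \<and> i \<notin> F then u (i - m) else 0
       else if i - m - n \<in> J \<and> i - n \<in> F then - u (i - m - n) else 0)" for i
    have wy: "w (m + j) - w (m + n + j) = (if j \<in> J then u j else 0)" if "j < n" for j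
      using that F_pq[OF that] by (auto simp: w_def)
    have wsum: "(\<Sum>j<n. B k j * (w (m + j) - w (m + n + j))) = (\<Sum>j\<in>J. B k j * u j)" for k
    proof -
      have "(\<Sum>j<n. B k j * (w (m + j) - w (m + n + j))) = (\<Sum>j<n. if j \<in> J then B k j * u j else 0)"
        by (intro sum.cong) (auto simp: wy)
      also have "\<dots> = (\<Sum>j\<in>J. B k j * u j)"
        by (subst sum.inter_restrict[symmetric]) (auto simp: J_def intro!: sum.cong)
      finally show ?thesis .
    qed
    have R0: "R w i = 0" if iF: "i \<in> F" for i
    proof (cases "i < ?N")
      case True
      have "i - n \<notin> F" if "i - m - n \<in> J" "m + n \<le> i"
      proof -
        have "i = m + n + (i - m - n)" "i - n = m + (i - m - n)" using that(2) by simp_all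
        then show ?thesis using that(1) iF unfolding J_def by (metis (no_types, lifting) mem_Collect_eq)
      qed
      then show ?thesis using True iF by (auto simp: R_eq w_def)
    next
      case False
      define k where "k = i - ?N"
      have ik: "i = ?N + k" using False by (simp add: k_def)
      have "R w i = w k + (\<Sum>j\<in>J. B k j * u j)" using False by (simp add: R_eq wsum k_def)
      also have "\<dots> = 0"
      proof -
        have "k < m" using F iF ik by auto
        then show ?thesis using u[of k] iF ik by (auto simp: w_def I_def B_def)
      qed
      finally show ?thesis .
    qed
    show "\<forall>j\<in>J. u j = 0"
    proof
      fix j assume j: "j \<in> J"
      then have jn: "j < n" by (simp add: J_def)
      have "R w (m + j) = 0" "R w (m + n + j) = 0" using R0 jn by (auto intro: det)
      then have "w (m + j) - w (m + n + j) = 0" using jn by (simp add: R_eq)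
      then show "u j = 0" using wy[OF jn] j by simp
    qed
  qed (use that in simp)
  have yint: "y j \<in> \<int>" if "j < n" for j using ynJ yJ that by blast
  have tint: "z k \<in> \<int>" if k: "k < m" for k
  proof (cases "k \<in> F")
    case True
    then show ?thesis using int[OF True] k by (simp add: R_eq)
  next
    case False
    then have "R z (?N + k) \<in> \<int>" using F_ab[OF k] int by blast
    moreover have "z k = R z (?N + k) - (\<Sum>j<n. B k j * y j)" by (simp add: R_eq y_def)
    moreover have "(\<Sum>j<n. B k j * y j) \<in> \<int>" using yint Bint by (intro Ints_sum Ints_mult) auto
    ultimately show ?thesis by simp
  qed
  have pq: "z (m + j) \<in> \<int> \<and> z (m + n + j) \<in> \<int>" if j: "j < n" for j
  proof -
    have "z (m + j) \<in> \<int> \<or> z (m + n + j) \<in> \<int>"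
      using F_pq[OF j] int[of "m + j"] int[of "m + n + j"] j by (auto simp: R_eq)
    moreover have "z (m + j) = z (m + n + j) + y j" "z (m + n + j) = z (m + j) - y j" by (simp_all add: y_def)
    ultimately show ?thesis using yint[OF j] by (metis Ints_add Ints_diff)
  qed
  show ?thesis
  proof (cases "i < ?N")
    case True
    consider "i < m" | j where "i = m + j" "j < n" | j where "i = m + n + j" "j < n"
    proof -
      have "i < m \<or> i = m + (i - m) \<and> i - m < n \<or> i = m + n + (i - m - n) \<and> i - m - n < n" using True by auto
      then show ?thesis using that by blast
    qed
    then have "z i \<in> \<int>" using tint pq by cases auto
    then show ?thesis using True by (simp add: R_eq)
  next
    case False
    have "(\<Sum>j<n. B (i - ?N) j * y j) \<in> \<int>" using yint Bint by (intro Ints_sum Ints_mult) auto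
    moreover have "z (i - ?N) \<in> \<int>" using tint False i by auto
    ultimately show ?thesis using False by (simp add: R_eq y_def)
  qed
qed

lemma totally_unimodular_entry:
  assumes tu: "totally_unimodular B" and ij: "i < dim_row B" "j < dim_col B"
  shows "\<bar>B $$ (i, j)\<bar> \<le> 1"
proof -
  let ?S = "submatrix B {i} {j}"
  have e: "{k. k < dim_row B \<and> k \<in> {i}} = {i}" "{k. k < dim_col B \<and> k \<in> {j}} = {j}" using ij by auto
  have c: "?S \<in> carrier_mat 1 1" by (rule carrier_matI) (simp_all only: dim_submatrix e, simp_all)
  have "det ?S = ?S $$ (0, 0)" by (rule det_single[OF c])
  also have "\<dots> = B $$ (pick {i} 0, pick {j} 0)"
    by (rule submatrix_index) (simp_all only: e, simp_all)
  also have "\<dots> = B $$ (i, j)"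
  proof -
    have "(LEAST a. a = k) = k" for k :: nat by (rule Least_equality) auto
    then show ?thesis by simp
  qed
  finally have "det ?S = B $$ (i, j)" .
  moreover have "{i} \<subseteq> {..<dim_row B} \<and> {j} \<subseteq> {..<dim_col B} \<and> card {i} = card {j}" using ij by simp
  then have "det ?S \<in> {0, 1, -1}" using tu unfolding totally_unimodular_def by blast
  ultimately show ?thesis by auto
qed

context unimodular_lp
begin

lemma invar_start:
  assumes "\<And>i. i < M \<Longrightarrow> 0 \<le> x0 i \<and> x0 i \<in> \<int>"
  shows "invar (\<lambda>_. False) x0 g"
proof -
  have "L (\<lambda>i. x0 i - x0 i)" unfolding L_def by (intro exI[of _ "\<lambda>_. 0"]) simp
  then show ?thesis using assms by (auto simp: invar_def feas_def)
qed

end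

abbreviation "Pos e \<equiv> IfR (RC 0) e e (RC 0)"
abbreviation "cm \<equiv> NG 3 (NC 3)"
abbreviation "cn \<equiv> NG 3 (NC 4)"

definition lp_setup :: stmt where
  "lp_setup =
    Sq (Map2 4 1 2 (IfN (NV 0) cN (IfEq (NV 0) (NV 1) (RC 1) (RC 0))
          (IfN (NV 1) cm (IfEq (NSub (NV 0) cN) (NV 1) (RC 1) (RC 0))
            (IfN (NV 1) (NAdd cm cn)
              (RG 23 (NAdd (NMul (NSub (NV 0) cN) cn) (NSub (NV 1) cm)))
              (Minus (RC 0) (RG 23 (NAdd (NMul (NSub (NV 0) cN) cn) (NSub (NSub (NV 1) cm) cn))))))))
   (Sq (Vec 6 1 (IfN (NV 1) cm (Pos (Minus (RC 0) (RG 0 (NV 1))))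
          (IfN (NV 1) cN (RC 0) (Pos (RG 0 (NSub (NV 1) cN))))))
       (Vec 7 1 (IfN (NV 1) cm (AbsX (RG 1 (NV 1)))
          (IfN (NV 1) cN (RC 0) (AbsX (RG 1 (NSub (NV 1) cN)))))))"

definition lp_output :: stmt where
  "lp_output =
    Sq (Vec 2 3 (Minus (RG 6 (NAdd cN (NV 1))) (RG 6 (NV 1))))
       (Vec 3 4 (Minus (RG 6 (NAdd cm (NV 1))) (RG 6 (NAdd (NAdd cm cn) (NV 1)))))"

definition ohcp_prog :: stmt where
  "ohcp_prog = Sq boundary_prog (Sq lp_setup (Sq (lp_solve 0) lp_output))"

lemma writes_ohcp [simp]:
  "nwrites lp_setup = {}" "rwrites lp_setup = {4, 6, 7}"
  "nwrites (lp_solve l) = {5, 10, 11}" "9 \<notin> rwrites lp_setup"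
  by (auto simp: lp_setup_def lp_solve_def epoch_def improve_def)

section \<open>The loop bounds and their size\<close>

primrec iputs :: "(nat \<times> iexp) list \<Rightarrow> com" where
  "iputs [] = Skip"
| "iputs (x # xs) = Seq (IPut 3 (IConst (fst x)) (snd x)) (iputs xs)"

primrec iputs_run :: "(nat \<times> iexp) list \<Rightarrow> store \<Rightarrow> store" where
  "iputs_run [] s = s"
| "iputs_run (x # xs) s = iputs_run xs (iput 3 (fst x) (ival (snd x) s) s)"

primrec iputs_cost :: "(nat \<times> iexp) list \<Rightarrow> nat" where
  "iputs_cost [] = 1"
| "iputs_cost (x # xs) = (2 + icost (snd x)) + iputs_cost xs"

lemma iputs_exec: "exec (iputs xs) s (iputs_cost xs) (iputs_run xs s)"
proof (induction xs arbitrary: s)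
  case (Cons x xs)
  have "exec (IPut 3 (IConst (fst x)) (snd x)) s (2 + icost (snd x)) (iput 3 (fst x) (ival (snd x) s) s)"
    by (rule exec_IPut') simp_all
  from exec.Seq[OF this Cons] show ?case by simp
qed (simp add: exec.Skip[unfolded One_nat_def])

abbreviation "kget a k \<equiv> IGet a (IConst k)"
abbreviation "kM \<equiv> kget 3 1"

text \<open>These assignments are plain machine code because compiled programs cannot write array 3.
  The order matters: \<open>M\<close> in cell 1 is computed from cells 3 and 4, and the bounds after
  it use \<open>M\<close>.\<close>

definition constants :: "(nat \<times> iexp) list" where
  "constants =
    [(0, IConst 1), (3, kget 0 1), (4, kget 0 2), (5, IAdd (kget 0 0) (IConst 1)), (6, IAdd (kget 0 0) (IConst 2)),
     (1, IAdd (IMul (IConst 2) (kget 3 3)) (IMul (IConst 2) (kget 3 4))),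
     (2, IAdd (kget 3 3) (IMul (IConst 2) (kget 3 4))),
     (7, IMul (IConst 4) (IMul kM (IMul kM (IMul kM (IMul kM kM))))),
     (8, IMul (IAdd (IMul (IAdd (IMul (IConst 2) kM) (IConst 1)) (IMul kM kM)) (IConst 1)) (IAdd kM (IConst 1))),
     (9, IAdd kM (IConst 1)), (10, IConst 2)]"

definition ohcp_code :: com where
  "ohcp_code = Seq (iputs constants) (scode ohcp_prog 0)"

lemma run_constants:
  fixes p m n :: nat and rs :: "nat \<Rightarrow> nat \<Rightarrow> real"
  assumes "fst s 0 0 = p" "fst s 0 1 = m" "fst s 0 2 = n" "fst s 3 = (\<lambda>_. 0)"
  defines "M \<equiv> 2 * m + 2 * n" and "u \<equiv> iputs_run constants s"
  shows "fst u 3 0 = 1" "fst u 3 1 = M" "fst u 3 2 = m + 2 * n" "fst u 3 3 = m" "fst u 3 4 = n"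
    "fst u 3 5 = p + 1" "fst u 3 6 = p + 2" "fst u 3 7 = 4 * M ^ 5"
    "fst u 3 8 = ((2 * M + 1) * M ^ 2 + 1) * (M + 1)" "fst u 3 9 = M + 1" "fst u 3 10 = 2"
    "\<And>k. 10 < k \<Longrightarrow> fst u 3 k = 0" "snd u = snd s" "\<And>a. a \<noteq> 3 \<Longrightarrow> fst u a = fst s a"
proof -
  have p5: "x ^ 5 = x * (x * (x * (x * x)))" for x :: nat by (simp add: eval_nat_numeral)
  note [simp] = u_def M_def constants_def power2_eq_square p5 assms(1-4) assms(2)[unfolded One_nat_def]
  show "fst u 3 0 = 1" "fst u 3 1 = M" "fst u 3 2 = m + 2 * n" "fst u 3 3 = m" "fst u 3 4 = n"
    "fst u 3 5 = p + 1" "fst u 3 6 = p + 2" "fst u 3 7 = 4 * M ^ 5"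
    "fst u 3 8 = ((2 * M + 1) * M ^ 2 + 1) * (M + 1)" "fst u 3 9 = M + 1" "fst u 3 10 = 2" by simp_all
  show "\<And>k. 10 < k \<Longrightarrow> fst u 3 k = 0" "snd u = snd s" "\<And>a. a \<noteq> 3 \<Longrightarrow> fst u a = fst s a" by simp_all
qed

text \<open>From \<open>M \<le> 4 * D\<close> the perceptron bound \<open>4 * M^5\<close> is at most
  \<open>4 * 4^5 = 4096\<close> times the fifth power. The rounds of an epoch are of fourth order
  only.\<close>

lemma constants_bound:
  assumes D: "m \<le> D" "n \<le> D" "p + 2 \<le> D"
  defines "M \<equiv> 2 * m + 2 * (n :: nat)"
  shows "1 \<le> 4096 * (D + 1) ^ 5" "M + 1 \<le> 4096 * (D + 1) ^ 5" "m + 2 * n \<le> 4096 * (D + 1) ^ 5"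
    "p + 2 \<le> 4096 * (D + 1) ^ 5" "4 * M ^ 5 \<le> 4096 * (D + 1) ^ 5"
    "((2 * M + 1) * M ^ 2 + 1) * (M + 1) \<le> 4096 * (D + 1) ^ 5"
proof -
  let ?E = "D + 1"
  have E1: "?E \<le> ?E ^ 5" using power_increasing[of 1 5 ?E] by simp
  have E4: "?E ^ 4 \<le> ?E ^ 5" by (rule power_increasing) simp_all
  have e4: "128 * (e * e ^ 2) * (4 * e) = 512 * e ^ 4" for e :: nat
    by (simp add: power2_eq_square power4_eq_xxxx)
  have M4: "M \<le> 4 * D" using D by (simp add: M_def)
  show "1 \<le> 4096 * ?E ^ 5" "M + 1 \<le> 4096 * ?E ^ 5" "m + 2 * n \<le> 4096 * ?E ^ 5" "p + 2 \<le> 4096 * ?E ^ 5"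
    using D E1 M4 by linarith+
  have "M ^ 5 \<le> (4 * ?E) ^ 5" using M4 by (intro power_mono) auto
  also have "\<dots> = 4 ^ 5 * ?E ^ 5" by (rule power_mult_distrib)
  also have "\<dots> = 1024 * ?E ^ 5" by (simp only: power_numeral_even power_numeral_odd) simp
  finally show "4 * M ^ 5 \<le> 4096 * ?E ^ 5" by linarith
  have "(2 * M + 1) * M ^ 2 \<le> (8 * ?E) * (4 * D) ^ 2" using M4 by (intro mult_mono power_mono) auto
  also have "\<dots> = 128 * (?E * D ^ 2)" by (simp add: power_mult_distrib algebra_simps)
  finally have "(2 * M + 1) * M ^ 2 + 1 \<le> 128 * (?E * D ^ 2) + 1" by simp
  also have "\<dots> \<le> 128 * (?E * ?E ^ 2)" by (simp add: power2_eq_square algebra_simps)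
  finally have "((2 * M + 1) * M ^ 2 + 1) * (M + 1) \<le> 128 * (?E * ?E ^ 2) * (4 * ?E)"
    using M4 by (intro mult_mono) auto
  also have "\<dots> = 512 * ?E ^ 4" by (rule e4)
  also have "\<dots> \<le> 4096 * ?E ^ 5" using E4 by (intro mult_mono) auto
  finally show "((2 * M + 1) * M ^ 2 + 1) * (M + 1) \<le> 4096 * ?E ^ 5" .
qed

lemma constants_poly:
  assumes s: "fst s 0 0 = p" "fst s 0 1 = m" "fst s 0 2 = n" "fst s 3 = (\<lambda>_. 0)"
    and D: "m \<le> D" "n \<le> D" "p + 2 \<le> D"
  shows "fst (iputs_run constants s) 3 k \<le> poly ([:4096:] * [:1, 1:] ^ 5) D"
proof -
  note r = run_constants[OF s]
  note b = constants_bound[OF D]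
  consider "k = 0" | "k = 1" | "k = 2" | "k = 3" | "k = 4" | "k = 5" | "k = 6" | "k = 7" | "k = 8" | "k = 9" | "k = 10" | "10 < k" by atomize_elim arith
  then have "fst (iputs_run constants s) 3 k \<le> 4096 * (D + 1) ^ 5"
  proof cases
    case 1
    show ?thesis unfolding 1 r(1) using b(1) by linarith
  next
    case 2
    show ?thesis unfolding 2 r(2) using b(2) by linarith
  next
    case 3
    show ?thesis unfolding 3 r(3) using b(3) by linarith
  next
    case 4
    show ?thesis unfolding 4 r(4) using b(3) by linarith
  next
    case 5
    show ?thesis unfolding 5 r(5) using b(3) by linarith
  next
    case 6
    show ?thesis unfolding 6 r(6) using b(4) by linarith
  next
    case 7
    show ?thesis unfolding 7 r(7) using b(4) by linarith
  next
    case 8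
    show ?thesis unfolding 8 r(8) using b(5) by linarith
  next
    case 9
    show ?thesis unfolding 9 r(9) using b(6) by linarith
  next
    case 10
    show ?thesis unfolding 10 r(10) using b(2) by linarith
  next
    case 11
    show ?thesis unfolding 11 r(11) using b(4) by linarith
  next
    case 12
    then show ?thesis by (simp add: r(12))
  qed
  then show ?thesis by (simp add: add.commute)
qed

section \<open>From chains to the program and back\<close>

definition ohcp_g :: "nat \<Rightarrow> nat \<Rightarrow> (nat \<Rightarrow> real) \<Rightarrow> nat \<Rightarrow> real" where
  "ohcp_g m n w i = (if i < m then \<bar>w i\<bar> else if i < m + 2 * n then 0 else \<bar>w (i - (m + 2 * n))\<bar>)"

definition split_vec :: "nat \<Rightarrow> nat \<Rightarrow> (nat \<Rightarrow> real) \<Rightarrow> (nat \<Rightarrow> real) \<Rightarrow> nat \<Rightarrow> real" where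
  "split_vec m n x y i =
    (if i < m then max 0 (- x i) else if i < m + n then max 0 (y (i - m))
     else if i < m + 2 * n then max 0 (- y (i - m - n)) else max 0 (x (i - (m + 2 * n))))"

lemma sum_blocks:
  fixes f :: "nat \<Rightarrow> 'a :: comm_monoid_add"
  assumes "\<And>i. m \<le> i \<Longrightarrow> i < m + 2 * n \<Longrightarrow> f i = 0"
  shows "(\<Sum>i<2 * m + 2 * n. f i) = (\<Sum>k<m. f k + f (m + 2 * n + k))"
proof -
  have "(\<Sum>i<2 * m + 2 * n. f i) = (\<Sum>i<(m + 2 * n) + m. f i)" by (simp add: mult_2 ac_simps)
  also have "\<dots> = (\<Sum>k<m. f k) + (\<Sum>j<2 * n. f (m + j)) + (\<Sum>k<m. f (m + 2 * n + k))"
    by (simp only: sum_lessThan_add)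
  also have "(\<Sum>j<2 * n. f (m + j)) = 0" using assms by (intro sum.neutral) auto
  finally show ?thesis by (simp add: sum.distrib)
qed

lemma unimodular_lp_ohcp:
  fixes BM :: "int mat"
  defines "m \<equiv> dim_row BM" and "n \<equiv> dim_col BM"
  defines "A \<equiv> lp_matrix m n (\<lambda>i j. real_of_int (BM $$ (i, j)))"
  assumes tu: "totally_unimodular BM"
  shows "unimodular_lp (2 * m + 2 * n) (m + 2 * n) A (ohcp_g m n w)"
proof unfold_locales
  let ?M = "2 * m + 2 * n" let ?N = "m + 2 * n"
  let ?B = "\<lambda>i j. real_of_int (BM $$ (i, j))"
  let ?R = "lp_row m n ?B"
  have R: "(\<Sum>j<?N. A i j * z j) = ?R z i" if "i < ?M" for z i
    using lp_matrix_mult(1)[of i m n ?B z] lp_matrix_mult(2)[of "i - ?N" m n ?B z] that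
    by (auto simp: A_def lp_row_def)
  show "?N \<le> ?M" by simp
  show "A i j = (if i = j then 1 else 0)" if "i < ?N" "j < ?N" for i j
    using that by (simp add: A_def lp_matrix_def)
  show "\<bar>A i j\<bar> \<le> 1" if "i < ?M" "j < ?N" for i j
  proof -
    have "\<bar>?B k l\<bar> \<le> 1" if "k < m" "l < n" for k l
      using totally_unimodular_entry[OF tu, of k l] that by (simp add: m_def n_def flip: of_int_abs)
    then show ?thesis using that by (auto simp: A_def lp_matrix_def)
  qed
  show "0 \<le> ohcp_g m n w i" if "i < ?M" for i by (simp add: ohcp_g_def)
  fix F :: "nat set" and h i
  assume F: "F \<subseteq> {..<?M}" and h: "\<exists>z. \<forall>i<?M. h i = (\<Sum>j<?N. A i j * z j)" and int: "\<forall>i\<in>F. h i \<in> \<int>"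
    and det: "\<And>h'. \<exists>z. \<forall>i<?M. h' i = (\<Sum>j<?N. A i j * z j) \<Longrightarrow> \<forall>i\<in>F. h' i = 0 \<Longrightarrow> \<forall>i<?M. h' i = 0"
    and i: "i < ?M"
  obtain z where z: "\<And>i. i < ?M \<Longrightarrow> h i = ?R z i" using h R by auto
  have zint: "?R z k \<in> \<int>" if "k \<in> F" for k
  proof -
    have "k < ?M" using that F by blast
    from z[OF this] show ?thesis using int that by metis
  qed
  have zdet: "?R z' k = 0" if z': "\<And>k. k \<in> F \<Longrightarrow> ?R z' k = 0" and k: "k < ?M" for z' k
  proof -
    have "\<exists>z. \<forall>i<?M. ?R z' i = (\<Sum>j<?N. A i j * z j)" using R by (intro exI[of _ z']) simp
    from det[OF this] z' k show ?thesis by blast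
  qed
  have "?R z i \<in> \<int>"
    unfolding m_def n_def
    by (rule lp_integral[OF tu]) (fact F[unfolded m_def n_def], fact zint[unfolded m_def n_def],
      fact zdet[unfolded m_def n_def], fact i[unfolded m_def n_def])
  then show "h i \<in> \<int>" using z[OF i] by simp
qed

lemma run_lp_setup:
  fixes s :: store
  assumes c: "fst s 3 0 = 1" "fst s 3 1 = 2 * m + 2 * n" "fst s 3 2 = m + 2 * n" "fst s 3 3 = m" "fst s 3 4 = n"
    and B: "\<forall>i<m. \<forall>j<n. snd s 23 (i * n + j) = B i j"
  defines "u \<equiv> run lp_setup [] s"
  shows "i < 2 * m + 2 * n \<Longrightarrow> j < m + 2 * n \<Longrightarrow> snd u 4 (i * (m + 2 * n) + j) = lp_matrix m n B i j"
    "i < 2 * m + 2 * n \<Longrightarrow> snd u 6 i = split_vec m n (snd s 0) (\<lambda>_. 0) i"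
    "i < 2 * m + 2 * n \<Longrightarrow> snd u 7 i = ohcp_g m n (snd s 1) i"
proof -
  note [simp] = c c(2)[unfolded One_nat_def]
  show "snd u 4 (i * (m + 2 * n) + j) = lp_matrix m n B i j" if ij: "i < 2 * m + 2 * n" "j < m + 2 * n"
  proof -
    have "i * (m + 2 * n) + j < (2 * m + 2 * n) * (m + 2 * n)" by (rule cell_less[OF ij])
    moreover have "snd s 23 ((i - (m + 2 * n)) * n + (j - m)) = B (i - (m + 2 * n)) (j - m)"
      if "\<not> i < m + 2 * n" "\<not> j < m" "j < m + n" using that ij by (intro B[rule_format]) auto
    moreover have "snd s 23 ((i - (m + 2 * n)) * n + (j - m - n)) = B (i - (m + 2 * n)) (j - m - n)"
      if "\<not> i < m + 2 * n" "\<not> j < m + n" using that ij by (intro B[rule_format]) auto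
    ultimately show ?thesis using cell_div_mod[OF ij(2), of i]
      by (auto simp: u_def lp_setup_def lp_matrix_def)
  qed
  show "snd u 6 i = split_vec m n (snd s 0) (\<lambda>_. 0) i" if "i < 2 * m + 2 * n"
    using that by (auto simp: u_def lp_setup_def split_vec_def max_def)
  show "snd u 7 i = ohcp_g m n (snd s 1) i" if "i < 2 * m + 2 * n"
    using that by (auto simp: u_def lp_setup_def ohcp_g_def)
qed

lemma run_lp_output:
  fixes s :: store
  assumes c: "fst s 3 0 = 1" "fst s 3 2 = m + 2 * n" "fst s 3 3 = m" "fst s 3 4 = n"
  defines "u \<equiv> run lp_output [] s"
  shows "i < m \<Longrightarrow> snd u 2 i = snd s 6 (m + 2 * n + i) - snd s 6 i"
    "j < n \<Longrightarrow> snd u 3 j = snd s 6 (m + j) - snd s 6 (m + n + j)"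
  using c by (auto simp: u_def lp_output_def)

lemma ohcp_objective_diagonal:
  assumes "W \<in> carrier_mat m m" "diagonal_mat W" "x \<in> carrier_vec m"
  shows "ohcp_objective W x = (\<Sum>i<m. \<bar>W $$ (i, i)\<bar> * \<bar>real_of_int (x $ i)\<bar>)"
proof -
  have "(W *\<^sub>v map_vec real_of_int x) $ i = W $$ (i, i) * real_of_int (x $ i)" if i: "i < m" for i
  proof -
    have "(W *\<^sub>v map_vec real_of_int x) $ i = (\<Sum>j<m. W $$ (i, j) * real_of_int (x $ j))"
      using i assms by (simp add: scalar_prod_def lessThan_atLeast0)
    also have "\<dots> = (\<Sum>j<m. if j = i then W $$ (i, i) * real_of_int (x $ i) else 0)"
      using assms(1,2) i by (intro sum.cong) (auto simp: diagonal_mat_def)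
    finally show ?thesis using i by simp
  qed
  then show ?thesis using assms by (simp add: ohcp_objective_def l1_norm_def abs_mult)
qed

text \<open>The cost of the computed solution bounds its objective from above, since the absolute
  value of \<open>a - b\<close> is at most \<open>a + b\<close>. A competing chain is split into
  positive and negative parts, for which cost and objective agree. The two comparisons enclose the
  optimality of the linear program.\<close>

lemma ohcp_prog_correct:
  fixes Ps Qs :: "nat list list" and s :: store
  defines "m \<equiv> length Ps" and "n \<equiv> length Qs" and "BM \<equiv> boundary_matrix Ps Qs"
  assumes bases: "bases p Ps Qs" and n0: "0 < n" and tu: "totally_unimodular BM"
    and c: "c \<in> carrier_vec m" and W: "W \<in> carrier_mat m m" "diagonal_mat W"
    and s: "s = iputs_run constants (ohcp_input p Ps Qs c W)"
  defines "u \<equiv> run ohcp_prog [] s"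
  shows "\<exists>x y. ohcp_output u x y \<and> ohcp_optimal BM c W x y"
proof -
  let ?M = "2 * m + 2 * n" let ?N = "m + 2 * n"
  let ?B = "\<lambda>i j. real_of_int (BM $$ (i, j))"
  let ?A = "lp_matrix m n ?B"
  let ?L = "\<lambda>h. \<exists>z. \<forall>i<?M. h i = (\<Sum>j<?N. ?A i j * z j)"
  let ?w = "\<lambda>i. W $$ (i, i)" let ?c = "\<lambda>i. real_of_int (c $ i)"
  have dim: "dim_row BM = m" "dim_col BM = n" by (simp_all add: BM_def boundary_matrix_def m_def n_def)
  define x0 where "x0 = split_vec m n ?c (\<lambda>_. 0)"
  let ?g = "ohcp_g m n ?w"
  interpret lp: unimodular_lp ?M ?N ?A ?L x0 ?g
    by (rule unimodular_lp_ohcp[OF tu, of ?w, unfolded dim])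
  interpret bases p Ps Qs by fact
  let ?i = "ohcp_input p Ps Qs c W"
  have i0: "fst ?i 0 0 = p" "fst ?i 0 1 = m" "fst ?i 0 2 = n" "fst ?i 3 = (\<lambda>_. 0)"
    by (simp_all add: ohcp_input_def cells_def m_def n_def fun_eq_iff)
  note k = run_constants[OF i0, folded s]
  have sc: "snd s 0 i = ?c i" "snd s 1 i = ?w i" if "i < m" for i
    using that c W by (simp_all add: k(13) ohcp_input_def cells_def diag_mat_def)
  have s9: "snd s 9 = (\<lambda>_. 0)" by (simp add: k(13) ohcp_input_def cells_def fun_eq_iff)
  have inp: "input s" by (simp add: input_def k(14) ohcp_input_def k m_def n_def)
  define s1 where "s1 = run boundary_prog [] s"
  have s1: "\<forall>i<m. \<forall>j<n. snd s1 23 (i * n + j) = ?B i j"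
    using run_boundary_prog[OF inp] by (simp add: s1_def BM_def boundary_matrix_def m_def n_def)
  have s1f: "snd s1 0 = snd s 0" "snd s1 1 = snd s 1" "snd s1 9 = snd s 9" unfolding s1_def by (rule rframe, simp)+
  have s1c: "fst s1 3 = fst s 3" by (simp add: s1_def)
  define s2 where "s2 = run lp_setup [] s1"
  note st = run_lp_setup[where s = s1, unfolded s1c, OF k(1-5) s1, folded s2_def]
  have s2c: "fst s2 3 = fst s 3" by (simp add: s2_def s1c)
  have x0: "snd s2 6 i = x0 i" if "i < ?M" for i
    using st(2)[OF that] that sc(1) by (auto simp: x0_def split_vec_def s1f)
  have g0: "snd s2 7 i = ?g i" if "i < ?M" for i
    using st(3)[OF that] that sc(2) by (auto simp: ohcp_g_def s1f s1f[unfolded One_nat_def])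
  have z0: "lp.zeros s2 i = False" for i
    by (simp add: lp.zeros_def s2_def rframe s1f s9)
  have x0int: "0 \<le> x0 i \<and> x0 i \<in> \<int>" if "i < ?M" for i
    by (auto simp: x0_def split_vec_def max_def)
  have "lp.base s2" using k(1-11) st(1) by (simp add: lp.base_def lp.consts_def lp.matA_def s2c)
  moreover have "lp.invar (lp.zeros s2) (snd s2 6) (snd s2 7)"
    by (rule lp.invar_cong[OF lp.invar_start[OF x0int]]) (simp_all add: x0 g0 z0)
  ultimately have state: "lp.state s2" by (simp add: lp.state_def)
  have M0: "0 < ?M" using n0 by simp
  have clock: "lp.clock s2" using k(8,9,10) by (simp add: lp.clock_def s2c)
  define s3 where "s3 = run (lp_solve 0) [] s2"
  let ?X = "snd s3 6"
  note sol = lp.run_lp_solve[where v = "[]", OF state M0 clock, unfolded list.size, folded s3_def]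
  have s3c: "fst s3 3 = fst s 3" by (simp add: s3_def s2c)
  have u: "u = run lp_output [] s3" by (simp add: u_def ohcp_prog_def s3_def s2_def s1_def)
  note out = run_lp_output[where s = s3, unfolded s3c, OF k(1,3,4,5), folded u]
  have X: "0 \<le> ?X i" "?X i \<in> \<int>" if "i < ?M" for i using sol(1) that by (auto simp: lp.feas_def)
  \<comment> \<open>The floors are exact, because the solution of the program is integral.\<close>
  define x where "x = vec m (\<lambda>i. \<lfloor>?X (?N + i) - ?X i\<rfloor>)"
  define y where "y = vec n (\<lambda>j. \<lfloor>?X (m + j) - ?X (m + n + j)\<rfloor>)"
  have xi: "real_of_int (x $ i) = ?X (?N + i) - ?X i" if "i < m" for i
    using X(2)[of i] X(2)[of "?N + i"] that by (simp add: x_def Ints_diff)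
  have yj: "real_of_int (y $ j) = ?X (m + j) - ?X (m + n + j)" if "j < n" for j
    using X(2)[of "m + j"] X(2)[of "m + n + j"] that by (simp add: y_def Ints_diff)
  have outp: "ohcp_output u x y" 
  proof -
    have "dim_vec x = m" "dim_vec y = n" by (simp_all add: x_def y_def)
    then show ?thesis using out xi yj by (simp only: ohcp_output_def) simp
  qed
  have x0d: "x0 (?N + i) - x0 i = ?c i" if "i < m" for i
    using that by (simp add: x0_def split_vec_def max_def)
  have x0y: "x0 (m + j) = 0" "x0 (m + n + j) = 0" if "j < n" for j
    using that by (simp_all add: x0_def split_vec_def)
  have Bv: "real_of_int ((BM *\<^sub>v v) $ i) = (\<Sum>j<n. ?B i j * real_of_int (v $ j))" if "i < m" "v \<in> carrier_vec n" for i v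
    using that dim by (simp add: scalar_prod_def lessThan_atLeast0)
  have feas: "ohcp_feasible BM c x y" unfolding ohcp_feasible_def
  proof (intro conjI)
    show "x \<in> carrier_vec (dim_row BM)" "y \<in> carrier_vec (dim_col BM)" by (simp_all add: dim x_def y_def)
    obtain z where z: "\<And>i. i < ?M \<Longrightarrow> ?X i - x0 i = (\<Sum>j<?N. ?A i j * z j)" using sol(1) by (auto simp: lp.feas_def)
    have zi: "z i = ?X i - x0 i" if "i < ?N" for i using z[of i] that by (simp add: lp_matrix_mult)
    show "x = c + BM *\<^sub>v y"
    proof (rule eq_vecI)
      show "dim_vec x = dim_vec (c + BM *\<^sub>v y)" by (simp add: x_def dim)
      fix i assume "i < dim_vec (c + BM *\<^sub>v y)"
      then have i: "i < m" by (simp add: dim)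
      have "?X (?N + i) - x0 (?N + i) = z i + (\<Sum>j<n. ?B i j * (z (m + j) - z (m + n + j)))"
        using z[of "?N + i"] i by (simp add: lp_matrix_mult)
      also have "(\<Sum>j<n. ?B i j * (z (m + j) - z (m + n + j))) = (\<Sum>j<n. ?B i j * real_of_int (y $ j))"
        by (intro sum.cong refl) (simp add: zi x0y yj)
      finally have "real_of_int (x $ i) = real_of_int (c $ i) + real_of_int ((BM *\<^sub>v y) $ i)"
        using xi[OF i] x0d[OF i] zi[of i] i Bv[of i y] by (simp add: y_def)
      then have "real_of_int (x $ i) = real_of_int ((c + BM *\<^sub>v y) $ i)" using i dim by simp
      then show "x $ i = (c + BM *\<^sub>v y) $ i" by (simp only: of_int_eq_iff)
    qed
  qed
  have cost: "lp.cost v = (\<Sum>k<m. \<bar>?w k\<bar> * (v k + v (?N + k)))" for v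
    unfolding lp.cost_def by (subst sum_blocks) (auto simp: ohcp_g_def distrib_left intro!: sum.cong)
  have "ohcp_objective W x \<le> ohcp_objective W x'" if f: "ohcp_feasible BM c x' y'" for x' y'
  proof -
    have x': "x' \<in> carrier_vec m" and y': "y' \<in> carrier_vec n" and eq: "x' = c + BM *\<^sub>v y'"
      using f unfolding ohcp_feasible_def dim by blast+
    define X' where "X' = split_vec m n (\<lambda>i. real_of_int (x' $ i)) (\<lambda>j. real_of_int (y' $ j))"
    have row: "X' (?N + i) - x0 (?N + i) = (\<Sum>j<?N. ?A (?N + i) j * (X' j - x0 j))" if i: "i < m" for i
    proof -
      have "(\<Sum>j<?N. ?A (?N + i) j * (X' j - x0 j)) =
          (X' i - x0 i) + (\<Sum>j<n. ?B i j * ((X' (m + j) - x0 (m + j)) - (X' (m + n + j) - x0 (m + n + j))))"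
        using lp_matrix_mult(2)[OF i, of n ?B "\<lambda>j. X' j - x0 j"] by simp
      also have "(\<Sum>j<n. ?B i j * ((X' (m + j) - x0 (m + j)) - (X' (m + n + j) - x0 (m + n + j)))) =
          (\<Sum>j<n. ?B i j * real_of_int (y' $ j))"
        by (intro sum.cong refl) (auto simp: x0y X'_def split_vec_def max_def)
      also have "\<dots> = real_of_int (x' $ i) - ?c i" using Bv[OF i y'] eq i dim by simp
      also have "X' i - x0 i + (real_of_int (x' $ i) - ?c i) = X' (?N + i) - x0 (?N + i)"
        using x0d[OF i] i by (auto simp: X'_def split_vec_def max_def)
      finally show ?thesis by simp
    qed
    have "lp.feas X'" unfolding lp.feas_def
    proof (intro conjI allI impI)
      fix i assume "i < ?M"
      show "0 \<le> X' i" "X' i \<in> \<int>" by (auto simp: X'_def split_vec_def max_def)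
    next
      show "?L (\<lambda>i. X' i - x0 i)"
      proof (intro exI[of _ "\<lambda>j. X' j - x0 j"] allI impI)
        fix i assume i: "i < ?M"
        show "X' i - x0 i = (\<Sum>j<?N. ?A i j * (X' j - x0 j))"
          using row[of "i - ?N"] i by (cases "i < ?N") (auto simp: lp_matrix_mult)
      qed
    qed
    then have "lp.cost ?X \<le> lp.cost X'" by (rule sol(2))
    moreover have "lp.cost X' = ohcp_objective W x'"
      unfolding cost ohcp_objective_diagonal[OF W x']
      by (intro sum.cong) (auto simp: X'_def split_vec_def max_def)
    moreover have "ohcp_objective W x \<le> lp.cost ?X"
    proof -
      have "x \<in> carrier_vec m" by (simp add: x_def)
      then have "ohcp_objective W x = (\<Sum>i<m. \<bar>?w i\<bar> * \<bar>?X (?N + i) - ?X i\<bar>)"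
        using ohcp_objective_diagonal[OF W] xi by simp
      also have "\<dots> \<le> (\<Sum>i<m. \<bar>?w i\<bar> * (?X i + ?X (?N + i)))"
      proof (intro sum_mono mult_left_mono)
        fix i assume "i \<in> {..<m}"
        then show "\<bar>?X (?N + i) - ?X i\<bar> \<le> ?X i + ?X (?N + i)" using X(1)[of i] X(1)[of "?N + i"] by auto
      qed simp
      finally show ?thesis by (simp add: cost)
    qed
    ultimately show ?thesis by linarith
  qed
  then show ?thesis using outp feas by (auto simp: ohcp_optimal_def)
qed

text \<open>A simplex of dimension above \<open>p\<close> has at least \<open>p + 2\<close>
  vertices, and each vertex is itself a simplex; this bounds the loops over vertices. It also has a
  face with \<open>p + 2\<close> vertices, so \<open>Qs\<close> is not empty and the program has at
  least one variable.\<close>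

lemma complex_sizes:
  assumes K: "finite K" "simplicial_complex K" "int p < complex_dim K"
    and Ps: "oriented_basis K p Ps" and Qs: "oriented_basis K (p + 1) Qs"
  shows "bases p Ps Qs" "0 < length Qs" "length Ps \<le> card K" "length Qs \<le> card K" "p + 2 \<le> card K"
proof -
  have basis: "distinct l \<and> length l = q + 1" if "oriented_basis K q L" "l \<in> set L" for q L l
  proof -
    have "distinct l" "card (set l) = q + 1" using that by (auto simp: oriented_basis_def)
    then show ?thesis using distinct_card[of l] by simp
  qed
  show "bases p Ps Qs" by unfold_locales (use basis[OF Ps] basis[OF Qs] in auto)
  have len: "length L \<le> card K" if "oriented_basis K q L" for q L
  proof -
    have "length L = card (set ` set L)"
      using that distinct_card[of "map set L"] by (simp add: oriented_basis_def)
    also have "\<dots> \<le> card K" using that K(1) by (intro card_mono) (auto simp: oriented_basis_def)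
    finally show ?thesis .
  qed
  show "length Ps \<le> card K" "length Qs \<le> card K" by (rule len[OF Ps], rule len[OF Qs])
  have "p + 1 < Max (insert 0 (card ` K))" using K(3) by (simp add: complex_dim_def)
  moreover have "Max (insert 0 (card ` K)) \<in> insert 0 (card ` K)" using K(1) by (intro Max_in) auto
  ultimately obtain s where s: "s \<in> K" "p + 2 \<le> card s" by auto
  have fs: "finite s" using K(2) s(1) by (simp add: simplicial_complex_def)
  have sub: "t \<in> K" if "t \<subseteq> s" "t \<noteq> {}" for t using K(2) s(1) that unfolding simplicial_complex_def by blast
  have "card s = card ((\<lambda>v. {v}) ` s)" by (simp add: card_image)
  also have "\<dots> \<le> card K" using K(1) sub by (intro card_mono) auto
  finally show "p + 2 \<le> card K" using s(2) by simp
  obtain t where t: "t \<subseteq> s" "card t = p + 2" using obtain_subset_with_card_n[OF s(2)] by blast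
  then have "t \<in> K" by (intro sub) auto
  then have "t \<in> set ` set Qs" using Qs t by (simp add: oriented_basis_def)
  then show "0 < length Qs" by auto
qed

theorem theorem3p6:
  shows "\<exists>(prog :: com) (T :: nat poly).
    \<forall>(K :: nat set set) (p :: nat) (Ps :: nat list list) (Qs :: nat list list).
      finite K \<and> simplicial_complex K \<and> complex_dim K > int p \<and>
      oriented_basis K p Ps \<and> oriented_basis K (p + 1) Qs \<and>
      totally_unimodular (boundary_matrix Ps Qs)
      \<longrightarrow> (\<forall>(c :: int vec) (W :: real mat).
            c \<in> carrier_vec (length Ps) \<and>
            W \<in> carrier_mat (length Ps) (length Ps) \<and> diagonal_mat W
            \<longrightarrow> (\<exists>N t x y.
                  exec prog (ohcp_input p Ps Qs c W) N t \<and>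
                  N \<le> poly T (card K) \<and>
                  ohcp_output t x y \<and>
                  ohcp_optimal (boundary_matrix Ps Qs) c W x y))"
proof -
  \<comment> \<open>The polynomial is fixed before any complex is given: it depends only on the
    program text and on the bound for array 3.\<close>
  obtain T where T: "\<And>D n. (\<And>b. n b \<le> poly ([:4096:] * [:1, 1:] ^ 5) D) \<Longrightarrow> scost ohcp_prog n \<le> poly T D"
    using scost_poly[of "[:4096:] * [:1, 1:] ^ 5" ohcp_prog] by blast
  show ?thesis
  proof (intro exI[of _ ohcp_code] exI[of _ "[:iputs_cost constants:] + T"] allI impI, elim conjE)
    fix K p Ps Qs and c :: "int vec" and W :: "real mat"
    assume K: "finite K" "simplicial_complex K" "int p < complex_dim K"
      "oriented_basis K p Ps" "oriented_basis K (p + 1) Qs" and tu: "totally_unimodular (boundary_matrix Ps Qs)"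
      and c: "c \<in> carrier_vec (length Ps)" and W: "W \<in> carrier_mat (length Ps) (length Ps)" "diagonal_mat W"
    note sz = complex_sizes[OF K]
    let ?i = "ohcp_input p Ps Qs c W"
    define s where "s = iputs_run constants ?i"
    let ?u = "run ohcp_prog [] s"
    have i0: "fst ?i 0 0 = p" "fst ?i 0 1 = length Ps" "fst ?i 0 2 = length Qs" "fst ?i 3 = (\<lambda>_. 0)"
      by (simp_all add: ohcp_input_def cells_def fun_eq_iff)
    obtain N t where run: "exec (scode ohcp_prog 0) s N t" "N \<le> scost ohcp_prog (fst s 3)"
      "\<forall>a<100. fst t a = fst ?u a \<and> snd t a = snd ?u a" using run_exec by blast
    have "scost ohcp_prog (fst s 3) \<le> poly T (card K)"
      unfolding s_def by (rule T) (rule constants_poly[OF i0 sz(3-5)])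
    then have "iputs_cost constants + N \<le> poly ([:iputs_cost constants:] + T) (card K)" using run(2) by simp
    moreover have "exec ohcp_code ?i (iputs_cost constants + N) t"
      unfolding ohcp_code_def by (rule exec.Seq[OF iputs_exec run(1)[unfolded s_def]])
    moreover obtain x y where xy: "ohcp_output ?u x y" "ohcp_optimal (boundary_matrix Ps Qs) c W x y"
      using ohcp_prog_correct[OF sz(1,2) tu c W s_def] by blast
    moreover have "ohcp_output t x y" using xy(1) run(3) by (simp add: ohcp_output_def)
    ultimately show "\<exists>N t x y. exec ohcp_code ?i N t \<and> N \<le> poly ([:iputs_cost constants:] + T) (card K) \<and>
        ohcp_output t x y \<and> ohcp_optimal (boundary_matrix Ps Qs) c W x y" by blast
  qed
qed

end
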